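(* Let $n\ge 3$ and let $g$ be a $C^2$ Riemannian metric on $M^n=\mathbb R^n\setminus B(1)$ (equivalently, defined near infinity of $\mathbb R^n$), written in the standard coordinates $x=(x^1,\dots,x^n)$ as $g=g_{ij}\,dx^i dx^j$, such that $g_{ij}-\delta_{ij}=o_2(|x|^{-\frac{n-2}{2}})$. Then: (a) $\displaystyle\lim_{r\to\infty}\big(\mathfrak{m}(r)-\mathfrak{m}_{I}(r)\big)=0$. (b) If in addition the Regge–Teitelboim condition $g_{ij}^{\mathrm{odd}}(x)=o_2(|x|^{-\frac n2})$ holds for all $i,j$ (and $\mathfrak m\neq 0$, so that the quantities below are defined), then $\displaystyle\lim_{r\to\infty}\big(\mathbf{c}_{CS}(r)-\mathbf{c}_{I}(r)\big)=0$.
   Context: Summation over repeated indices is used; commas denote partial derivatives in the coordinates $x^i$. $B(r)=\{|x|<r\}$, $S_r=\partial B(r)$. A function $f$ near infinity satisfies $f=o_k(|x|^{-\tau})$ if $f\in C^k$ and $|x|^{|\alpha|+\tau}|\partial^\alpha f(x)|\to 0$ as $x\to\infty$ for all multi-indices $|\alpha|\le k$. For a function $f$, $f^{\mathrm{odd}}(x)=\tfrac12(f(x)-f(-x))$. On $S_r$, $\nu_e,d\sigma_e$ are the Euclidean unit outward normal and area element, and $\nu_g,d\sigma_g$ those with respect to $g$; $\omega_{n-1}$ is the area of the unit sphere in $\mathbb R^n$. $\mathrm{Ric}$ and $R_g$ are the Ricci tensor and scalar curvature of $g$. Define $\mathfrak m(r)=\frac{1}{2(n-1)\omega_{n-1}}\int_{S_r}(g_{ij,j}-g_{jj,i})\nu_e^i\,d\sigma_e$,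 with $\mathfrak m=\lim_{r\to\infty}\mathfrak m(r)$ (ADM mass) when the limit exists; $\mathfrak m_I(r)=\frac{1}{(n-1)(2-n)\omega_{n-1}}\int_{S_r}\big(\mathrm{Ric}-\tfrac12R_g g\big)(X,\nu_g)\,d\sigma_g$, where $X=x^i\partial_{x^i}$. For $\alpha=1,\dots,n$: $c^\alpha_{CS}(r)=\frac{1}{2(n-1)\omega_{n-1}\mathfrak m}\int_{S_r}\big[x^\alpha(g_{ij,i}-g_{ii,j})\nu_e^j-(g_{i\alpha}\nu_e^i-g_{ii}\nu_e^\alpha)\big]d\sigma_e$, $c^\alpha_{I}(r)=\frac{1}{2(n-1)(n-2)\omega_{n-1}\mathfrak m}\int_{S_r}\big(\mathrm{Ric}-\tfrac12R_g g\big)(Y_{(\alpha)},\nu_g)\,d\sigma_g$, where $Y_{(\alpha)}=(|x|^2\delta^{\alpha i}-2x^\alpha x^i)\partial_{x^i}$; $\mathbf c_{CS}(r)=(c^1_{CS}(r),\dots,c^n_{CS}(r))$ and $\mathbf c_I(r)=(c^1_I(r),\dots,c^n_I(r))$. *)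

theory Defs
  imports "HOL-Analysis.Analysis"
begin

definition pd :: "'n::finite \<Rightarrow> (real^'n \<Rightarrow> real) \<Rightarrow> real^'n \<Rightarrow> real" where
  "pd i f x = deriv (\<lambda>t. f (x + t *\<^sub>R axis i 1)) 0"

fun pds :: "'n::finite list \<Rightarrow> (real^'n \<Rightarrow> real) \<Rightarrow> real^'n \<Rightarrow> real" where
  "pds [] f = f"
| "pds (i # is) f = pd i (pds is f)"

fun Ck_on :: "nat \<Rightarrow> (real^'n::finite) set \<Rightarrow> (real^'n \<Rightarrow> real) \<Rightarrow> bool" where
  "Ck_on 0 U f = continuous_on U f"
| "Ck_on (Suc k) U f = (f differentiable_on U \<and> (\<forall>i. Ck_on k U (pd i f)))"

definition little_o_k :: "nat \<Rightarrow> real \<Rightarrow> (real^'n::finite \<Rightarrow> real) \<Rightarrow> bool" where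
  "little_o_k k \<tau> f \<longleftrightarrow> Ck_on k {x. norm x > 1} f \<and>
     (\<forall>is::'n list. length is \<le> k \<longrightarrow>
        ((\<lambda>x. norm x powr (real (length is) + \<tau>) * \<bar>pds is f x\<bar>) \<longlongrightarrow> 0) at_infinity)"

definition odd_part :: "(real^'n::finite \<Rightarrow> real) \<Rightarrow> real^'n \<Rightarrow> real" where
  "odd_part f x = (f x - f (-x)) / 2"

text \<open>Surface integral over S_r w.r.t. Euclidean area (cone-measure formula:
  int_{S_r} f d sigma_e = n r^(n-1) int_{B(1)} f(r y/|y|) dy).\<close>
definition sphere_int :: "real \<Rightarrow> (real^'n::finite \<Rightarrow> real) \<Rightarrow> real" where
  "sphere_int r f = real CARD('n) * r ^ (CARD('n) - 1) *
     integral (ball 0 1) (\<lambda>y. f ((r / norm y) *\<^sub>R y))"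

definition omega :: "'n::finite itself \<Rightarrow> real" where
  "omega _ = sphere_int 1 (\<lambda>_::real^'n. 1)"

definition gc :: "(real^'n \<Rightarrow> real^'n^'n) \<Rightarrow> 'n::finite \<Rightarrow> 'n \<Rightarrow> real^'n \<Rightarrow> real" where
  "gc g i j = (\<lambda>x. g x $ i $ j)"

definition ginv :: "(real^'n \<Rightarrow> real^'n^'n) \<Rightarrow> real^'n \<Rightarrow> real^'n^'n::finite" where
  "ginv g x = matrix_inv (g x)"

definition Chr :: "(real^'n \<Rightarrow> real^'n^'n) \<Rightarrow> 'n::finite \<Rightarrow> 'n \<Rightarrow> 'n \<Rightarrow> real^'n \<Rightarrow> real" where
  "Chr g k i j x = (1/2) * (\<Sum>l\<in>UNIV. ginv g x $ k $ l *
      (pd j (gc g l i) x + pd i (gc g l j) x - pd l (gc g i j) x))"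

definition Ric :: "(real^'n \<Rightarrow> real^'n^'n) \<Rightarrow> 'n::finite \<Rightarrow> 'n \<Rightarrow> real^'n \<Rightarrow> real" where
  "Ric g i j x = (\<Sum>k\<in>UNIV. pd k (Chr g k i j) x - pd j (Chr g k i k) x)
     + (\<Sum>k\<in>UNIV. \<Sum>l\<in>UNIV. Chr g k k l x * Chr g l i j x - Chr g k j l x * Chr g l i k x)"

definition Scal :: "(real^'n \<Rightarrow> real^'n^'n) \<Rightarrow> real^'n::finite \<Rightarrow> real" where
  "Scal g x = (\<Sum>i\<in>UNIV. \<Sum>j\<in>UNIV. ginv g x $ i $ j * Ric g i j x)"

definition Ein :: "(real^'n \<Rightarrow> real^'n^'n) \<Rightarrow> 'n::finite \<Rightarrow> 'n \<Rightarrow> real^'n \<Rightarrow> real" where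
  "Ein g i j x = Ric g i j x - (1/2) * Scal g x * g x $ i $ j"

definition nu_e :: "real^'n::finite \<Rightarrow> real^'n" where
  "nu_e x = x /\<^sub>R norm x"

text \<open>|nu|_g^2 = g^{kl} nu_k nu_l for the Euclidean unit conormal nu_k = delta_kj nu_e^j.\<close>
definition conorm2 :: "(real^'n \<Rightarrow> real^'n^'n) \<Rightarrow> real^'n::finite \<Rightarrow> real" where
  "conorm2 g x = (\<Sum>k\<in>UNIV. \<Sum>l\<in>UNIV. ginv g x $ k $ l * nu_e x $ k * nu_e x $ l)"

definition nu_g :: "(real^'n \<Rightarrow> real^'n^'n) \<Rightarrow> real^'n::finite \<Rightarrow> real^'n" where
  "nu_g g x = (\<chi> j. (\<Sum>k\<in>UNIV. ginv g x $ j $ k * nu_e x $ k) / sqrt (conorm2 g x))"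

text \<open>d sigma_g = sqrt(det g) |nu|_g d sigma_e on S_r.\<close>
definition area_g :: "(real^'n \<Rightarrow> real^'n^'n) \<Rightarrow> real^'n::finite \<Rightarrow> real" where
  "area_g g x = sqrt (det (g x)) * sqrt (conorm2 g x)"

definition mass_r :: "(real^'n \<Rightarrow> real^'n^'n) \<Rightarrow> real \<Rightarrow> real" where
  "mass_r g r = 1 / (2 * (real CARD('n::finite) - 1) * omega TYPE('n)) *
     sphere_int r (\<lambda>x. \<Sum>i\<in>UNIV. \<Sum>j\<in>UNIV.
        (pd j (gc g i j) x - pd i (gc g j j) x) * nu_e x $ i)"

definition mass_I :: "(real^'n \<Rightarrow> real^'n^'n) \<Rightarrow> real \<Rightarrow> real" where
  "mass_I g r = 1 / ((real CARD('n::finite) - 1) * (2 - real CARD('n)) * omega TYPE('n)) *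
     sphere_int r (\<lambda>x. (\<Sum>i\<in>UNIV. \<Sum>j\<in>UNIV. Ein g i j x * x $ i * nu_g g x $ j) * area_g g x)"

definition c_CS :: "(real^'n \<Rightarrow> real^'n^'n) \<Rightarrow> real \<Rightarrow> real \<Rightarrow> real^'n::finite" where
  "c_CS g m r = (\<chi> a. 1 / (2 * (real CARD('n) - 1) * omega TYPE('n) * m) *
     sphere_int r (\<lambda>x. x $ a * (\<Sum>i\<in>UNIV. \<Sum>j\<in>UNIV. (pd i (gc g i j) x - pd j (gc g i i) x) * nu_e x $ j)
        - ((\<Sum>i\<in>UNIV. g x $ i $ a * nu_e x $ i) - (\<Sum>i\<in>UNIV. g x $ i $ i) * nu_e x $ a)))"

definition Yfield :: "'n \<Rightarrow> real^'n \<Rightarrow> real^'n::finite" where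
  "Yfield a x = (\<chi> i. (norm x)\<^sup>2 * (if a = i then 1 else 0) - 2 * x $ a * x $ i)"

definition c_I :: "(real^'n \<Rightarrow> real^'n^'n) \<Rightarrow> real \<Rightarrow> real \<Rightarrow> real^'n::finite" where
  "c_I g m r = (\<chi> a. 1 / (2 * (real CARD('n) - 1) * (real CARD('n) - 2) * omega TYPE('n) * m) *
     sphere_int r (\<lambda>x. (\<Sum>i\<in>UNIV. \<Sum>j\<in>UNIV. Ein g i j x * Yfield a x $ i * nu_g g x $ j) * area_g g x))"

end

theory Submission
  imports Defs
begin

text \<open>
  Linearize at the Euclidean metric: the flux density $\sqrt{\det g}\, g^{jk} G_{ij}$ differs from the
  linearized Einstein tensor by terms at least quadratic in $g - \delta$ and its derivatives, hence by
  $o(|x|^{-n})$. Contracted with $X$ this is negligible in the limit. Contracted with $Y_{(\alpha)}$ it is not,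
  but only the part of the error that is odd in $x$ contributes to the integral over $S_r$, and the
  Regge--Teitelboim condition makes that part $o(|x|^{-n-1})$.

  The linearized Einstein tensor is the divergence of a potential antisymmetric in two indices, so its
  flux against a vector field $V$ over $S_r$ can be integrated by parts exactly. For the homothetic field
  $X$ only the trace of the potential remains, which is the mass integrand; for the conformal
  field $Y_{(\alpha)}$ a second integration by parts gives the integrand of $\mathbf{c}_{CS}$. Stokes'
  theorem on $S_r$ is needed only for divergences of antisymmetric tensors, which are sums of derivatives along
  rotation fields; it thus follows from the rotation invariance of Lebesgue measure.
\<close>

section \<open>Orthogonal invariance of Lebesgue measure\<close>

text \<open>The decay exponent is exactly critical. With \<tau> = (n-2)/2 the linear part of the
  curvature is only o(|x|^(-\<tau>-2)); its flux against X over S_r is thereby bounded only by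
  o(r^((n-2)/2)), so it cannot be estimated away and has to cancel identically at every radius. The
  quadratic error is o(|x|^(-2\<tau>-2)) = o(|x|^(-n)), which just suffices for X, of size |x|, and
  falls short by one power for Y, of size |x|^2. The flux density is a nonlinear function of g
  involving a determinant, an inverse and a square root. Size and parity are therefore propagated
  together by one calculus (\<open>decays\<close>, \<open>asymp_const\<close>) with a parameter
  \<delta>; the two claims use its instances \<delta> = 0 and \<delta> = 1. Since the surface
  integral is defined through the radial projection of the unit ball, facts about spheres are pulled
  back to the ball.\<close>

text \<open>The change-of-variables theorems of HOL-Analysis require a well-ordered index type. Relabelling
  the coordinates by a well-ordered copy of the index type removes this restriction.\<close>

typedef 'a ordered_copy = "UNIV :: 'a set" ..

instance ordered_copy :: (finite) finite
proof
  have "(UNIV :: 'a ordered_copy set) = range Abs_ordered_copy"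
    by (metis UNIV_I Abs_ordered_copy_cases rangeI subsetI subset_antisym)
  then show "finite (UNIV :: 'a ordered_copy set)"
    by (metis finite finite_imageI)
qed

text \<open>Any injection will do: the order is pulled back from the naturals, which makes it a
  wellorder.\<close>

definition ordered_copy_code :: "'a::finite ordered_copy \<Rightarrow> nat" where
  "ordered_copy_code = (SOME f. inj f)"

lemma inj_ordered_copy_code: "inj (ordered_copy_code :: 'a::finite ordered_copy \<Rightarrow> nat)"
proof -
  have "\<exists>f :: 'a ordered_copy \<Rightarrow> nat. inj f"
    using finite_imp_inj_to_nat_seg[OF finite_class.finite_UNIV] by blast
  then show ?thesis
    unfolding ordered_copy_code_def by (rule someI_ex)
qed

instantiation ordered_copy :: (finite) wellorder
begin

definition "x \<le> y \<longleftrightarrow> ordered_copy_code x \<le> ordered_copy_code y"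
definition "x < y \<longleftrightarrow> ordered_copy_code x < ordered_copy_code y"

instance
proof
  fix P :: "'a ordered_copy \<Rightarrow> bool" and a :: "'a ordered_copy"
  assume "\<And>x. (\<And>y. y < x \<Longrightarrow> P y) \<Longrightarrow> P x"
  then show "P a"
  proof (induction a rule: measure_induct_rule[of ordered_copy_code])
    case (less a)
    then show ?case
      unfolding less_ordered_copy_def by blast
  qed
qed (auto simp: less_ordered_copy_def less_eq_ordered_copy_def
          dest: injD[OF inj_ordered_copy_code])

end

lemma emeasure_lborel_box_cart:
  fixes l u :: "real^'n::finite"
  assumes "\<And>i. l $ i \<le> u $ i"
  shows "emeasure lborel (box l u) = ennreal (\<Prod>i\<in>UNIV. u $ i - l $ i)"
proof -
  have ne: "cbox l u \<noteq> {}"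
    using assms by (auto simp: interval_ne_empty_cart)
  have "emeasure lborel (box l u) = ennreal (\<Prod>b\<in>Basis. (u - l) \<bullet> b)"
    using assms by (intro emeasure_lborel_box) (auto simp: Basis_vec_def inner_axis)
  also have "(\<Prod>b\<in>Basis. (u - l) \<bullet> b) = measure lborel (cbox l u)"
    using ne by (simp add: content_cbox' inner_diff_left)
  also have "\<dots> = (\<Prod>i\<in>UNIV. u $ i - l $ i)"
    by (rule content_cbox_cart[OF ne])
  finally show ?thesis .
qed

text \<open>Side lengths are indexed by \<open>UNIV\<close> instead of \<open>Basis\<close>, so that
  a product over one index type can be reindexed along a bijection to another.\<close>

lemma lborel_eqI_cart:
  fixes M :: "(real^'n::finite) measure"
  assumes "\<And>l u. (\<And>i. l $ i \<le> u $ i) \<Longrightarrow> emeasure M (box l u) = ennreal (\<Prod>i\<in>UNIV. u $ i - l $ i)"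
    and "sets M = sets borel"
  shows "lborel = M"
proof (rule lborel_eqI)
  fix l u :: "real^'n"
  assume "\<And>b. b \<in> Basis \<Longrightarrow> l \<bullet> b \<le> u \<bullet> b"
  then have le: "l $ i \<le> u $ i" for i
    by (metis axis_in_Basis_iff cart_eq_inner_axis insert_iff Basis_real_def)
  show "emeasure M (box l u) = ennreal (\<Prod>b\<in>Basis. (u - l) \<bullet> b)"
    using assms(1)[of l u] emeasure_lborel_box_cart[of l u] le
      emeasure_lborel_box[of l u] \<open>\<And>b. b \<in> Basis \<Longrightarrow> l \<bullet> b \<le> u \<bullet> b\<close> by simp
qed (use assms in auto)

text \<open>The preimage of a box is the box with relabelled corners, and reindexing does not change
  the product of the side lengths.\<close>

lemma distr_lborel_relabel:
  fixes p :: "'m::finite \<Rightarrow> 'n::finite"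
  assumes "bij p"
  shows "distr lborel lborel (\<lambda>x::real^'n. \<chi> i. x $ p i) = lborel"
proof (rule lborel_eqI_cart[symmetric])
  let ?f = "\<lambda>x::real^'n. (\<chi> i. x $ p i)"
  have [measurable]: "?f \<in> borel \<rightarrow>\<^sub>M borel"
    by (intro borel_measurable_continuous_onI continuous_intros)
  fix l u :: "real^'m"
  assume le: "\<And>i. l $ i \<le> u $ i"
  have inv: "inv p (p i) = i" "p (inv p j) = j" for i j
    using assms by (simp_all add: bij_is_inj bij_is_surj surj_f_inv_f)
  have "?f -` box l u = box (\<chi> j. l $ inv p j) (\<chi> j. u $ inv p j)"
  proof -
    have "(\<forall>i. l $ i < x $ p i \<and> x $ p i < u $ i) \<longleftrightarrow>
          (\<forall>j. l $ inv p j < x $ j \<and> x $ j < u $ inv p j)" for x :: "real^'n"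
      by (metis inv)
    then show ?thesis
      by (auto simp: mem_box_cart)
  qed
  then have "emeasure (distr lborel lborel ?f) (box l u) = ennreal (\<Prod>j\<in>UNIV. u $ inv p j - l $ inv p j)"
    using le by (simp add: emeasure_distr emeasure_lborel_box_cart)
  also have "(\<Prod>j\<in>UNIV. u $ inv p j - l $ inv p j) = (\<Prod>i\<in>UNIV. u $ i - l $ i)"
    using assms by (intro prod.reindex_bij_betw[of "inv p" UNIV UNIV "\<lambda>i. u $ i - l $ i"]) (simp add: bij_imp_bij_inv)
  finally show "emeasure (distr lborel lborel ?f) (box l u) = ennreal (\<Prod>i\<in>UNIV. u $ i - l $ i)" .
qed simp

text \<open>A preimage under \<open>f\<close> is an image under its orthogonal inverse, to which
  \<open>measure_orthogonal_image\<close> applies; boxes are enough to identify the measure.\<close>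

lemma distr_lborel_orthogonal_wellorder:
  fixes f :: "real^'n::{finite,wellorder} \<Rightarrow> real^'n::_"
  assumes f: "orthogonal_transformation f"
  shows "distr lborel lborel f = lborel"
proof (rule lborel_eqI_cart[symmetric])
  have [measurable]: "f \<in> borel \<rightarrow>\<^sub>M borel"
    by (intro borel_measurable_continuous_onI linear_continuous_on
        linear_conv_bounded_linear[THEN iffD1] orthogonal_transformation_linear f)
  fix l u :: "real^'n::_"
  assume le: "\<And>i. l $ i \<le> u $ i"
  have fin: "f -` box l u = inv f ` box l u"
    using bij_vimage_eq_inv_image[OF orthogonal_transformation_bij[OF f]] .
  have box: "box l u \<in> lmeasurable"
    by (intro bounded_set_imp_lmeasurable) auto
  have img: "inv f ` box l u \<in> lmeasurable"
    by (intro measurable_orthogonal_image orthogonal_transformation_inv f box)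
  have b: "f -` box l u \<in> sets borel"
    using measurable_sets[of f borel borel "box l u"] by simp
  have "emeasure (distr lborel lborel f) (box l u) = emeasure lebesgue (inv f ` box l u)"
    using b by (simp add: emeasure_distr fin[symmetric])
  also have "\<dots> = ennreal (measure lebesgue (inv f ` box l u))"
    using img by (simp add: emeasure_eq_measure2)
  also have "\<dots> = emeasure lebesgue (box l u)"
    using measure_orthogonal_image[OF orthogonal_transformation_inv[OF f] box] box
    by (simp add: emeasure_eq_measure2)
  finally show "emeasure (distr lborel lborel f) (box l u) = ennreal (\<Prod>i\<in>UNIV. u $ i - l $ i)"
    by (simp add: emeasure_lborel_box_cart le)
qed simp

text \<open>Conjugating \<open>f\<close> by the relabelling isometry \<open>a\<close> and its
  inverse \<open>b\<close> gives an orthogonal map over the ordered index type; all three factors of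
  \<open>b \<circ> (a \<circ> f \<circ> b) \<circ> a\<close> preserve Lebesgue measure.\<close>

theorem distr_lborel_orthogonal:
  fixes f :: "real^'n::finite \<Rightarrow> real^'n"
  assumes f: "orthogonal_transformation f"
  shows "distr lborel lborel f = lborel"
proof -
  define a :: "real^'n \<Rightarrow> real^'n ordered_copy" where "a = (\<lambda>x. \<chi> i. x $ Rep_ordered_copy i)"
  define b :: "real^'n ordered_copy \<Rightarrow> real^'n" where "b = (\<lambda>x. \<chi> i. x $ Abs_ordered_copy i)"
  have ab: "a (b x) = x" "b (a y) = y" for x y
    by (simp_all add: a_def b_def Rep_ordered_copy_inverse Abs_ordered_copy_inverse)
  have bijR: "bij (Rep_ordered_copy :: 'n ordered_copy \<Rightarrow> 'n)"
    by (rule bijI') (auto simp: Rep_ordered_copy_inject intro: Abs_ordered_copy_inverse[symmetric])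
  have bijA: "bij (Abs_ordered_copy :: 'n \<Rightarrow> 'n ordered_copy)"
    by (rule bijI') (auto simp: Abs_ordered_copy_inject intro: Rep_ordered_copy_inverse[symmetric])
  have da: "distr lborel lborel a = lborel" and db: "distr lborel lborel b = lborel"
    unfolding a_def b_def by (intro distr_lborel_relabel bijR bijA)+
  have [measurable]: "a \<in> borel \<rightarrow>\<^sub>M borel" "b \<in> borel \<rightarrow>\<^sub>M borel"
    unfolding a_def b_def by (intro borel_measurable_continuous_onI continuous_intros)+
  have [measurable]: "f \<in> borel \<rightarrow>\<^sub>M borel"
    by (intro borel_measurable_continuous_onI linear_continuous_on
        linear_conv_bounded_linear[THEN iffD1] orthogonal_transformation_linear f)
  have inner_a: "a x \<bullet> a y = x \<bullet> y" for x y
    unfolding a_def inner_vec_def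
    using sum.reindex_bij_betw[OF bijR, of "\<lambda>i. x $ i \<bullet> y $ i"] by simp
  have inner_b: "b x \<bullet> b y = x \<bullet> y" for x y
    using inner_a[of "b x" "b y"] by (simp add: ab)
  have lin: "linear a" "linear b"
    unfolding a_def b_def by (auto intro!: linearI simp: vec_eq_iff)
  have orth: "orthogonal_transformation (a \<circ> f \<circ> b)"
    unfolding orthogonal_transformation_def
    using f lin by (auto simp: inner_a inner_b orthogonal_transformation_def intro!: linear_compose)
  have "f = b \<circ> (a \<circ> f \<circ> b) \<circ> a"
    by (auto simp: ab)
  then have "distr lborel lborel f = distr lborel lborel (b \<circ> (a \<circ> f \<circ> b) \<circ> a)"
    by simp
  also have "\<dots> = distr (distr (distr lborel lborel a) lborel (a \<circ> f \<circ> b)) lborel b"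
    by (simp add: distr_distr comp_def)
  also have "\<dots> = lborel"
    using distr_lborel_orthogonal_wellorder[OF orth] by (simp add: da db)
  finally show ?thesis .
qed

lemma integral_lborel_orthogonal:
  fixes f :: "real^'n::finite \<Rightarrow> real^'n" and h :: "real^'n \<Rightarrow> real"
  assumes f: "orthogonal_transformation f" and h: "h \<in> borel_measurable borel"
  shows "(\<integral>x. h (f x) \<partial>lborel) = (\<integral>x. h x \<partial>lborel)"
proof -
  have [measurable]: "f \<in> borel \<rightarrow>\<^sub>M borel"
    by (intro borel_measurable_continuous_onI linear_continuous_on
        linear_conv_bounded_linear[THEN iffD1] orthogonal_transformation_linear f)
  have "(\<integral>x. h x \<partial>lborel) = (\<integral>x. h x \<partial>(distr lborel lborel f))"
    by (simp add: distr_lborel_orthogonal f)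
  also have "\<dots> = (\<integral>x. h (f x) \<partial>lborel)"
    using h by (intro integral_distr) auto
  finally show ?thesis by simp
qed

section \<open>Partial derivatives\<close>

text \<open>Links \<open>pd\<close>, defined by a one-variable \<open>deriv\<close>, to the total
  derivative; together with the converse \<open>has_derivative_pd\<close> it yields the sum, product
  and chain rules.\<close>

lemma pd_has_derivative:
  assumes "(f has_derivative f') (at x)"
  shows "pd i f x = f' (axis i 1)"
proof -
  have "((\<lambda>t. x + t *\<^sub>R axis i 1) has_derivative (\<lambda>t. t *\<^sub>R axis i 1)) (at (0::real))"
    by (auto intro!: derivative_eq_intros)
  then have "((\<lambda>t. f (x + t *\<^sub>R axis i 1)) has_derivative (\<lambda>t. f' (t *\<^sub>R axis i 1))) (at 0)"
    by (rule has_derivative_compose) (simp add: assms)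
  moreover have "f' (t *\<^sub>R axis i 1) = t * f' (axis i 1)" for t
    using has_derivative_linear[OF assms] by (simp add: linear_cmul)
  ultimately have "((\<lambda>t. f (x + t *\<^sub>R axis i 1)) has_real_derivative f' (axis i 1)) (at 0)"
    by (simp add: has_field_derivative_def mult_commute_abs)
  then show ?thesis
    unfolding pd_def by (rule DERIV_imp_deriv)
qed

lemma has_derivative_pd:
  assumes "f differentiable (at x)"
  shows "(f has_derivative (\<lambda>v. \<Sum>i\<in>UNIV. v $ i * pd i f x)) (at x)"
proof -
  obtain f' where f': "(f has_derivative f') (at x)"
    using assms by (auto simp: differentiable_def)
  have lin: "linear f'"
    by (rule has_derivative_linear[OF f'])
  have "f' v = (\<Sum>i\<in>UNIV. v $ i * pd i f x)" for v
  proof -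
    have "f' v = f' (\<Sum>i\<in>UNIV. v $ i *\<^sub>R axis i 1)"
      by (simp add: basis_expansion scalar_mult_eq_scaleR[symmetric])
    also have "\<dots> = (\<Sum>i\<in>UNIV. v $ i * f' (axis i 1))"
      by (simp add: linear_sum[OF lin] linear_cmul[OF lin])
    finally show ?thesis
      by (simp add: pd_has_derivative[OF f'])
  qed
  then have "f' = (\<lambda>v. \<Sum>i\<in>UNIV. v $ i * pd i f x)"
    by (rule ext)
  then show ?thesis
    using f' by simp
qed

text \<open>Used for the coordinate segments in \<open>second_difference_mvt\<close> and for the
  orbits of \<open>plane_rotation\<close>.\<close>

lemma has_real_derivative_along_curve:
  fixes f :: "real^'n::finite \<Rightarrow> real"
  assumes "(c has_vector_derivative v) (at t)" "f differentiable (at (c t))"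
  shows "((\<lambda>s. f (c s)) has_real_derivative (\<Sum>i\<in>UNIV. v $ i * pd i f (c t))) (at t)"
proof -
  have "(\<lambda>h. \<Sum>i\<in>UNIV. (h *\<^sub>R v) $ i * pd i f (c t)) = (*) (\<Sum>i\<in>UNIV. v $ i * pd i f (c t))"
    by (rule ext) (simp add: sum_distrib_left sum_distrib_right mult_ac)
  then show ?thesis
    using has_derivative_compose[OF assms(1)[unfolded has_vector_derivative_def] has_derivative_pd[OF assms(2)]]
    by (simp only: has_field_derivative_def)
qed

text \<open>Partial derivatives depend only on the germ at a point. The metric is constrained only
  on the open set |x| > 1, so identities such as its symmetry can be differentiated only
  there.\<close>

lemma pd_cong_open:
  assumes "open S" "x \<in> S" "\<And>y. y \<in> S \<Longrightarrow> f y = g y"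
  shows "pd i f x = pd i g x"
  unfolding pd_def
proof (rule deriv_cong_ev)
  have "isCont (\<lambda>t. x + t *\<^sub>R axis i 1) (0::real)"
    by (intro continuous_intros)
  then have "\<forall>\<^sub>F t in nhds 0. x + t *\<^sub>R axis i 1 \<in> S"
    using assms(1,2) by (auto simp: isCont_def tendsto_nhds_iff intro!: topological_tendstoD)
  then show "\<forall>\<^sub>F t in nhds 0. f (x + t *\<^sub>R axis i 1) = g (x + t *\<^sub>R axis i 1)"
    by eventually_elim (rule assms(3))
qed simp

lemma pd_const [simp]: "pd i (\<lambda>_. c) x = 0"
  unfolding pd_def by simp

lemma pd_add:
  assumes "f differentiable (at x)" "g differentiable (at x)"
  shows "pd i (\<lambda>x. f x + g x) x = pd i f x + pd i g x"
  using pd_has_derivative[OF has_derivative_add[OF has_derivative_pd[OF assms(1)] has_derivative_pd[OF assms(2)]], of i]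
  by (simp add: axis_def if_distrib[of "\<lambda>c. c * _"] cong: if_cong)

lemma pd_mult:
  assumes "f differentiable (at x)" "g differentiable (at x)"
  shows "pd i (\<lambda>x. f x * g x) x = pd i f x * g x + f x * pd i g x"
  using pd_has_derivative[OF has_derivative_mult[OF has_derivative_pd[OF assms(1)] has_derivative_pd[OF assms(2)]], of i]
  by (simp add: axis_def if_distrib[of "\<lambda>c. c * _"] cong: if_cong)

lemma pd_cmult:
  assumes "f differentiable (at x)"
  shows "pd i (\<lambda>x. c * f x) x = c * pd i f x"
  using pd_mult[OF differentiable_const assms, of i c] by simp

lemma pd_diff:
  assumes "f differentiable (at x)" "g differentiable (at x)"
  shows "pd i (\<lambda>x. f x - g x) x = pd i f x - pd i g x"
  using pd_add[OF assms(1) differentiable_minus[OF assms(2)], of i] pd_cmult[OF assms(2), of i "-1"]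
  by simp

lemma pd_sum:
  assumes "\<And>a. a \<in> A \<Longrightarrow> f a differentiable (at x)"
  shows "pd i (\<lambda>x. \<Sum>a\<in>A. f a x) x = (\<Sum>a\<in>A. pd i (f a) x)"
proof (cases "finite A")
  case True
  then show ?thesis
    using assms by (induction A rule: finite_induct) (auto simp: pd_add differentiable_sum)
qed simp

text \<open>Shifting by a constant leaves the predicate under the choice operator in
  \<open>deriv\<close> unchanged, hence an equality of functions. It passes from the derivatives of
  g_ij - \<delta>_ij in the decay hypothesis to those of g_ij.\<close>

lemma pd_diff_const: "pd i (\<lambda>x. f x - c) = pd i f"
proof -
  have *: "((\<lambda>t. h t - c) has_real_derivative D) F \<longleftrightarrow> (h has_real_derivative D) F"
    for h :: "real \<Rightarrow> real" and D :: real and F :: "real filter"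
  proof
    assume "((\<lambda>t. h t - c) has_real_derivative D) F"
    from Deriv.field_differentiable_add[OF this DERIV_const[of c]] show "(h has_real_derivative D) F"
      by simp
  next
    assume "(h has_real_derivative D) F"
    from Deriv.field_differentiable_diff[OF this DERIV_const[of c]] show "((\<lambda>t. h t - c) has_real_derivative D) F"
      by simp
  qed
  show ?thesis
    unfolding pd_def deriv_def * ..
qed

lemma differentiable_component [simp]: "(\<lambda>x::real^'n::finite. x $ k) differentiable F"
  by (rule bounded_linear_imp_differentiable[OF bounded_linear_vec_nth])

lemma pd_component [simp]: "pd i (\<lambda>x. x $ k) x = (if i = k then 1 else 0)"
  using pd_has_derivative[OF bounded_linear_imp_has_derivative[OF bounded_linear_vec_nth[of k]]]
  by (auto simp: axis_def)

lemma differentiable_reflect: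
  fixes f :: "real^'n::finite \<Rightarrow> real"
  assumes "f differentiable (at (- x))"
  shows "(\<lambda>x. f (- x)) differentiable (at x)"
  using differentiable_chain_at[of uminus x f] assms by (simp add: comp_def)

text \<open>Differentiation exchanges even and odd functions; this sign gives the first derivatives
  of an almost even metric the parity -1.\<close>

lemma pd_reflect:
  assumes "f differentiable (at (- x))"
  shows "pd i (\<lambda>x. f (- x)) x = - pd i f (- x)"
proof -
  have "((\<lambda>x. - x) has_derivative (\<lambda>v. - v)) (at x)"
    by (auto intro!: derivative_eq_intros)
  from has_derivative_compose[OF this has_derivative_pd[OF assms]]
  have "((\<lambda>x. f (- x)) has_derivative (\<lambda>v. \<Sum>i\<in>UNIV. (- v) $ i * pd i f (- x))) (at x)" .
  from pd_has_derivative[OF this, of i] show ?thesis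
    by (simp add: axis_def if_distrib[of "\<lambda>c. c * _"] sum_negf cong: if_cong)
qed

section \<open>Symmetry of mixed second derivatives\<close>

lemma Ck_on_2_iff:
  "Ck_on 2 S f \<longleftrightarrow> f differentiable_on S \<and>
    (\<forall>i. pd i f differentiable_on S \<and> (\<forall>j. continuous_on S (pd j (pd i f))))"
  by (simp only: numeral_2_eq_2 Ck_on.simps)

text \<open>The mean value theorem is applied to the difference \<phi> in direction i and then to
  \<open>pd i f\<close> in direction j. The second difference is symmetric in i and j while the
  right side singles out an order; \<open>pd_commute\<close> exploits this. The radius 2h comes from
  |s e_i + t e_j| \<le> s + t.\<close>

lemma second_difference_mvt:
  fixes f :: "real^'n::finite \<Rightarrow> real"
  assumes S: "open S" "cball x (2 * h) \<subseteq> S" and h: "0 < h" and C: "Ck_on 2 S f"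
  shows "\<exists>y \<in> cball x (2 * h).
    f (x + h *\<^sub>R axis i 1 + h *\<^sub>R axis j 1) - f (x + h *\<^sub>R axis i 1) - f (x + h *\<^sub>R axis j 1) + f x
      = h\<^sup>2 * pd j (pd i f) y"
proof -
  have in_ball: "x + s *\<^sub>R axis i 1 + t *\<^sub>R axis j 1 \<in> cball x (2 * h)" if "0 \<le> s" "s \<le> h" "0 \<le> t" "t \<le> h" for s t
  proof -
    have "norm (s *\<^sub>R axis i 1 + t *\<^sub>R axis j 1 :: real^'n) \<le> s + t"
      using that norm_triangle_ineq[of "s *\<^sub>R axis i 1 :: real^'n" "t *\<^sub>R axis j 1"] by (simp add: norm_axis_1)
    moreover have "dist (x + s *\<^sub>R axis i 1 + t *\<^sub>R axis j 1) x = norm (s *\<^sub>R axis i 1 + t *\<^sub>R axis j 1 :: real^'n)"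
      by (simp add: dist_norm add.assoc)
    ultimately show ?thesis
      using that unfolding mem_cball dist_commute[of x] by linarith
  qed
  have df: "f differentiable (at y)" "pd i f differentiable (at y)" if "y \<in> cball x (2 * h)" for y
    using C S that unfolding Ck_on_2_iff by (auto simp: differentiable_on_eq_differentiable_at)
  define \<phi> where "\<phi> s = f (x + s *\<^sub>R axis i 1 + h *\<^sub>R axis j 1) - f (x + s *\<^sub>R axis i 1)" for s
  have axis_sum: "(\<Sum>k\<in>UNIV. axis m 1 $ k * w k) = w m" for m and w :: "'n \<Rightarrow> real"
    by (simp add: axis_def if_distrib[of "\<lambda>c. c * _"] cong: if_cong)
  have "\<exists>z. 0 < z \<and> z < h \<and> \<phi> h - \<phi> 0 = (h - 0) * (pd i f (x + z *\<^sub>R axis i 1 + h *\<^sub>R axis j 1) - pd i f (x + z *\<^sub>R axis i 1))"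
  proof (rule MVT2[OF h])
    fix s assume s: "0 \<le> s" "s \<le> h"
    have 1: "((\<lambda>s. x + s *\<^sub>R axis i 1 + h *\<^sub>R axis j 1) has_vector_derivative axis i 1) (at s)"
      "((\<lambda>s. x + s *\<^sub>R axis i 1) has_vector_derivative axis i 1) (at s)"
      by (auto intro!: derivative_eq_intros)
    show "(\<phi> has_real_derivative pd i f (x + s *\<^sub>R axis i 1 + h *\<^sub>R axis j 1) - pd i f (x + s *\<^sub>R axis i 1)) (at s)"
      unfolding \<phi>_def
      using has_real_derivative_along_curve[OF 1(1) df(1)[OF in_ball[OF s]]]
        has_real_derivative_along_curve[OF 1(2), of f] df(1)[OF in_ball[OF s, of 0]] h
      by (intro DERIV_diff) (auto simp: axis_sum)
  qed
  then obtain z where z: "0 < z" "z < h"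
    "\<phi> h - \<phi> 0 = h * (pd i f (x + z *\<^sub>R axis i 1 + h *\<^sub>R axis j 1) - pd i f (x + z *\<^sub>R axis i 1))"
    by auto
  define \<psi> where "\<psi> t = pd i f (x + z *\<^sub>R axis i 1 + t *\<^sub>R axis j 1)" for t
  have "\<exists>t. 0 < t \<and> t < h \<and> \<psi> h - \<psi> 0 = (h - 0) * pd j (pd i f) (x + z *\<^sub>R axis i 1 + t *\<^sub>R axis j 1)"
  proof (rule MVT2[OF h])
    fix t assume t: "0 \<le> t" "t \<le> h"
    have 1: "((\<lambda>t. x + z *\<^sub>R axis i 1 + t *\<^sub>R axis j 1) has_vector_derivative axis j 1) (at t)"
      by (auto intro!: derivative_eq_intros)
    show "(\<psi> has_real_derivative pd j (pd i f) (x + z *\<^sub>R axis i 1 + t *\<^sub>R axis j 1)) (at t)"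
      unfolding \<psi>_def
      using has_real_derivative_along_curve[OF 1 df(2)[OF in_ball[OF _ _ t]]] z
      by (auto simp: axis_sum)
  qed
  then obtain t where t: "0 < t" "t < h" "\<psi> h - \<psi> 0 = h * pd j (pd i f) (x + z *\<^sub>R axis i 1 + t *\<^sub>R axis j 1)"
    by auto
  have "\<phi> h - \<phi> 0 = h\<^sup>2 * pd j (pd i f) (x + z *\<^sub>R axis i 1 + t *\<^sub>R axis j 1)"
    using z(3) t(3) by (simp add: \<psi>_def power2_eq_square)
  moreover have "x + z *\<^sub>R axis i 1 + t *\<^sub>R axis j 1 \<in> cball x (2 * h)"
    using in_ball[of z t] z t by simp
  ultimately show ?thesis
    unfolding \<phi>_def by (intro bexI) simp_all
qed

text \<open>The same second difference evaluated in both orders gives equal mixed derivatives at two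
  points near x; continuity makes this incompatible with a gap at x.\<close>

theorem pd_commute:
  fixes f :: "real^'n::finite \<Rightarrow> real"
  assumes S: "open S" "x \<in> S" and C: "Ck_on 2 S f"
  shows "pd i (pd j f) x = pd j (pd i f) x"
proof (rule ccontr)
  \<comment> \<open>Half the gap: two errors below \<open>e\<close> cannot add up to it.\<close>
  define e where "e = \<bar>pd i (pd j f) x - pd j (pd i f) x\<bar> / 2"
  assume "\<not> ?thesis"
  then have e: "e > 0"
    by (simp add: e_def)
  have cont: "continuous_on S (pd i (pd j f))" "continuous_on S (pd j (pd i f))"
    using C unfolding Ck_on_2_iff by auto
  obtain d0 where d0: "d0 > 0" "cball x d0 \<subseteq> S"
    using S open_contains_cball by blast
  obtain d1 where d1: "d1 > 0" "\<And>y. y \<in> S \<Longrightarrow> dist y x < d1 \<Longrightarrow> dist (pd i (pd j f) y) (pd i (pd j f) x) < e"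
    using cont(1) S(2) e unfolding continuous_on_iff by blast
  obtain d2 where d2: "d2 > 0" "\<And>y. y \<in> S \<Longrightarrow> dist y x < d2 \<Longrightarrow> dist (pd j (pd i f) y) (pd j (pd i f) x) < e"
    using cont(2) S(2) e unfolding continuous_on_iff by blast
  \<comment> \<open>The divisor 4 makes 2h strictly smaller than each of the three radii.\<close>
  define h where "h = min d0 (min d1 d2) / 4"
  have h: "h > 0" "2 * h < d0" "2 * h < d1" "2 * h < d2"
    using d0 d1 d2 by (auto simp: h_def)
  have sub: "cball x (2 * h) \<subseteq> S"
    using h d0 by (meson cball_subset_cball_iff dual_order.trans less_imp_le subset_cball)
  obtain y where y: "y \<in> cball x (2 * h)"
    "f (x + h *\<^sub>R axis i 1 + h *\<^sub>R axis j 1) - f (x + h *\<^sub>R axis i 1) - f (x + h *\<^sub>R axis j 1) + f x = h\<^sup>2 * pd j (pd i f) y"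
    using second_difference_mvt[OF S(1) sub h(1) C] by blast
  obtain z where z: "z \<in> cball x (2 * h)"
    "f (x + h *\<^sub>R axis j 1 + h *\<^sub>R axis i 1) - f (x + h *\<^sub>R axis j 1) - f (x + h *\<^sub>R axis i 1) + f x = h\<^sup>2 * pd i (pd j f) z"
    using second_difference_mvt[OF S(1) sub h(1) C] by blast
  have "x + h *\<^sub>R axis j 1 + h *\<^sub>R axis i 1 = x + h *\<^sub>R axis i 1 + h *\<^sub>R axis j 1"
    by (simp add: algebra_simps)
  from z(2)[unfolded this] y(2) have "h\<^sup>2 * pd i (pd j f) z = h\<^sup>2 * pd j (pd i f) y"
    by linarith
  then have "pd i (pd j f) z = pd j (pd i f) y"
    using h(1) by simp
  moreover have "dist (pd i (pd j f) z) (pd i (pd j f) x) < e"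
    using d1(2)[of z] z(1) sub h by (auto simp: dist_commute)
  moreover have "dist (pd j (pd i f) y) (pd j (pd i f) x) < e"
    using d2(2)[of y] y(1) sub h by (auto simp: dist_commute)
  ultimately have "\<bar>pd i (pd j f) x - pd j (pd i f) x\<bar> < 2 * e"
    unfolding dist_real_def by linarith
  then show False
    by (simp add: e_def)
qed

section \<open>Closure properties of C^1 functions\<close>

lemma Ck_on_1_iff: "Ck_on 1 S f \<longleftrightarrow> f differentiable_on S \<and> (\<forall>i. continuous_on S (pd i f))"
  by (simp only: One_nat_def Ck_on.simps)

lemma Ck_on_1D:
  assumes "Ck_on 1 S f" "open S"
  shows "x \<in> S \<Longrightarrow> f differentiable (at x)" "continuous_on S f" "continuous_on S (pd i f)"
  using assms by (auto simp: Ck_on_1_iff differentiable_on_eq_differentiable_at differentiable_imp_continuous_on)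

lemma Ck_on_1_add:
  assumes "open S" "Ck_on 1 S f" "Ck_on 1 S g"
  shows "Ck_on 1 S (\<lambda>x. f x + g x)"
proof -
  have "continuous_on S (pd i (\<lambda>x. f x + g x))" for i
    using Ck_on_1D[OF assms(2,1)] Ck_on_1D[OF assms(3,1)]
    by (subst continuous_on_cong[OF refl pd_add]) (auto intro!: continuous_intros)
  then show ?thesis
    using assms by (auto simp: Ck_on_1_iff intro!: derivative_intros)
qed

lemma Ck_on_1_mult:
  assumes "open S" "Ck_on 1 S f" "Ck_on 1 S g"
  shows "Ck_on 1 S (\<lambda>x. f x * g x)"
proof -
  have "continuous_on S (pd i (\<lambda>x. f x * g x))" for i
    using Ck_on_1D[OF assms(2,1)] Ck_on_1D[OF assms(3,1)]
    by (subst continuous_on_cong[OF refl pd_mult]) (auto intro!: continuous_intros)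
  then show ?thesis
    using assms by (auto simp: Ck_on_1_iff intro!: derivative_intros)
qed

lemma Ck_on_1_const: "Ck_on 1 S (\<lambda>_. c)"
  unfolding Ck_on_1_iff by (auto simp: fun_eq_iff cong: continuous_on_cong)

lemma Ck_on_1_component: "Ck_on 1 S (\<lambda>x. x $ k)"
  unfolding Ck_on_1_iff by (auto simp: differentiable_on_def cong: continuous_on_cong)

lemma Ck_on_1_diff:
  assumes "open S" "Ck_on 1 S f" "Ck_on 1 S g"
  shows "Ck_on 1 S (\<lambda>x. f x - g x)"
  using Ck_on_1_add[OF assms(1,2) Ck_on_1_mult[OF assms(1) Ck_on_1_const[of S "-1"] assms(3)]] by simp

lemma Ck_on_1_sum:
  assumes "open S" "\<And>a. a \<in> A \<Longrightarrow> Ck_on 1 S (f a)"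
  shows "Ck_on 1 S (\<lambda>x. \<Sum>a\<in>A. f a x)"
proof (cases "finite A")
  case True
  then show ?thesis
    using assms(2)
  proof (induction A rule: finite_induct)
    case (insert a A)
    then have "Ck_on 1 S (\<lambda>x. f a x + (\<Sum>a\<in>A. f a x))"
      by (intro Ck_on_1_add assms(1)) blast+
    then show ?case
      by (simp only: sum.insert[OF insert(1,2)])
  qed (simp only: sum.empty Ck_on_1_const)
next
  case False
  then have "(\<lambda>x. \<Sum>a\<in>A. f a x) = (\<lambda>_. 0)"
    by simp
  then show ?thesis
    by (simp only: Ck_on_1_const)
qed

lemmas Ck_on_1_intros = Ck_on_1_add Ck_on_1_mult Ck_on_1_const Ck_on_1_component Ck_on_1_diff Ck_on_1_sum

section \<open>Integration over spheres\<close>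

text \<open>The origin is removed because the radial projection sends it, by division by zero, to 0,
  a point off the sphere where f is unconstrained. A continuous f is bounded on the compact sphere,
  so the gauge integral in \<open>sphere_int\<close> is a Lebesgue integral, for which image
  measures and dominated convergence are available.\<close>

lemma
  fixes f :: "real^'n::finite \<Rightarrow> real"
  assumes r: "r > 0" and f: "continuous_on (sphere 0 r) f"
  shows integrable_sphere_pullback:
      "integrable lborel (\<lambda>y. indicator (ball 0 1 - {0}) y * f ((r / norm y) *\<^sub>R y))"
    and sphere_int_lborel: "sphere_int r f = real CARD('n) * r ^ (CARD('n) - 1) *
      (\<integral>y. indicator (ball 0 1 - {0}) y * f ((r / norm y) *\<^sub>R y) \<partial>lborel)"
proof -
  let ?B = "ball 0 1 - {0} :: (real^'n) set"
  let ?P = "\<lambda>y::real^'n. (r / norm y) *\<^sub>R y"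
  have P: "?P ` ?B \<subseteq> sphere 0 r"
    using r by (auto split: if_splits)
  have cP: "continuous_on ?B (\<lambda>y. f (?P y))"
    by (rule continuous_on_compose2[OF f _ P]) (auto intro!: continuous_intros)
  have meas: "(\<lambda>y. indicator ?B y * f (?P y)) \<in> borel_measurable borel"
    using borel_measurable_continuous_on_indicator[OF _ cP] by simp
  have "\<exists>C. \<forall>x\<in>sphere 0 r. norm (f x) \<le> C"
    using compact_imp_bounded[OF compact_continuous_image[OF f compact_sphere]]
    unfolding bounded_iff by auto
  then obtain C where C: "\<And>x. x \<in> sphere 0 r \<Longrightarrow> norm (f x) \<le> C"
    by blast
  have "emeasure lborel (ball (0::real^'n) 1) < \<infinity>"
    by (intro emeasure_bounded_finite) auto
  moreover have "emeasure lborel ?B \<le> emeasure lborel (ball (0::real^'n) 1)"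
    by (intro emeasure_mono) auto
  ultimately have "emeasure lborel ?B < \<infinity>"
    by (rule le_less_trans[rotated])
  then have ind: "integrable lborel (\<lambda>y. indicator ?B y * C)"
    by (intro integrable_mult_left integrable_real_indicator) auto
  show int: "integrable lborel (\<lambda>y. indicator ?B y * f (?P y))"
  proof (rule Bochner_Integration.integrable_bound[OF ind])
    show "AE y in lborel. norm (indicator ?B y * f (?P y)) \<le> norm (indicator ?B y * C)"
    proof (rule AE_I2)
      fix y :: "real^'n"
      show "norm (indicator ?B y * f (?P y)) \<le> norm (indicator ?B y * C)"
        using C[of "?P y"] r by (auto simp: indicator_def)
    qed
  qed (use meas in simp)
  then have "set_integrable lborel ?B (\<lambda>y. f (?P y))"
    by (simp add: set_integrable_def)
  then have "(LINT y:?B|lborel. f (?P y)) = integral ?B (\<lambda>y. f (?P y))"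
    by (rule set_borel_integral_eq_integral(2))
  moreover have "integral ?B (\<lambda>y. f (?P y)) = integral (ball 0 1) (\<lambda>y. f (?P y))"
    by (rule integral_subset_negligible) (auto intro: negligible_subset[of "{0}"])
  ultimately show "sphere_int r f = real CARD('n) * r ^ (CARD('n) - 1) *
      (\<integral>y. indicator ?B y * f (?P y) \<partial>lborel)"
    by (simp add: sphere_int_def set_lebesgue_integral_def)
qed

text \<open>The projection maps the centre of the ball to 0, where \<open>f\<close> and
  \<open>g\<close> may differ; hence the exceptional set \<open>{0}\<close>.\<close>

lemma sphere_int_cong:
  fixes f g :: "real^'n::finite \<Rightarrow> real"
  assumes "r > 0" "\<And>x. norm x = r \<Longrightarrow> f x = g x"
  shows "sphere_int r f = sphere_int r g"
  unfolding sphere_int_def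
proof (intro arg_cong2[where f = times] refl integral_spike[of "{0}"])
  fix y :: "real^'n"
  assume "y \<in> ball 0 1 - {0}"
  then show "g ((r / norm y) *\<^sub>R y) = f ((r / norm y) *\<^sub>R y)"
    using assms by (intro assms(2)[symmetric]) auto
qed simp

lemma sphere_int_cmult: "sphere_int r (\<lambda>x. c * f x) = c * sphere_int r f"
  by (simp add: sphere_int_def)

lemma sphere_int_minus: "sphere_int r (\<lambda>x. - f x) = - sphere_int r f"
  using sphere_int_cmult[of r "-1" f] by simp

lemma sphere_int_add:
  fixes f g :: "real^'n::finite \<Rightarrow> real"
  assumes "r > 0" "continuous_on (sphere 0 r) f" "continuous_on (sphere 0 r) g"
  shows "sphere_int r (\<lambda>x. f x + g x) = sphere_int r f + sphere_int r g"
  using integrable_sphere_pullback[OF assms(1,2)] integrable_sphere_pullback[OF assms(1,3)]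
  by (simp add: sphere_int_lborel assms continuous_on_add distrib_left)

lemma sphere_int_diff:
  fixes f g :: "real^'n::finite \<Rightarrow> real"
  assumes "r > 0" "continuous_on (sphere 0 r) f" "continuous_on (sphere 0 r) g"
  shows "sphere_int r (\<lambda>x. f x - g x) = sphere_int r f - sphere_int r g"
  using sphere_int_add[OF assms(1,2) continuous_on_minus[OF assms(3)]] by (simp add: sphere_int_minus)

lemma sphere_int_sum:
  fixes f :: "'a \<Rightarrow> real^'n::finite \<Rightarrow> real"
  assumes "r > 0" "\<And>a. a \<in> A \<Longrightarrow> continuous_on (sphere 0 r) (f a)"
  shows "sphere_int r (\<lambda>x. \<Sum>a\<in>A. f a x) = (\<Sum>a\<in>A. sphere_int r (f a))"
proof (cases "finite A")
  case True
  then show ?thesis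
    using assms(2)
    by (induction A rule: finite_induct)
      (auto simp: sphere_int_add assms(1) continuous_on_sum sphere_int_cmult[of r 0 "\<lambda>_. 0", simplified])
qed (simp add: sphere_int_cmult[of r 0 "\<lambda>_. 0", simplified])

lemma sphere_int_bound:
  fixes f :: "real^'n::finite \<Rightarrow> real"
  assumes r: "r > 0" and f: "continuous_on (sphere 0 r) f" and B: "\<And>x. norm x = r \<Longrightarrow> \<bar>f x\<bar> \<le> B"
  shows "\<bar>sphere_int r f\<bar> \<le> sphere_int r (\<lambda>_::real^'n. B)"
proof -
  have "\<bar>\<integral>y. indicator (ball 0 1 - {0}) y * f ((r / norm y) *\<^sub>R y) \<partial>lborel\<bar>
    \<le> (\<integral>y. indicator (ball 0 1 - {0}) y * B \<partial>(lborel :: (real^'n) measure))"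
  proof (rule order.trans[OF integral_abs_bound integral_mono])
    fix y :: "real^'n"
    show "\<bar>indicator (ball 0 1 - {0}) y * f ((r / norm y) *\<^sub>R y)\<bar> \<le> indicator (ball 0 1 - {0}) y * B"
      using B[of "(r / norm y) *\<^sub>R y"] r by (auto simp: indicator_def)
  qed (use integrable_sphere_pullback[OF r f] integrable_sphere_pullback[OF r, of "\<lambda>_. B"] in auto)
  then show ?thesis
    using r by (simp add: sphere_int_lborel f abs_mult mult_left_mono)
qed

lemma sphere_int_const: "sphere_int r (\<lambda>_::real^'n::finite. c) = c * r ^ (CARD('n) - 1) * omega TYPE('n)"
proof -
  have "sphere_int r (\<lambda>_::real^'n. c) = c * sphere_int r (\<lambda>_::real^'n. 1)"
    using sphere_int_cmult[of r c "\<lambda>_. 1"] by simp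
  then show ?thesis
    by (simp add: omega_def sphere_int_def)
qed

text \<open>An orthogonal map preserves norms and commutes with scaling, hence commutes with the
  radial projection; invariance on the sphere becomes invariance of Lebesgue measure on the
  punctured ball.\<close>

lemma sphere_int_orthogonal:
  fixes f :: "real^'n::finite \<Rightarrow> real" and T :: "real^'n \<Rightarrow> real^'n"
  assumes r: "r > 0" and f: "continuous_on (sphere 0 r) f" and T: "orthogonal_transformation T"
  shows "sphere_int r (\<lambda>x. f (T x)) = sphere_int r f"
proof -
  let ?F = "\<lambda>y. indicator (ball 0 1 - {0}) y * f ((r / norm y) *\<^sub>R y)"
  have norm_T: "norm (T x) = norm x" and scale_T: "T (c *\<^sub>R x) = c *\<^sub>R T x" for x c
    using T by (auto simp: orthogonal_transformation orthogonal_transformation_scaleR)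
  have "continuous_on (sphere 0 r) T"
    by (intro linear_continuous_on linear_conv_bounded_linear[THEN iffD1] orthogonal_transformation_linear T)
  then have fT: "continuous_on (sphere 0 r) (\<lambda>x. f (T x))"
    by (rule continuous_on_compose2[OF f]) (auto simp: norm_T)
  have T0: "T y \<in> ball 0 1 - {0} \<longleftrightarrow> y \<in> ball 0 1 - {0}" for y
  proof -
    have "T y = 0 \<longleftrightarrow> y = 0"
      by (metis norm_T norm_eq_zero)
    then show ?thesis
      by (simp add: norm_T)
  qed
  have "indicator (ball 0 1 - {0}) y * f (T ((r / norm y) *\<^sub>R y)) = ?F (T y)" for y
    using T0[of y] by (simp add: indicator_def norm_T scale_T)
  moreover have "?F \<in> borel_measurable borel"
    using borel_measurable_integrable[OF integrable_sphere_pullback[OF r f]] by simp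
  from integral_lborel_orthogonal[OF T this]
  have "(\<integral>y. ?F (T y) \<partial>lborel) = (\<integral>y. ?F y \<partial>lborel)" .
  ultimately show ?thesis
    by (simp add: sphere_int_lborel r f fT)
qed

lemma sphere_int_reflect:
  fixes f :: "real^'n::finite \<Rightarrow> real"
  assumes "r > 0" "continuous_on (sphere 0 r) f"
  shows "sphere_int r (\<lambda>x. f (- x)) = sphere_int r f"
  by (rule sphere_int_orthogonal[OF assms]) (auto simp: orthogonal_transformation_neg)

section \<open>Rotations in coordinate planes and divergences on spheres\<close>

definition plane_rotation :: "'n \<Rightarrow> 'n \<Rightarrow> real \<Rightarrow> real^'n::finite \<Rightarrow> real^'n" where
  "plane_rotation k j t x = x + (cos t - 1) *\<^sub>R (axis k (x $ k) + axis j (x $ j))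
     + sin t *\<^sub>R (axis k (x $ j) - axis j (x $ k))"

text \<open>With u the projection of x to the plane and v a quarter turn of u, one has x \<bullet> u
  = |u|^2 = |v|^2 = q, while v is orthogonal to x and u. Hence the squared norm changes by ((c-1)^2
  + s^2 + 2(c-1)) q = (s^2 + c^2 - 1) q = 0.\<close>

lemma orthogonal_plane_rotation:
  assumes "k \<noteq> j"
  shows "orthogonal_transformation (plane_rotation k j t)"
  unfolding orthogonal_transformation
proof (intro conjI allI)
  show "linear (plane_rotation k j t)"
    by (rule linearI) (auto simp: plane_rotation_def vec_eq_iff axis_def algebra_simps)
  fix x :: "real^'a"
  define u where "u = axis k (x $ k) + axis j (x $ j)"
  define v where "v = axis k (x $ j) - axis j (x $ k)"
  define q where "q = (x $ k)\<^sup>2 + (x $ j)\<^sup>2"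
  have ax: "axis m a $ i = (if i = m then a else 0)" for m i :: 'a and a :: real
    by (simp add: axis_def)
  have alg: "p + (c - 1)\<^sup>2 * q + s\<^sup>2 * q + 2 * (c - 1) * q = p + (s\<^sup>2 + c\<^sup>2 - 1) * q" for p c s :: real
    by (simp add: power2_eq_square algebra_simps)
  have ip: "x \<bullet> u = q" "u \<bullet> u = q" "v \<bullet> v = q" "x \<bullet> v = 0" "u \<bullet> v = 0"
    using assms by (auto simp: u_def v_def q_def inner_axis inner_axis' ax inner_simps power2_eq_square)
  have "plane_rotation k j t x \<bullet> plane_rotation k j t x
      = x \<bullet> x + (cos t - 1)\<^sup>2 * q + (sin t)\<^sup>2 * q + 2 * (cos t - 1) * q"
    unfolding plane_rotation_def u_def[symmetric] v_def[symmetric]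
    by (simp add: inner_simps ip inner_commute[of u x] inner_commute[of v x] inner_commute[of v u]
        power2_eq_square algebra_simps)
  also have "\<dots> = x \<bullet> x + ((sin t)\<^sup>2 + (cos t)\<^sup>2 - 1) * q"
    by (rule alg)
  also have "\<dots> = x \<bullet> x"
    by simp
  finally show "norm (plane_rotation k j t x) = norm x"
    by (simp add: norm_eq)
qed

text \<open>The rotations are the flow of the field x_j e_k - x_k e_j: the velocity at angle t is
  the field at the rotated point, so derivatives along an orbit are values of one function on the
  sphere.\<close>

lemma plane_rotation_has_vector_derivative:
  assumes "k \<noteq> j"
  shows "((\<lambda>t. plane_rotation k j t x) has_vector_derivative
    (axis k (plane_rotation k j t x $ j) - axis j (plane_rotation k j t x $ k))) (at t)"
proof -
  have "((\<lambda>t. plane_rotation k j t x) has_vector_derivative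
    ((- sin t) *\<^sub>R (axis k (x $ k) + axis j (x $ j)) + cos t *\<^sub>R (axis k (x $ j) - axis j (x $ k)))) (at t)"
    unfolding plane_rotation_def by (auto intro!: derivative_eq_intros)
  moreover have "(- sin t) *\<^sub>R (axis k (x $ k) + axis j (x $ j)) + cos t *\<^sub>R (axis k (x $ j) - axis j (x $ k))
    = axis k (plane_rotation k j t x $ j) - axis j (plane_rotation k j t x $ k)"
    using assms by (auto simp: plane_rotation_def vec_eq_iff axis_def algebra_simps)
  ultimately show ?thesis by simp
qed

text \<open>The rotation invariance of the integral, differentiated with respect to the angle.\<close>

theorem sphere_int_rotation_derivative:
  fixes f :: "real^'n::finite \<Rightarrow> real"
  assumes r: "r > 0" and S: "open S" "sphere 0 r \<subseteq> S" and f: "Ck_on 1 S f"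
  shows "sphere_int r (\<lambda>x. x $ j * pd k f x - x $ k * pd j f x) = 0"
proof (cases "k = j")
  case True
  then show ?thesis
    by (simp add: sphere_int_def)
next
  case False
  let ?B = "ball 0 1 - {0} :: (real^'n) set"
  let ?P = "\<lambda>y::real^'n. (r / norm y) *\<^sub>R y"
  let ?R = "plane_rotation k j"
  define L where "L x = x $ j * pd k f x - x $ k * pd j f x" for x
  note fD = Ck_on_1D[OF f S(1)]
  have cf: "continuous_on (sphere 0 r) f" and cL: "continuous_on (sphere 0 r) L"
    unfolding L_def using S(2) fD by (auto intro!: continuous_intros intro: continuous_on_subset)
  have "\<exists>C. \<forall>x\<in>sphere 0 r. norm (L x) \<le> C"
    using compact_imp_bounded[OF compact_continuous_image[OF cL compact_sphere]]
    unfolding bounded_iff by auto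
  then obtain C where C: "\<And>x. x \<in> sphere 0 r \<Longrightarrow> norm (L x) \<le> C"
    by blast
  have norm_R: "norm (?R t x) = norm x" for t x
    using orthogonal_plane_rotation[OF False, of t] by (simp add: orthogonal_transformation)
  have deriv: "((\<lambda>t. f (?R t z)) has_real_derivative L (?R t z)) (at t)" if "norm z = r" for t z
  proof -
    have "f differentiable (at (?R t z))"
      using S(2) that by (intro fD(1)) (auto simp: norm_R)
    from has_real_derivative_along_curve[OF plane_rotation_has_vector_derivative[OF False] this]
    show ?thesis
      by (simp add: L_def axis_def left_diff_distrib sum_subtractf if_distrib[of "\<lambda>c. c * _"] cong: if_cong)
  qed
  have R0: "?R 0 z = z" for z
    by (simp add: plane_rotation_def)
  \<comment> \<open>The difference quotient of f along the rotation by the angle 1/(m+1), pulled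
    back to the ball; by invariance its integral vanishes.\<close>
  define q where "q m y = indicator ?B y * (f (?R (1 / Suc m) (?P y)) - f (?P y)) * Suc m" for m y
  have cR: "continuous_on (sphere 0 r) (\<lambda>x. f (?R t x))" for t
    by (rule continuous_on_compose2[OF cf linear_continuous_on[OF linear_conv_bounded_linear[THEN iffD1,
      OF orthogonal_transformation_linear[OF orthogonal_plane_rotation[OF False, of t]]]]])
      (auto simp: norm_R)
  have q_int: "integrable lborel (q m)" "(\<integral>y. q m y \<partial>lborel) = 0" for m
  proof -
    note i1 = integrable_sphere_pullback[OF r cR[of "1 / Suc m"]]
    note i2 = integrable_sphere_pullback[OF r cf]
    show "integrable lborel (q m)"
      using i1 i2 unfolding q_def right_diff_distrib by auto
    have "sphere_int r (\<lambda>x. f (?R (1 / Suc m) x)) = sphere_int r f"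
      by (rule sphere_int_orthogonal[OF r cf orthogonal_plane_rotation[OF False]])
    then have "(\<integral>y. indicator ?B y * f (?R (1 / Suc m) (?P y)) \<partial>lborel) = (\<integral>y. indicator ?B y * f (?P y) \<partial>lborel)"
      using r by (simp add: sphere_int_lborel[OF r cR] sphere_int_lborel[OF r cf])
    then show "(\<integral>y. q m y \<partial>lborel) = 0"
      using i1 i2 unfolding q_def right_diff_distrib by simp
  qed
  \<comment> \<open>The quotients converge to the derivative L along the rotation field. By the mean
    value theorem each quotient is a value of L at another point of the same sphere, so the bound C
    of L there dominates.\<close>
  have "(\<lambda>m. \<integral>y. q m y \<partial>lborel) \<longlonglongrightarrow> (\<integral>y. indicator ?B y * L (?P y) \<partial>lborel)"
  proof (rule integral_dominated_convergence)
    show "(\<lambda>y. indicator ?B y * L (?P y)) \<in> borel_measurable lborel"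
      using integrable_sphere_pullback[OF r cL] by simp
    show "q m \<in> borel_measurable lborel" for m
      using q_int(1) by auto
    show "integrable lborel (\<lambda>y. indicator ?B y * C)"
      using integrable_sphere_pullback[OF r, of "\<lambda>_. C"] by simp
    show "AE y in lborel. (\<lambda>m. q m y) \<longlonglongrightarrow> indicator ?B y * L (?P y)"
    proof (rule AE_I2)
      fix y :: "real^'n"
      show "(\<lambda>m. q m y) \<longlonglongrightarrow> indicator ?B y * L (?P y)"
      proof (cases "y \<in> ?B")
        case True
        then have "norm (?P y) = r"
          using r by auto
        then have "((\<lambda>h. (f (?R h (?P y)) - f (?P y)) / h) \<longlongrightarrow> L (?P y)) (at 0)"
          using deriv[of "?P y" 0] by (simp add: DERIV_def R0)
        moreover have "filterlim (\<lambda>m. 1 / real (Suc m)) (at 0) sequentially"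
          using LIMSEQ_Suc[OF lim_1_over_n] unfolding filterlim_at by (simp add: field_simps)
        ultimately have "(\<lambda>m. (f (?R (1 / Suc m) (?P y)) - f (?P y)) / (1 / Suc m)) \<longlonglongrightarrow> L (?P y)"
          by (rule filterlim_compose)
        then show ?thesis
          using True by (simp add: q_def)
      qed (simp add: q_def)
    qed
    show "AE y in lborel. norm (q m y) \<le> indicator ?B y * C" for m
    proof (rule AE_I2)
      fix y :: "real^'n"
      show "norm (q m y) \<le> indicator ?B y * C"
      proof (cases "y \<in> ?B")
        case True
        then have n: "norm (?P y) = r"
          using r by auto
        have "\<exists>z. 0 < z \<and> z < 1 / real (Suc m) \<and> f (?R (1 / Suc m) (?P y)) - f (?R 0 (?P y)) = (1 / Suc m - 0) * L (?R z (?P y))"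
          using deriv[OF n] by (intro MVT2) auto
        then obtain z where "f (?R (1 / Suc m) (?P y)) - f (?P y) = (1 / Suc m) * L (?R z (?P y))"
          by (auto simp: R0)
        then have "q m y = L (?R z (?P y))"
          using True by (simp add: q_def)
        then show ?thesis
          using C[of "?R z (?P y)"] n True by (simp add: norm_R)
      qed (simp add: q_def)
    qed
  qed
  then have "(\<integral>y. indicator ?B y * L (?P y) \<partial>lborel) = 0"
    unfolding q_int(2) LIMSEQ_const_iff by (rule sym)
  then show ?thesis
    unfolding L_def[symmetric] by (simp add: sphere_int_lborel[OF r cL])
qed

text \<open>For antisymmetric $A$, twice the integrand is the sum over $k, j$ of the derivatives of
  $A_{kj}$ along the rotation field in the $kj$-plane.\<close>

corollary sphere_int_antisym_divergence:
  fixes A :: "'n \<Rightarrow> 'n \<Rightarrow> real^'n::finite \<Rightarrow> real"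
  assumes r: "r > 0" and S: "open S" "sphere 0 r \<subseteq> S" and A: "\<And>k j. Ck_on 1 S (A k j)"
    and antisym: "\<And>k j x. A j k x = - A k j x"
  shows "sphere_int r (\<lambda>x. \<Sum>k\<in>UNIV. \<Sum>j\<in>UNIV. pd k (A k j) x * x $ j) = 0"
proof -
  have "pd j (A k j) x = - pd j (A j k) x" if "norm x = r" for k j x
  proof -
    have "A k j = (\<lambda>x. - 1 * A j k x)"
      using antisym[of k j] by auto
    then show ?thesis
      using pd_cmult[OF Ck_on_1D(1)[OF A S(1)], of x j "-1" j k] that S(2) by auto
  qed
  then have swap: "(\<Sum>k\<in>UNIV. \<Sum>j\<in>UNIV. x $ k * pd j (A k j) x) = - (\<Sum>k\<in>UNIV. \<Sum>j\<in>UNIV. pd k (A k j) x * x $ j)"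
    if "norm x = r" for x
    using that by (subst sum.swap) (simp add: sum_negf mult.commute)
  have c: "continuous_on (sphere 0 r) (pd i (A k j))" for i k j
    using Ck_on_1D(3)[OF A S(1)] S(2) by (rule continuous_on_subset)
  have "2 * sphere_int r (\<lambda>x. \<Sum>k\<in>UNIV. \<Sum>j\<in>UNIV. pd k (A k j) x * x $ j)
    = sphere_int r (\<lambda>x. 2 * (\<Sum>k\<in>UNIV. \<Sum>j\<in>UNIV. pd k (A k j) x * x $ j))"
    by (simp add: sphere_int_cmult)
  also have "\<dots> = sphere_int r (\<lambda>x. \<Sum>k\<in>UNIV. \<Sum>j\<in>UNIV. x $ j * pd k (A k j) x - x $ k * pd j (A k j) x)"
    by (rule sphere_int_cong[OF r]) (simp add: sum_subtractf swap mult.commute)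
  also have "\<dots> = (\<Sum>k\<in>UNIV. \<Sum>j\<in>UNIV. sphere_int r (\<lambda>x. x $ j * pd k (A k j) x - x $ k * pd j (A k j) x))"
    using c by (simp add: sphere_int_sum r continuous_intros)
  also have "\<dots> = 0"
    by (simp add: sphere_int_rotation_derivative[OF r S A])
  finally show ?thesis by simp
qed

section \<open>The linearized Einstein tensor\<close>

lemma open_norm_gt [simp]: "open {x::'a::real_normed_vector. norm x > c}"
  by (intro open_Collect_less continuous_intros)

text \<open>The vanishing integral of a rotation derivative, applied to x_m f; the coefficient on
  the right is the rotation derivative of x_m. It trades first derivatives of g weighted by a
  coordinate for g itself.\<close>

lemma sphere_int_by_parts_rotation:
  fixes f :: "real^'n::finite \<Rightarrow> real"
  assumes r: "r > 1" and f: "Ck_on 1 {x. norm x > 1} f"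
  shows "sphere_int r (\<lambda>x. x $ m * (x $ j * pd k f x - x $ k * pd j f x)) =
    - sphere_int r (\<lambda>x. ((if k = m then x $ j else 0) - (if j = m then x $ k else 0)) * f x)"
proof -
  let ?U = "{x::real^'n. norm x > 1}"
  have sub: "sphere 0 r \<subseteq> ?U" and r0: "r > 0"
    using r by auto
  have cf: "continuous_on (sphere 0 r) f" "continuous_on (sphere 0 r) (pd i f)" for i
    by (rule continuous_on_subset[OF Ck_on_1D(2)[OF f open_norm_gt] sub]
        continuous_on_subset[OF Ck_on_1D(3)[OF f open_norm_gt] sub])+
  have ci: "continuous_on (sphere 0 r) (\<lambda>x::real^'n. if b then x $ i else 0)" for b i
    by (cases b) (auto intro: continuous_intros)
  have "0 = sphere_int r (\<lambda>x. x $ j * pd k (\<lambda>x. x $ m * f x) x - x $ k * pd j (\<lambda>x. x $ m * f x) x)"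
    by (intro sphere_int_rotation_derivative[symmetric, OF r0 open_norm_gt sub] Ck_on_1_intros f open_norm_gt)
  also have "\<dots> = sphere_int r (\<lambda>x. x $ m * (x $ j * pd k f x - x $ k * pd j f x) +
      ((if k = m then x $ j else 0) - (if j = m then x $ k else 0)) * f x)"
  proof (rule sphere_int_cong[OF r0])
    fix x :: "real^'n"
    assume "norm x = r"
    then have "f differentiable (at x)"
      using Ck_on_1D(1)[OF f] r by auto
    then show "x $ j * pd k (\<lambda>x. x $ m * f x) x - x $ k * pd j (\<lambda>x. x $ m * f x) x =
      x $ m * (x $ j * pd k f x - x $ k * pd j f x) +
      ((if k = m then x $ j else 0) - (if j = m then x $ k else 0)) * f x"
      by (simp add: pd_mult algebra_simps)
  qed
  also have "\<dots> = sphere_int r (\<lambda>x. x $ m * (x $ j * pd k f x - x $ k * pd j f x)) +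
      sphere_int r (\<lambda>x. ((if k = m then x $ j else 0) - (if j = m then x $ k else 0)) * f x)"
    by (intro sphere_int_add r0 continuous_intros cf ci)
  finally show ?thesis by simp
qed

text \<open>|x|^2 is spelled out as a polynomial, so that the rules for sums and products
  apply.\<close>

lemma Yfield_component: "Yfield a x $ i = (\<Sum>l\<in>UNIV. x $ l * x $ l) * (if a = i then 1 else 0) - 2 * (x $ a * x $ i)"
  by (simp add: Yfield_def power2_norm_eq_inner inner_vec_def)

lemma Ck_on_1_Yfield: "Ck_on 1 {x. norm x > 1} (\<lambda>x. Yfield a x $ i)"
  unfolding Yfield_component by (intro Ck_on_1_intros open_norm_gt)

text \<open>The first two terms together are antisymmetric in k and i, the third is a multiple of
  the identity: this is the conformal Killing property of \<open>Yfield\<close>, with factor -2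
  x_a.\<close>

lemma pd_Yfield:
  fixes x :: "real^'n::finite"
  shows "pd k (\<lambda>x. Yfield a x $ i) x =
    2 * x $ k * (if a = i then 1 else 0) - 2 * x $ i * (if k = a then 1 else 0) - 2 * x $ a * (if k = i then 1 else 0)"
proof -
  have *: "pd k (\<lambda>x. (\<Sum>l\<in>UNIV. x $ l * x $ l) * c - 2 * (x $ a * x $ i)) x =
    (\<Sum>l\<in>UNIV. pd k (\<lambda>x. x $ l) x * x $ l + x $ l * pd k (\<lambda>x. x $ l) x) * c
    - 2 * (pd k (\<lambda>x. x $ a) x * x $ i + x $ a * pd k (\<lambda>x. x $ i) x)" for c
  proof -
    have "(\<lambda>x::real^'n. \<Sum>l\<in>UNIV. x $ l * x $ l) differentiable (at x)"
      by (intro differentiable_sum differentiable_mult ballI) auto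
    then show ?thesis
      by (simp add: pd_diff pd_mult pd_cmult pd_sum differentiable_mult del: pd_component)
  qed
  then show ?thesis
    unfolding Yfield_component *
    by (simp add: sum.distrib if_distrib[of "\<lambda>c. _ * c"] if_distrib[of "\<lambda>c. c * _"] algebra_simps cong: if_cong)
qed

section \<open>Linearized curvature as a divergence\<close>

locale symmetric_C2_tensor =
  fixes g :: "real^'n::finite \<Rightarrow> real^'n^'n"
  assumes sym: "\<And>x. norm x > 1 \<Longrightarrow> transpose (g x) = g x"
    and C2: "\<And>i j. Ck_on 2 {x. norm x > 1} (gc g i j)"
begin

abbreviation dg :: "'n \<Rightarrow> 'n \<Rightarrow> 'n \<Rightarrow> real^'n \<Rightarrow> real" where
  "dg i j k \<equiv> pd k (gc g i j)"

abbreviation ddg :: "'n \<Rightarrow> 'n \<Rightarrow> 'n \<Rightarrow> 'n \<Rightarrow> real^'n \<Rightarrow> real" where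
  "ddg i j k l \<equiv> pd l (pd k (gc g i j))"

lemma gc_sym: "norm x > 1 \<Longrightarrow> gc g i j x = gc g j i x"
  using sym[of x] by (simp add: gc_def transpose_def vec_eq_iff)

lemma dg_sym: "norm x > 1 \<Longrightarrow> dg i j k x = dg j i k x"
  by (rule pd_cong_open[OF open_norm_gt]) (auto simp: gc_sym)

lemma ddg_sym: "norm x > 1 \<Longrightarrow> ddg i j k l x = ddg j i k l x"
  by (rule pd_cong_open[OF open_norm_gt]) (auto simp: dg_sym)

lemma ddg_commute: "norm x > 1 \<Longrightarrow> ddg i j k l x = ddg i j l k x"
  by (rule pd_commute[OF open_norm_gt _ C2]) simp

lemma Ck_on_1_gc: "Ck_on 1 {x. norm x > 1} (gc g i j)"
  using C2[of i j] unfolding Ck_on_2_iff Ck_on_1_iff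
  by (auto intro: differentiable_imp_continuous_on)

lemma Ck_on_1_dg: "Ck_on 1 {x. norm x > 1} (dg i j k)"
  using C2[of i j] unfolding Ck_on_2_iff Ck_on_1_iff by auto

lemma gc_differentiable: "norm x > 1 \<Longrightarrow> gc g i j differentiable (at x)"
  using Ck_on_1D(1)[OF Ck_on_1_gc] by auto

lemma dg_differentiable: "norm x > 1 \<Longrightarrow> dg i j k differentiable (at x)"
  using Ck_on_1D(1)[OF Ck_on_1_dg] by auto

lemma continuous_on_gc: "continuous_on {x. norm x > 1} (gc g i j)"
  by (rule Ck_on_1D(2)[OF Ck_on_1_gc open_norm_gt])

lemma continuous_on_dg: "continuous_on {x. norm x > 1} (dg i j k)"
  by (rule Ck_on_1D(2)[OF Ck_on_1_dg open_norm_gt])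

lemma continuous_on_ddg: "continuous_on {x. norm x > 1} (ddg i j k l)"
  by (rule Ck_on_1D(3)[OF Ck_on_1_dg open_norm_gt])

text \<open>The suffix \<open>_lin\<close> marks the linearization at the Euclidean metric; \<open>dChr_lin k i j m\<close> is that
  of $\partial_m \Gamma^k_{ij}$.\<close>

definition dChr_lin :: "'n \<Rightarrow> 'n \<Rightarrow> 'n \<Rightarrow> 'n \<Rightarrow> real^'n \<Rightarrow> real" where
  "dChr_lin k i j m x = (ddg k i j m x + ddg k j i m x - ddg i j k m x) / 2"

definition Ric_lin :: "'n \<Rightarrow> 'n \<Rightarrow> real^'n \<Rightarrow> real" where
  "Ric_lin i j x = (\<Sum>k\<in>UNIV. dChr_lin k i j k x - dChr_lin k i k j x)"

definition Scal_lin :: "real^'n \<Rightarrow> real" where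
  "Scal_lin x = (\<Sum>i\<in>UNIV. Ric_lin i i x)"

definition Ein_lin :: "'n \<Rightarrow> 'n \<Rightarrow> real^'n \<Rightarrow> real" where
  "Ein_lin i j x = Ric_lin i j x - (if i = j then Scal_lin x / 2 else 0)"

text \<open>The negative of the mass integrand as a covector; its divergence is minus the linearized
  scalar curvature.\<close>

definition mass_density :: "'n \<Rightarrow> real^'n \<Rightarrow> real" where
  "mass_density k x = (\<Sum>l\<in>UNIV. dg l l k x - dg k l l x)"

text \<open>The divergence over k of the first two terms gives the linearized Ricci tensor except
  for the gradient of \<open>mass_density\<close>; the term with i = k supplies that gradient, and
  the term with i = j the subtraction of half the scalar curvature. It is these two trace terms
  together that keep the sum antisymmetric in k and j.\<close>

definition potential :: "'n \<Rightarrow> 'n \<Rightarrow> 'n \<Rightarrow> real^'n \<Rightarrow> real" where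
  "potential i k j x = (dg i k j x - dg i j k x
     + (if i = j then mass_density k x else 0) - (if i = k then mass_density j x else 0)) / 2"

lemma potential_antisym: "potential i j k x = - potential i k j x"
  by (simp add: potential_def field_simps)

lemma Ck_on_1_mass_density: "Ck_on 1 {x. norm x > 1} (mass_density k)"
  unfolding mass_density_def by (intro Ck_on_1_intros open_norm_gt Ck_on_1_dg)

text \<open>The case distinctions become constant factors, a form to which the closure and
  derivative rules apply.\<close>

lemma potential_alt:
  "potential i k j = (\<lambda>x. 1/2 * (dg i k j x - dg i j k x
     + (if i = j then 1 else 0) * mass_density k x - (if i = k then 1 else 0) * mass_density j x))"
  by (auto simp: potential_def fun_eq_iff)

lemma Ck_on_1_potential: "Ck_on 1 {x. norm x > 1} (potential i k j)"
  unfolding potential_alt by (intro Ck_on_1_intros open_norm_gt Ck_on_1_dg Ck_on_1_mass_density)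

lemma mass_density_differentiable: "norm x > 1 \<Longrightarrow> mass_density k differentiable (at x)"
  using Ck_on_1D(1)[OF Ck_on_1_mass_density] by auto

lemma potential_differentiable: "norm x > 1 \<Longrightarrow> potential i k j differentiable (at x)"
  using Ck_on_1D(1)[OF Ck_on_1_potential] by auto

lemma pd_mass_density:
  assumes "norm x > 1"
  shows "pd m (mass_density k) x = (\<Sum>l\<in>UNIV. ddg l l k m x) - (\<Sum>l\<in>UNIV. ddg k l l m x)"
proof -
  have "pd m (mass_density k) x = pd m (\<lambda>x. \<Sum>l\<in>UNIV. dg l l k x - dg k l l x) x"
    by (simp add: mass_density_def[abs_def])
  also have "\<dots> = (\<Sum>l\<in>UNIV. ddg l l k m x - ddg k l l m x)"
    using assms by (simp add: pd_sum pd_diff dg_differentiable)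
  finally show ?thesis
    by (simp add: sum_subtractf)
qed

lemma pd_potential:
  assumes "norm x > 1"
  shows "pd m (potential i k j) x = (ddg i k j m x - ddg i j k m x
     + (if i = j then pd m (mass_density k) x else 0) - (if i = k then pd m (mass_density j) x else 0)) / 2"
proof -
  have "pd m (\<lambda>x. 1/2 * (dg i k j x - dg i j k x + a * mass_density k x - b * mass_density j x)) x =
    1/2 * (ddg i k j m x - ddg i j k m x + a * pd m (mass_density k) x - b * pd m (mass_density j) x)" for a b
    by (simp only: pd_cmult pd_add pd_diff differentiable_add differentiable_diff differentiable_mult
        differentiable_const dg_differentiable[OF assms] mass_density_differentiable[OF assms])
  then show ?thesis
    unfolding potential_alt by simp
qed

text \<open>Symmetry of g and commuting derivatives make k the outermost derivative in the first two
  sums; the other two sums have i outermost and form the gradient of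
  \<open>mass_density\<close>.\<close>

lemma Ric_lin_eq:
  assumes "norm x > 1"
  shows "Ric_lin i j x =
    ((\<Sum>k\<in>UNIV. ddg i k j k x) - (\<Sum>k\<in>UNIV. ddg i j k k x) - pd i (mass_density j) x) / 2"
proof -
  have "dChr_lin k i j k x - dChr_lin k i k j x
      = (ddg i k j k x - ddg i j k k x - ddg k k j i x + ddg j k k i x) / 2" for k
  proof -
    have "ddg k i j k x = ddg i k j k x" "ddg k i k j x = ddg i k k j x"
      by (rule ddg_sym[OF assms])+
    moreover have "ddg k k i j x = ddg k k j i x"
      by (rule ddg_commute[OF assms])
    moreover have "ddg k j i k x = ddg j k k i x"
      by (subst ddg_sym[OF assms]) (rule ddg_commute[OF assms])
    ultimately show ?thesis
      unfolding dChr_lin_def by (simp add: field_simps)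
  qed
  then have "Ric_lin i j x = (\<Sum>k\<in>UNIV. (ddg i k j k x - ddg i j k k x - ddg k k j i x + ddg j k k i x) / 2)"
    by (simp only: Ric_lin_def)
  then show ?thesis
    by (simp add: pd_mass_density[OF assms] sum.distrib sum_subtractf sum_divide_distrib[symmetric])
qed

text \<open>After commuting derivatives, the trace of the first two sums in
  \<open>Ric_lin_eq\<close> is also minus the divergence of \<open>mass_density\<close>, so the two
  halves add up.\<close>

lemma Scal_lin_eq:
  assumes "norm x > 1"
  shows "Scal_lin x = - (\<Sum>k\<in>UNIV. pd k (mass_density k) x)"
proof -
  have "(\<Sum>i\<in>UNIV. \<Sum>k\<in>UNIV. ddg i i k k x) = (\<Sum>k\<in>UNIV. \<Sum>l\<in>UNIV. ddg l l k k x)"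
    by (rule sum.swap)
  moreover have "(\<Sum>i\<in>UNIV. \<Sum>k\<in>UNIV. ddg i k i k x) = (\<Sum>k\<in>UNIV. \<Sum>l\<in>UNIV. ddg k l l k x)"
    by (intro sum.cong refl ddg_commute assms)
  ultimately show ?thesis
    unfolding Scal_lin_def Ric_lin_eq[OF assms]
    by (simp add: pd_mass_density[OF assms] sum.distrib sum_subtractf sum_divide_distrib[symmetric] field_simps)
qed

lemma Ein_lin_eq_divergence:
  assumes "norm x > 1"
  shows "Ein_lin i j x = (\<Sum>k\<in>UNIV. pd k (potential i k j) x)"
  unfolding Ein_lin_def Ric_lin_eq[OF assms] Scal_lin_eq[OF assms] pd_potential[OF assms]
  by (simp add: sum.distrib sum_subtractf sum_divide_distrib[symmetric] field_simps)

text \<open>The derivative terms contribute one half of \<open>mass_density j\<close>, the term i =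
  j another half, the term i = k minus n halves. This is the origin of the dimensional factor in the
  intrinsic mass.\<close>

lemma sum_potential_diagonal:
  assumes "norm x > 1"
  shows "(\<Sum>k\<in>UNIV. potential k k j x) = (2 - real CARD('n)) / 2 * mass_density j x"
proof -
  have "(\<Sum>k\<in>UNIV. potential k k j x) =
    (\<Sum>k\<in>UNIV. (dg k k j x - dg j k k x + (if k = j then mass_density k x else 0) - mass_density j x) / 2)"
    unfolding potential_def using dg_sym[OF assms, of _ j] by simp
  also have "\<dots> = (\<Sum>k\<in>UNIV. dg k k j x - dg j k k x) / 2 + mass_density j x / 2 - real CARD('n) * mass_density j x / 2"
    by (simp add: sum.distrib sum_subtractf sum_divide_distrib[symmetric] field_simps)
  also have "\<dots> = (2 - real CARD('n)) / 2 * mass_density j x"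
    by (simp add: mass_density_def[symmetric] field_simps)
  finally show ?thesis .
qed

section \<open>Fluxes of the linearized Einstein tensor\<close>

lemma continuous_on_Ein_lin: "continuous_on {x. norm x > 1} (Ein_lin i j)"
proof -
  have "continuous_on {x. norm x > 1} (\<lambda>x. \<Sum>k\<in>UNIV. pd k (potential i k j) x)"
    using Ck_on_1D(3)[OF Ck_on_1_potential] by (intro continuous_intros) auto
  then show ?thesis
    by (rule continuous_on_eq) (simp add: Ein_lin_eq_divergence)
qed

text \<open>Contracting the index i with V keeps the potential antisymmetric in k and j, so the
  divergence of the contraction integrates to zero; the product rule splits it into the flux and a
  term with derivatives of V. The weight x_j stands for r times the unit normal.\<close>

lemma sphere_int_Ein_lin:
  assumes r: "r > 1" and V: "\<And>i. Ck_on 1 {x. norm x > 1} (V i)"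
  shows "sphere_int r (\<lambda>x. \<Sum>i\<in>UNIV. \<Sum>j\<in>UNIV. Ein_lin i j x * V i x * x $ j) =
    - sphere_int r (\<lambda>x. \<Sum>k\<in>UNIV. \<Sum>j\<in>UNIV. \<Sum>i\<in>UNIV. potential i k j x * pd k (V i) x * x $ j)"
proof -
  let ?U = "{x::real^'n. norm x > 1}"
  have sub: "sphere 0 r \<subseteq> ?U" and r0: "r > 0"
    using r by auto
  define A where "A k j x = (\<Sum>i\<in>UNIV. potential i k j x * V i x)" for k j x
  have A: "Ck_on 1 ?U (A k j)" for k j
    unfolding A_def[abs_def] by (intro Ck_on_1_intros Ck_on_1_potential V open_norm_gt)
  have V': "V i differentiable (at x)" if "norm x > 1" for i x
    using Ck_on_1D(1)[OF V] that by auto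
  have pdA: "pd k (A k j) x = (\<Sum>i\<in>UNIV. pd k (potential i k j) x * V i x) + (\<Sum>i\<in>UNIV. potential i k j x * pd k (V i) x)"
    if "norm x > 1" for k j x
    unfolding A_def[abs_def] using that
    by (simp add: pd_sum pd_mult differentiable_mult potential_differentiable V' sum.distrib)
  have cV: "continuous_on (sphere 0 r) (V i)" "continuous_on (sphere 0 r) (pd k (V i))" for i k
    using Ck_on_1D(2,3)[OF V open_norm_gt] sub by (auto intro: continuous_on_subset)
  have cE: "continuous_on (sphere 0 r) (Ein_lin i j)" for i j
    using continuous_on_Ein_lin sub by (rule continuous_on_subset)
  have cP: "continuous_on (sphere 0 r) (potential i k j)" for i k j
    using Ck_on_1D(2)[OF Ck_on_1_potential open_norm_gt] sub by (rule continuous_on_subset)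
  have "0 = sphere_int r (\<lambda>x. \<Sum>k\<in>UNIV. \<Sum>j\<in>UNIV. pd k (A k j) x * x $ j)"
  proof (rule sphere_int_antisym_divergence[symmetric, OF r0 open_norm_gt sub A])
    show "A j k x = - A k j x" for k j x
      unfolding A_def potential_antisym[of _ j k] by (simp add: sum_negf)
  qed
  also have "\<dots> = sphere_int r (\<lambda>x. (\<Sum>i\<in>UNIV. \<Sum>j\<in>UNIV. Ein_lin i j x * V i x * x $ j)
      + (\<Sum>k\<in>UNIV. \<Sum>j\<in>UNIV. \<Sum>i\<in>UNIV. potential i k j x * pd k (V i) x * x $ j))"
  proof (rule sphere_int_cong[OF r0])
    fix x :: "real^'n"
    assume "norm x = r"
    then have x: "norm x > 1"
      using r by simp
    have "(\<Sum>k\<in>UNIV. \<Sum>j\<in>UNIV. \<Sum>i\<in>UNIV. pd k (potential i k j) x * V i x * x $ j)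
      = (\<Sum>j\<in>UNIV. \<Sum>k\<in>UNIV. \<Sum>i\<in>UNIV. pd k (potential i k j) x * V i x * x $ j)"
      by (rule sum.swap)
    also have "\<dots> = (\<Sum>j\<in>UNIV. \<Sum>i\<in>UNIV. \<Sum>k\<in>UNIV. pd k (potential i k j) x * V i x * x $ j)"
      by (intro sum.cong refl sum.swap)
    also have "\<dots> = (\<Sum>i\<in>UNIV. \<Sum>j\<in>UNIV. \<Sum>k\<in>UNIV. pd k (potential i k j) x * V i x * x $ j)"
      by (rule sum.swap)
    also have "\<dots> = (\<Sum>i\<in>UNIV. \<Sum>j\<in>UNIV. Ein_lin i j x * V i x * x $ j)"
      by (simp add: Ein_lin_eq_divergence[OF x] sum_distrib_right)
    finally show "(\<Sum>k\<in>UNIV. \<Sum>j\<in>UNIV. pd k (A k j) x * x $ j) =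
      (\<Sum>i\<in>UNIV. \<Sum>j\<in>UNIV. Ein_lin i j x * V i x * x $ j)
      + (\<Sum>k\<in>UNIV. \<Sum>j\<in>UNIV. \<Sum>i\<in>UNIV. potential i k j x * pd k (V i) x * x $ j)"
      by (simp add: pdA[OF x] distrib_right sum.distrib sum_distrib_right)
  qed
  also have "\<dots> = sphere_int r (\<lambda>x. \<Sum>i\<in>UNIV. \<Sum>j\<in>UNIV. Ein_lin i j x * V i x * x $ j)
    + sphere_int r (\<lambda>x. \<Sum>k\<in>UNIV. \<Sum>j\<in>UNIV. \<Sum>i\<in>UNIV. potential i k j x * pd k (V i) x * x $ j)"
    by (intro sphere_int_add r0 continuous_intros cV cE cP)
  finally show ?thesis by simp
qed

lemma sphere_int_Ein_lin_radial:
  assumes r: "r > 1"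
  shows "sphere_int r (\<lambda>x. \<Sum>i\<in>UNIV. \<Sum>j\<in>UNIV. Ein_lin i j x * x $ i * x $ j) =
    (real CARD('n) - 2) / 2 * sphere_int r (\<lambda>x. \<Sum>j\<in>UNIV. mass_density j x * x $ j)"
proof -
  have "sphere_int r (\<lambda>x. \<Sum>i\<in>UNIV. \<Sum>j\<in>UNIV. Ein_lin i j x * x $ i * x $ j) =
    - sphere_int r (\<lambda>x. \<Sum>k\<in>UNIV. \<Sum>j\<in>UNIV. \<Sum>i\<in>UNIV. potential i k j x * pd k (\<lambda>x. x $ i) x * x $ j)"
    by (rule sphere_int_Ein_lin[OF r Ck_on_1_component])
  also have "sphere_int r (\<lambda>x. \<Sum>k\<in>UNIV. \<Sum>j\<in>UNIV. \<Sum>i\<in>UNIV. potential i k j x * pd k (\<lambda>x. x $ i) x * x $ j)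
    = sphere_int r (\<lambda>x. (2 - real CARD('n)) / 2 * (\<Sum>j\<in>UNIV. mass_density j x * x $ j))"
  proof (rule sphere_int_cong)
    fix x :: "real^'n"
    assume "norm x = r"
    then have x: "norm x > 1"
      using r by simp
    have "(\<Sum>k\<in>UNIV. \<Sum>j\<in>UNIV. \<Sum>i\<in>UNIV. potential i k j x * pd k (\<lambda>x. x $ i) x * x $ j)
      = (\<Sum>k\<in>UNIV. \<Sum>j\<in>UNIV. potential k k j x * x $ j)"
      by (simp add: if_distrib[of "\<lambda>c. _ * c"] if_distrib[of "\<lambda>c. c * _"] cong: if_cong)
    also have "\<dots> = (\<Sum>j\<in>UNIV. (\<Sum>k\<in>UNIV. potential k k j x) * x $ j)"
      by (subst sum.swap) (simp add: sum_distrib_right)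
    also have "\<dots> = (2 - real CARD('n)) / 2 * (\<Sum>j\<in>UNIV. mass_density j x * x $ j)"
      by (simp only: sum_potential_diagonal[OF x] sum_distrib_left mult.assoc)
    finally show "(\<Sum>k\<in>UNIV. \<Sum>j\<in>UNIV. \<Sum>i\<in>UNIV. potential i k j x * pd k (\<lambda>x. x $ i) x * x $ j)
      = (2 - real CARD('n)) / 2 * (\<Sum>j\<in>UNIV. mass_density j x * x $ j)" .
  qed (use r in simp)
  also have "\<dots> = (2 - real CARD('n)) / 2 * sphere_int r (\<lambda>x. \<Sum>j\<in>UNIV. mass_density j x * x $ j)"
    by (rule sphere_int_cmult)
  finally show ?thesis
    by (simp add: field_simps)
qed

text \<open>Of the three terms of \<open>pd_Yfield\<close>, the first meets the symmetric x_k x_j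
  and vanishes by antisymmetry, the third gives the trace, and the middle one is left for a second
  integration by parts.\<close>

lemma potential_conformal_contraction:
  assumes "norm x > 1"
  shows "(\<Sum>k\<in>UNIV. \<Sum>j\<in>UNIV. \<Sum>i\<in>UNIV. potential i k j x * pd k (\<lambda>x. Yfield a x $ i) x * x $ j) =
    - 2 * (\<Sum>j\<in>UNIV. \<Sum>i\<in>UNIV. potential i a j x * x $ i * x $ j)
    - (2 - real CARD('n)) * x $ a * (\<Sum>j\<in>UNIV. mass_density j x * x $ j)"
proof -
  have "(\<Sum>k\<in>UNIV. \<Sum>j\<in>UNIV. potential a k j x * x $ k * x $ j)
    = (\<Sum>k\<in>UNIV. \<Sum>j\<in>UNIV. potential a j k x * x $ j * x $ k)"
    by (rule sum.swap)
  also have "\<dots> = - (\<Sum>k\<in>UNIV. \<Sum>j\<in>UNIV. potential a k j x * x $ k * x $ j)"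
  proof -
    have "potential a j k x * x $ j * x $ k = - (potential a k j x * x $ k * x $ j)" for j k
      using potential_antisym[of a j k x] by simp
    then have "(\<Sum>k\<in>UNIV. \<Sum>j\<in>UNIV. potential a j k x * x $ j * x $ k)
      = (\<Sum>k\<in>UNIV. \<Sum>j\<in>UNIV. - (potential a k j x * x $ k * x $ j))"
      by (intro sum.cong refl)
    then show ?thesis
      by (simp only: sum_negf)
  qed
  finally have first: "(\<Sum>k\<in>UNIV. \<Sum>j\<in>UNIV. potential a k j x * x $ k * x $ j) = 0"
    by simp
  have "(\<Sum>k\<in>UNIV. \<Sum>j\<in>UNIV. potential k k j x * x $ j) = (\<Sum>j\<in>UNIV. (\<Sum>k\<in>UNIV. potential k k j x) * x $ j)"
    by (subst sum.swap) (simp add: sum_distrib_right)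
  also have "\<dots> = (2 - real CARD('n)) / 2 * (\<Sum>j\<in>UNIV. mass_density j x * x $ j)"
    by (simp only: sum_potential_diagonal[OF assms] sum_distrib_left mult.assoc)
  finally have last: "(\<Sum>k\<in>UNIV. \<Sum>j\<in>UNIV. potential k k j x * x $ j) = (2 - real CARD('n)) / 2 * (\<Sum>j\<in>UNIV. mass_density j x * x $ j)" .
  have "(\<Sum>k\<in>UNIV. \<Sum>j\<in>UNIV. \<Sum>i\<in>UNIV. potential i k j x * pd k (\<lambda>x. Yfield a x $ i) x * x $ j)
    = (\<Sum>k\<in>UNIV. \<Sum>j\<in>UNIV. \<Sum>i\<in>UNIV. (if i = a then 2 * (potential i k j x * x $ k * x $ j) else 0)
        - (if k = a then 2 * (potential i k j x * x $ i * x $ j) else 0)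
        - (if i = k then 2 * x $ a * (potential i k j x * x $ j) else 0))"
    unfolding pd_Yfield by (intro sum.cong refl) (auto simp: algebra_simps)
  also have "\<dots> = (\<Sum>k\<in>UNIV. \<Sum>j\<in>UNIV. 2 * (potential a k j x * x $ k * x $ j))
      - (\<Sum>k\<in>UNIV. if k = a then (\<Sum>j\<in>UNIV. \<Sum>i\<in>UNIV. 2 * (potential i k j x * x $ i * x $ j)) else 0)
      - (\<Sum>k\<in>UNIV. \<Sum>j\<in>UNIV. 2 * x $ a * (potential k k j x * x $ j))"
    unfolding sum_subtractf
    by (intro arg_cong2[where f = "(-)"] sum.cong refl) (simp_all cong: if_cong)
  also have "\<dots> = 2 * (\<Sum>k\<in>UNIV. \<Sum>j\<in>UNIV. potential a k j x * x $ k * x $ j)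
      - 2 * (\<Sum>j\<in>UNIV. \<Sum>i\<in>UNIV. potential i a j x * x $ i * x $ j)
      - 2 * x $ a * (\<Sum>k\<in>UNIV. \<Sum>j\<in>UNIV. potential k k j x * x $ j)"
    by (simp add: sum_distrib_left)
  finally show ?thesis
    unfolding first last by simp
qed

text \<open>The six terms of the contraction pair up exactly, with weight x_j, into derivatives
  along rotation fields: of g_ll in the ja-plane, of g_ai in the ij-plane and of g_jl in the
  al-plane. In this form \<open>sphere_int_by_parts_rotation\<close> applies term by term.\<close>

lemma potential_rotation_form:
  assumes "norm x > 1"
  shows "2 * (\<Sum>j\<in>UNIV. \<Sum>i\<in>UNIV. potential i a j x * x $ i * x $ j) =
    (\<Sum>j\<in>UNIV. \<Sum>l\<in>UNIV. x $ j * (x $ j * dg l l a x - x $ a * dg l l j x))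
    + (\<Sum>i\<in>UNIV. \<Sum>j\<in>UNIV. x $ j * (x $ i * dg a i j x - x $ j * dg a i i x))
    + (\<Sum>j\<in>UNIV. \<Sum>l\<in>UNIV. x $ j * (x $ a * dg j l l x - x $ l * dg j l a x))"
proof -
  have "2 * (\<Sum>j\<in>UNIV. \<Sum>i\<in>UNIV. potential i a j x * x $ i * x $ j)
    = (\<Sum>j\<in>UNIV. \<Sum>i\<in>UNIV. (dg i a j x - dg i j a x) * x $ i * x $ j
      + (if i = j then mass_density a x * x $ i * x $ j else 0) - (if i = a then mass_density j x * x $ i * x $ j else 0))"
    unfolding potential_def sum_distrib_left by (intro sum.cong refl) (auto simp: field_simps)
  also have "\<dots> = (\<Sum>j\<in>UNIV. \<Sum>i\<in>UNIV. (dg i a j x - dg i j a x) * x $ i * x $ j)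
    + (\<Sum>j\<in>UNIV. mass_density a x * x $ j * x $ j) - (\<Sum>j\<in>UNIV. mass_density j x * x $ a * x $ j)"
    by (simp add: sum.distrib sum_subtractf)
  also have "(\<Sum>j\<in>UNIV. \<Sum>i\<in>UNIV. (dg i a j x - dg i j a x) * x $ i * x $ j) =
    (\<Sum>j\<in>UNIV. \<Sum>i\<in>UNIV. x $ j * x $ i * dg a i j x) - (\<Sum>j\<in>UNIV. \<Sum>i\<in>UNIV. x $ j * x $ i * dg j i a x)"
    unfolding sum_subtractf[symmetric] using dg_sym[OF assms]
    by (intro sum.cong refl) (simp add: algebra_simps)
  also have "(\<Sum>j\<in>UNIV. \<Sum>i\<in>UNIV. x $ j * x $ i * dg a i j x) = (\<Sum>i\<in>UNIV. \<Sum>j\<in>UNIV. x $ j * x $ i * dg a i j x)"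
    by (rule sum.swap)
  finally have 1: "2 * (\<Sum>j\<in>UNIV. \<Sum>i\<in>UNIV. potential i a j x * x $ i * x $ j) =
     (\<Sum>i\<in>UNIV. \<Sum>j\<in>UNIV. x $ j * x $ i * dg a i j x) - (\<Sum>j\<in>UNIV. \<Sum>i\<in>UNIV. x $ j * x $ i * dg j i a x)
     + (\<Sum>j\<in>UNIV. mass_density a x * x $ j * x $ j) - (\<Sum>j\<in>UNIV. mass_density j x * x $ a * x $ j)" .
  have 2: "(\<Sum>j\<in>UNIV. mass_density a x * x $ j * x $ j)
    = (\<Sum>j\<in>UNIV. \<Sum>l\<in>UNIV. x $ j * x $ j * dg l l a x) - (\<Sum>i\<in>UNIV. \<Sum>j\<in>UNIV. x $ j * x $ j * dg a i i x)"
    unfolding sum.swap[of "\<lambda>i j. x $ j * x $ j * dg a i i x"] sum_subtractf[symmetric] mass_density_def sum_distrib_right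
    by (intro sum.cong refl) (simp add: algebra_simps)
  have 3: "(\<Sum>j\<in>UNIV. mass_density j x * x $ a * x $ j)
    = (\<Sum>j\<in>UNIV. \<Sum>l\<in>UNIV. x $ j * x $ a * dg l l j x) - (\<Sum>j\<in>UNIV. \<Sum>l\<in>UNIV. x $ j * x $ a * dg j l l x)"
    unfolding sum_subtractf[symmetric] mass_density_def sum_distrib_right
    by (intro sum.cong refl) (simp add: algebra_simps)
  show ?thesis
    unfolding 1 2 3 by (simp add: right_diff_distrib sum_subtractf mult.assoc)
qed

lemma sphere_int_potential:
  assumes r: "r > 1"
  shows "sphere_int r (\<lambda>x. 2 * (\<Sum>j\<in>UNIV. \<Sum>i\<in>UNIV. potential i a j x * x $ i * x $ j)) =
    (real CARD('n) - 2) * sphere_int r (\<lambda>x. x $ a * (\<Sum>l\<in>UNIV. gc g l l x) - (\<Sum>i\<in>UNIV. x $ i * gc g i a x))"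
proof -
  let ?U = "{x::real^'n. norm x > 1}"
  have sub: "sphere 0 r \<subseteq> ?U" and r0: "r > 0"
    using r by auto
  have cd: "continuous_on (sphere 0 r) (dg i j k)" and cg: "continuous_on (sphere 0 r) (gc g i j)" for i j k
    by (rule continuous_on_subset[OF continuous_on_dg sub] continuous_on_subset[OF continuous_on_gc sub])+
  note parts = sphere_int_by_parts_rotation[OF r Ck_on_1_gc]
  have "sphere_int r (\<lambda>x. 2 * (\<Sum>j\<in>UNIV. \<Sum>i\<in>UNIV. potential i a j x * x $ i * x $ j))
    = sphere_int r (\<lambda>x. (\<Sum>j\<in>UNIV. \<Sum>l\<in>UNIV. x $ j * (x $ j * dg l l a x - x $ a * dg l l j x))
    + (\<Sum>i\<in>UNIV. \<Sum>j\<in>UNIV. x $ j * (x $ i * dg a i j x - x $ j * dg a i i x))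
    + (\<Sum>j\<in>UNIV. \<Sum>l\<in>UNIV. x $ j * (x $ a * dg j l l x - x $ l * dg j l a x)))"
    using r by (intro sphere_int_cong r0 potential_rotation_form) simp
  also have "\<dots> = (\<Sum>j\<in>UNIV. \<Sum>l\<in>UNIV. sphere_int r (\<lambda>x. x $ j * (x $ j * dg l l a x - x $ a * dg l l j x)))
    + (\<Sum>i\<in>UNIV. \<Sum>j\<in>UNIV. sphere_int r (\<lambda>x. x $ j * (x $ i * dg a i j x - x $ j * dg a i i x)))
    + (\<Sum>j\<in>UNIV. \<Sum>l\<in>UNIV. sphere_int r (\<lambda>x. x $ j * (x $ a * dg j l l x - x $ l * dg j l a x)))"
    by (simp add: sphere_int_add sphere_int_sum r0 continuous_intros cd)
  also have "\<dots> = - ((\<Sum>j\<in>UNIV. \<Sum>l\<in>UNIV. sphere_int r (\<lambda>x. ((if a = j then x $ j else 0) - x $ a) * gc g l l x))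
    + (\<Sum>i\<in>UNIV. \<Sum>j\<in>UNIV. sphere_int r (\<lambda>x. (x $ i - (if i = j then x $ j else 0)) * gc g a i x))
    + (\<Sum>j\<in>UNIV. \<Sum>l\<in>UNIV. sphere_int r (\<lambda>x. ((if l = j then x $ a else 0) - (if a = j then x $ l else 0)) * gc g j l x)))"
    by (simp add: parts sum_negf)
  also have "\<dots> = - sphere_int r (\<lambda>x.
      (\<Sum>j\<in>UNIV. \<Sum>l\<in>UNIV. ((if a = j then x $ j else 0) - x $ a) * gc g l l x)
    + (\<Sum>i\<in>UNIV. \<Sum>j\<in>UNIV. (x $ i - (if i = j then x $ j else 0)) * gc g a i x)
    + (\<Sum>j\<in>UNIV. \<Sum>l\<in>UNIV. ((if l = j then x $ a else 0) - (if a = j then x $ l else 0)) * gc g j l x))"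
  proof -
    have ci: "continuous_on (sphere 0 r) (\<lambda>x::real^'n. if b then x $ m else 0)" for b m
      by (cases b) (auto intro: continuous_intros)
    show ?thesis
      by (simp add: sphere_int_add sphere_int_sum r0 continuous_on_add continuous_on_sum continuous_on_mult
          continuous_on_diff continuous_on_component continuous_on_id ci cg)
  qed
  also have "sphere_int r (\<lambda>x.
      (\<Sum>j\<in>UNIV. \<Sum>l\<in>UNIV. ((if a = j then x $ j else 0) - x $ a) * gc g l l x)
    + (\<Sum>i\<in>UNIV. \<Sum>j\<in>UNIV. (x $ i - (if i = j then x $ j else 0)) * gc g a i x)
    + (\<Sum>j\<in>UNIV. \<Sum>l\<in>UNIV. ((if l = j then x $ a else 0) - (if a = j then x $ l else 0)) * gc g j l x))
    = sphere_int r (\<lambda>x. (2 - real CARD('n)) * (x $ a * (\<Sum>l\<in>UNIV. gc g l l x) - (\<Sum>i\<in>UNIV. x $ i * gc g i a x)))"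
  proof (rule sphere_int_cong[OF r0])
    fix x :: "real^'n"
    assume "norm x = r"
    then have x: "norm x > 1"
      using r by simp
    \<comment> \<open>With t the trace of g and s = \<Sum> x_i g_ia, the three sums are (1-n) x_a t,
      (n-1) s and x_a t - s. They add up to (2-n)(x_a t - s), and the sign of the integration by
      parts turns the factor into n-2.\<close>
    define t where "t = (\<Sum>l\<in>UNIV. gc g l l x)"
    define s where "s = (\<Sum>i\<in>UNIV. x $ i * gc g i a x)"
    have "(\<Sum>j\<in>UNIV. \<Sum>l\<in>UNIV. ((if a = j then x $ j else 0) - x $ a) * gc g l l x)
      = (\<Sum>j\<in>UNIV. (if a = j then x $ j else 0) - x $ a) * t"
      by (simp only: t_def sum_product)
    also have "\<dots> = (1 - real CARD('n)) * (x $ a * t)"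
      by (simp add: sum_subtractf algebra_simps)
    finally have 1: "(\<Sum>j\<in>UNIV. \<Sum>l\<in>UNIV. ((if a = j then x $ j else 0) - x $ a) * gc g l l x)
      = (1 - real CARD('n)) * (x $ a * t)" .
    have "(\<Sum>i\<in>UNIV. \<Sum>j\<in>UNIV. (x $ i - (if i = j then x $ j else 0)) * gc g a i x)
      = (\<Sum>i\<in>UNIV. (real CARD('n) - 1) * (x $ i * gc g i a x))"
    proof (intro sum.cong refl)
      fix i
      have "(\<Sum>j\<in>UNIV. (x $ i - (if i = j then x $ j else 0)) * gc g a i x) = (\<Sum>j\<in>UNIV. x $ i - (if i = j then x $ j else 0)) * gc g a i x"
        by (rule sum_distrib_right[symmetric])
      also have "\<dots> = (real CARD('n) - 1) * (x $ i * gc g i a x)"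
        by (simp add: sum_subtractf gc_sym[OF x, of a] algebra_simps)
      finally show "(\<Sum>j\<in>UNIV. (x $ i - (if i = j then x $ j else 0)) * gc g a i x) = (real CARD('n) - 1) * (x $ i * gc g i a x)" .
    qed
    then have 2: "(\<Sum>i\<in>UNIV. \<Sum>j\<in>UNIV. (x $ i - (if i = j then x $ j else 0)) * gc g a i x) = (real CARD('n) - 1) * s"
      by (simp add: s_def sum_distrib_left)
    have "(\<Sum>j\<in>UNIV. \<Sum>l\<in>UNIV. ((if l = j then x $ a else 0) - (if a = j then x $ l else 0)) * gc g j l x)
      = (\<Sum>j\<in>UNIV. x $ a * gc g j j x - (if a = j then (\<Sum>l\<in>UNIV. x $ l * gc g j l x) else 0))"
      by (intro sum.cong refl)
        (simp add: left_diff_distrib sum_subtractf if_distrib[of "\<lambda>c. c * _"] cong: if_cong)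
    also have "\<dots> = x $ a * t - s"
      by (simp add: t_def s_def sum_subtractf sum_distrib_left gc_sym[OF x, of a])
    finally have 3: "(\<Sum>j\<in>UNIV. \<Sum>l\<in>UNIV. ((if l = j then x $ a else 0) - (if a = j then x $ l else 0)) * gc g j l x)
      = x $ a * t - s" .
    show "(\<Sum>j\<in>UNIV. \<Sum>l\<in>UNIV. ((if a = j then x $ j else 0) - x $ a) * gc g l l x)
    + (\<Sum>i\<in>UNIV. \<Sum>j\<in>UNIV. (x $ i - (if i = j then x $ j else 0)) * gc g a i x)
    + (\<Sum>j\<in>UNIV. \<Sum>l\<in>UNIV. ((if l = j then x $ a else 0) - (if a = j then x $ l else 0)) * gc g j l x)
    = (2 - real CARD('n)) * (x $ a * (\<Sum>l\<in>UNIV. gc g l l x) - (\<Sum>i\<in>UNIV. x $ i * gc g i a x))"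
      unfolding 1 2 3 t_def[symmetric] s_def[symmetric] by (simp add: algebra_simps)
  qed
  also have "\<dots> = (2 - real CARD('n)) * sphere_int r (\<lambda>x. x $ a * (\<Sum>l\<in>UNIV. gc g l l x) - (\<Sum>i\<in>UNIV. x $ i * gc g i a x))"
    by (rule sphere_int_cmult)
  finally show ?thesis
    by (simp add: algebra_simps)
qed

text \<open>The twice integrated term contributes the undifferentiated g, the trace term the
  derivative part of the integrand of the center. Both carry the factor n-2, which the normalization
  of \<open>c_I\<close> removes.\<close>

lemma sphere_int_Ein_lin_conformal:
  assumes r: "r > 1"
  shows "sphere_int r (\<lambda>x. \<Sum>i\<in>UNIV. \<Sum>j\<in>UNIV. Ein_lin i j x * Yfield a x $ i * x $ j) =
    (real CARD('n) - 2) * sphere_int r (\<lambda>x. x $ a * (\<Sum>l\<in>UNIV. gc g l l x) - (\<Sum>i\<in>UNIV. x $ i * gc g i a x)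
      - x $ a * (\<Sum>j\<in>UNIV. mass_density j x * x $ j))"
proof -
  let ?U = "{x::real^'n. norm x > 1}"
  have sub: "sphere 0 r \<subseteq> ?U" and r0: "r > 0"
    using r by auto
  have cm: "continuous_on (sphere 0 r) (mass_density j)" and cp: "continuous_on (sphere 0 r) (potential i k j)"
    and cg: "continuous_on (sphere 0 r) (gc g i j)" for i j k
    by (rule continuous_on_subset[OF Ck_on_1D(2)[OF Ck_on_1_mass_density open_norm_gt] sub]
        continuous_on_subset[OF Ck_on_1D(2)[OF Ck_on_1_potential open_norm_gt] sub]
        continuous_on_subset[OF continuous_on_gc sub])+
  have "sphere_int r (\<lambda>x. \<Sum>i\<in>UNIV. \<Sum>j\<in>UNIV. Ein_lin i j x * Yfield a x $ i * x $ j) =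
    - sphere_int r (\<lambda>x. \<Sum>k\<in>UNIV. \<Sum>j\<in>UNIV. \<Sum>i\<in>UNIV. potential i k j x * pd k (\<lambda>x. Yfield a x $ i) x * x $ j)"
    by (rule sphere_int_Ein_lin[OF r Ck_on_1_Yfield])
  also have "\<dots> = sphere_int r (\<lambda>x. 2 * (\<Sum>j\<in>UNIV. \<Sum>i\<in>UNIV. potential i a j x * x $ i * x $ j)
      - (real CARD('n) - 2) * (x $ a * (\<Sum>j\<in>UNIV. mass_density j x * x $ j)))"
    unfolding sphere_int_minus[symmetric]
  proof (rule sphere_int_cong[OF r0])
    fix x :: "real^'n"
    assume "norm x = r"
    then have x: "norm x > 1"
      using r by simp
    show "- (\<Sum>k\<in>UNIV. \<Sum>j\<in>UNIV. \<Sum>i\<in>UNIV. potential i k j x * pd k (\<lambda>x. Yfield a x $ i) x * x $ j)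
      = 2 * (\<Sum>j\<in>UNIV. \<Sum>i\<in>UNIV. potential i a j x * x $ i * x $ j)
      - (real CARD('n) - 2) * (x $ a * (\<Sum>j\<in>UNIV. mass_density j x * x $ j))"
      unfolding potential_conformal_contraction[OF x] by (simp add: algebra_simps)
  qed
  also have "\<dots> = sphere_int r (\<lambda>x. 2 * (\<Sum>j\<in>UNIV. \<Sum>i\<in>UNIV. potential i a j x * x $ i * x $ j))
      - (real CARD('n) - 2) * sphere_int r (\<lambda>x. x $ a * (\<Sum>j\<in>UNIV. mass_density j x * x $ j))"
    unfolding sphere_int_cmult[symmetric] by (intro sphere_int_diff r0 continuous_intros cp cm)
  also have "\<dots> = (real CARD('n) - 2) * (sphere_int r (\<lambda>x. x $ a * (\<Sum>l\<in>UNIV. gc g l l x) - (\<Sum>i\<in>UNIV. x $ i * gc g i a x))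
      - sphere_int r (\<lambda>x. x $ a * (\<Sum>j\<in>UNIV. mass_density j x * x $ j)))"
    unfolding sphere_int_potential[OF r] by (simp add: right_diff_distrib)
  also have "\<dots> = (real CARD('n) - 2) * sphere_int r (\<lambda>x. x $ a * (\<Sum>l\<in>UNIV. gc g l l x) - (\<Sum>i\<in>UNIV. x $ i * gc g i a x)
      - x $ a * (\<Sum>j\<in>UNIV. mass_density j x * x $ j))"
    by (intro arg_cong2[where f = "(*)"] refl sphere_int_diff[symmetric] r0 continuous_intros cg cm)
  finally show ?thesis .
qed

end

section \<open>Decay and parity at infinity\<close>

abbreviation little_o :: "real \<Rightarrow> ('a::real_normed_vector \<Rightarrow> real) \<Rightarrow> bool" where
  "little_o a f \<equiv> ((\<lambda>x. norm x powr a * f x) \<longlongrightarrow> 0) at_infinity"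

lemma little_o_add: "little_o a f \<Longrightarrow> little_o a g \<Longrightarrow> little_o a (\<lambda>x. f x + g x)"
  using tendsto_add[of "\<lambda>x. norm x powr a * f x" 0 at_infinity "\<lambda>x. norm x powr a * g x" 0]
  by (simp add: distrib_left)

lemma little_o_cmult: "little_o a f \<Longrightarrow> little_o a (\<lambda>x. c * f x)"
  using tendsto_mult_left[of "\<lambda>x. norm x powr a * f x" 0 at_infinity c]
  by (simp add: mult.left_commute)

lemma little_o_mult: "little_o a f \<Longrightarrow> little_o b g \<Longrightarrow> little_o (a + b) (\<lambda>x. f x * g x)"
  using tendsto_mult[of "\<lambda>x. norm x powr a * f x" 0 at_infinity "\<lambda>x. norm x powr b * g x" 0]
  by (simp add: powr_add mult_ac)

lemma filterlim_reflect_at_infinity: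
  "filterlim (\<lambda>x::'a::real_normed_vector. - x) at_infinity at_infinity"
  by (rule filterlim_norm_at_top_imp_at_infinity) (simp add: filterlim_norm_at_top)

lemma little_o_reflect: "little_o a f \<Longrightarrow> little_o a (\<lambda>x. f (- x))"
  using filterlim_compose[OF _ filterlim_reflect_at_infinity, of "\<lambda>x. norm x powr a * f x"] by simp

lemma eventually_norm_gt_at_infinity: "\<forall>\<^sub>F x in at_infinity. norm (x::'a::real_normed_vector) > c"
  unfolding eventually_at_infinity by (intro exI[of _ "c + 1"]) auto

lemma little_o_bounded:
  assumes "little_o a f" "\<forall>\<^sub>F x in at_infinity. \<bar>h x\<bar> \<le> C * \<bar>f x\<bar>"
  shows "little_o a h"
proof (rule Lim_null_comparison)
  show "((\<lambda>x. C * \<bar>norm x powr a * f x\<bar>) \<longlongrightarrow> 0) at_infinity"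
    using tendsto_mult_left[OF tendsto_rabs_zero[OF assms(1)], of C] by simp
  show "\<forall>\<^sub>F x in at_infinity. norm (norm x powr a * h x) \<le> C * \<bar>norm x powr a * f x\<bar>"
    using assms(2)
  proof eventually_elim
    case (elim x)
    then have "norm x powr a * \<bar>h x\<bar> \<le> norm x powr a * (C * \<bar>f x\<bar>)"
      by (intro mult_left_mono) auto
    then show ?case
      by (simp add: abs_mult mult_ac)
  qed
qed

lemma little_o_mono:
  assumes "little_o a f" "b \<le> a"
  shows "little_o b f"
proof (rule Lim_null_comparison[OF _ tendsto_rabs_zero[OF assms(1)]])
  show "\<forall>\<^sub>F x in at_infinity. norm (norm x powr b * f x) \<le> \<bar>norm x powr a * f x\<bar>"
    using eventually_norm_gt_at_infinity[of 1]
  proof eventually_elim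
    case (elim x)
    then show ?case
      using assms(2) by (simp add: abs_mult mult_right_mono powr_mono)
  qed
qed

lemma little_o_cong:
  assumes "little_o a f" "\<And>x. norm x > 1 \<Longrightarrow> f x = h x"
  shows "little_o a h"
proof (rule Lim_transform_eventually[OF assms(1)])
  show "\<forall>\<^sub>F x in at_infinity. norm x powr a * f x = norm x powr a * h x"
    using eventually_norm_gt_at_infinity[of 1] by eventually_elim (simp add: assms(2))
qed

text \<open>\<open>decays \<delta> s a f\<close>: $f = o(|x|^{-a})$, and the part of $f$ violating the parity
  $f(-x) = s f(x)$ gains a further factor $|x|^{-\delta}$. For $\delta = 0$ the parity requirement is
  vacuous; the Regge--Teitelboim condition corresponds to $\delta = 1$.\<close>

definition decays :: "real \<Rightarrow> real \<Rightarrow> real \<Rightarrow> ('a::real_normed_vector \<Rightarrow> real) \<Rightarrow> bool" where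
  "decays \<delta> s a f \<longleftrightarrow> little_o a f \<and> little_o (a + \<delta>) (\<lambda>x. f x - s * f (- x))"

lemma decays_0:
  assumes "little_o a f"
  shows "decays 0 s a f"
  using little_o_add[OF assms little_o_cmult[OF little_o_reflect[OF assms], of "- s"]] assms
  by (simp add: decays_def)

lemma decays_add:
  assumes "decays \<delta> s a f" "decays \<delta> s a g"
  shows "decays \<delta> s a (\<lambda>x. f x + g x)"
  using little_o_add[of a f g]
    little_o_add[of "a + \<delta>" "\<lambda>x. f x - s * f (- x)" "\<lambda>x. g x - s * g (- x)"] assms
  by (simp add: decays_def algebra_simps)

lemma decays_cmult:
  assumes "decays \<delta> s a f"
  shows "decays \<delta> s a (\<lambda>x. c * f x)"
  using little_o_cmult[of a f c] little_o_cmult[of "a + \<delta>" "\<lambda>x. f x - s * f (- x)" c] assms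
  by (simp add: decays_def algebra_simps)

lemma decays_diff:
  assumes "decays \<delta> s a f" "decays \<delta> s a g"
  shows "decays \<delta> s a (\<lambda>x. f x - g x)"
  using decays_add[OF assms(1) decays_cmult[OF assms(2), of "- 1"]] by simp

lemma decays_zero: "decays \<delta> s a (\<lambda>_. 0)"
  by (simp add: decays_def)

lemma decays_sum:
  assumes "\<And>i. i \<in> A \<Longrightarrow> decays \<delta> s a (f i)"
  shows "decays \<delta> s a (\<lambda>x. \<Sum>i\<in>A. f i x)"
proof (cases "finite A")
  case True
  then show ?thesis
    using assms by (induction A rule: finite_induct) (auto simp: decays_zero decays_add)
qed (simp add: decays_zero)

text \<open>Telescoping: f g - s t f(-x) g(-x) = (f - s f(-x)) g + s f(-x) (g - t g(-x)). Each
  summand has one factor with the extra gain \<delta>, so parities multiply and the gain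
  survives.\<close>

lemma decays_mult:
  assumes "decays \<delta> s a f" "decays \<delta> t b g"
  shows "decays \<delta> (s * t) (a + b) (\<lambda>x. f x * g x)"
proof -
  have "little_o (a + \<delta> + b) (\<lambda>x. (f x - s * f (- x)) * g x)"
    using assms by (intro little_o_mult) (auto simp: decays_def)
  moreover have "little_o (a + (b + \<delta>)) (\<lambda>x. (s * f (- x)) * (g x - t * g (- x)))"
    using assms by (intro little_o_mult little_o_cmult little_o_reflect) (auto simp: decays_def)
  ultimately have "little_o (a + b + \<delta>) (\<lambda>x. (f x - s * f (- x)) * g x + (s * f (- x)) * (g x - t * g (- x)))"
    by (intro little_o_add) (simp_all add: add_ac)
  moreover have "(f x - s * f (- x)) * g x + (s * f (- x)) * (g x - t * g (- x))
      = f x * g x - s * t * (f (- x) * g (- x))" for x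
    by (simp add: algebra_simps)
  ultimately show ?thesis
    using little_o_mult[of a f b g] assms by (simp add: decays_def)
qed

lemma decays_mono:
  assumes "decays \<delta> s a f" "b \<le> a"
  shows "decays \<delta> s b f"
  using assms by (auto simp: decays_def intro: little_o_mono)

lemma decays_cong:
  assumes "decays \<delta> s a f" "\<And>x. norm x > 1 \<Longrightarrow> f x = h x"
  shows "decays \<delta> s a h"
  unfolding decays_def
proof
  show "little_o a h"
    using assms by (auto simp: decays_def intro: little_o_cong[of a f h])
  show "little_o (a + \<delta>) (\<lambda>x. h x - s * h (- x))"
  proof (rule little_o_cong)
    show "little_o (a + \<delta>) (\<lambda>x. f x - s * f (- x))"
      using assms(1) by (simp add: decays_def)
  qed (simp add: assms(2))
qed

text \<open>The constant is even, hence parity 1. For \<tau> \<ge> 0 the class is stable under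
  polynomials and locally Lipschitz functions, so it passes from the metric to its determinant,
  inverse and volume density.\<close>

definition asymp_const :: "real \<Rightarrow> real \<Rightarrow> real \<Rightarrow> ('a::real_normed_vector \<Rightarrow> real) \<Rightarrow> bool" where
  "asymp_const \<delta> \<tau> c u \<longleftrightarrow> decays \<delta> 1 \<tau> (\<lambda>x. u x - c)"

text \<open>In u f = (u - c) f + c f the first part decays at least as fast as f because \<tau>
  \<ge> 0; multiplication by u costs neither decay nor parity.\<close>

lemma decays_asymp_const_mult:
  assumes "asymp_const \<delta> \<tau> c u" "decays \<delta> s a f" "\<tau> \<ge> 0"
  shows "decays \<delta> s a (\<lambda>x. u x * f x)"
proof -
  have "decays \<delta> s a (\<lambda>x. (u x - c) * f x)"
    using decays_mono[OF decays_mult[OF assms(1)[unfolded asymp_const_def] assms(2)], of a] assms(3) by simp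
  from decays_add[OF this decays_cmult[OF assms(2), of c]] show ?thesis
    by (simp add: algebra_simps)
qed

lemma asymp_const_const: "asymp_const \<delta> \<tau> c (\<lambda>_. c)"
  by (simp add: asymp_const_def decays_zero)

lemma asymp_const_add:
  assumes "asymp_const \<delta> \<tau> c u" "asymp_const \<delta> \<tau> d v"
  shows "asymp_const \<delta> \<tau> (c + d) (\<lambda>x. u x + v x)"
  using decays_add[OF assms[unfolded asymp_const_def]] by (simp add: asymp_const_def algebra_simps)

lemma asymp_const_mult:
  assumes "asymp_const \<delta> \<tau> c u" "asymp_const \<delta> \<tau> d v" "\<tau> \<ge> 0"
  shows "asymp_const \<delta> \<tau> (c * d) (\<lambda>x. u x * v x)"
proof -
  have "decays \<delta> 1 \<tau> (\<lambda>x. u x * (v x - d))"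
    using assms by (intro decays_asymp_const_mult[OF assms(1)]) (auto simp: asymp_const_def)
  from decays_add[OF this decays_cmult[OF assms(1)[unfolded asymp_const_def], of d]] show ?thesis
    by (simp add: asymp_const_def algebra_simps)
qed

lemma asymp_const_sum:
  assumes "\<And>i. i \<in> A \<Longrightarrow> asymp_const \<delta> \<tau> (c i) (u i)"
  shows "asymp_const \<delta> \<tau> (\<Sum>i\<in>A. c i) (\<lambda>x. \<Sum>i\<in>A. u i x)"
proof (cases "finite A")
  case True
  then show ?thesis
    using assms by (induction A rule: finite_induct) (auto simp: asymp_const_const asymp_const_add)
qed (simp add: asymp_const_const)

lemma asymp_const_prod:
  assumes "\<And>i. i \<in> A \<Longrightarrow> asymp_const \<delta> \<tau> (c i) (u i)" "\<tau> \<ge> 0"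
  shows "asymp_const \<delta> \<tau> (\<Prod>i\<in>A. c i) (\<lambda>x. \<Prod>i\<in>A. u i x)"
proof (cases "finite A")
  case True
  then show ?thesis
    using assms by (induction A rule: finite_induct) (auto simp: asymp_const_const asymp_const_mult)
qed (simp add: asymp_const_const)

lemma asymp_const_det:
  fixes A :: "'a::real_normed_vector \<Rightarrow> real^'n::finite^'n"
  assumes "\<And>i j. asymp_const \<delta> \<tau> (C $ i $ j) (\<lambda>x. A x $ i $ j)" "\<tau> \<ge> 0"
  shows "asymp_const \<delta> \<tau> (det C) (\<lambda>x. det (A x))"
  unfolding det_def
  by (intro asymp_const_sum asymp_const_mult asymp_const_const asymp_const_prod assms)

lemma asymp_const_tendsto:
  assumes "asymp_const \<delta> \<tau> c u" "\<tau> \<ge> 0"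
  shows "(u \<longlongrightarrow> c) at_infinity"
proof -
  have "little_o 0 (\<lambda>x. u x - c)"
    using assms by (intro little_o_mono[of \<tau> _ 0]) (auto simp: asymp_const_def decays_def)
  then have "((\<lambda>x. u x - c) \<longlongrightarrow> 0) at_infinity"
    by (rule Lim_transform_eventually)
      (use eventually_norm_gt_at_infinity[of 0] in \<open>eventually_elim, simp\<close>)
  then show ?thesis
    by (simp add: LIM_zero_iff)
qed

text \<open>A Lipschitz bound near c controls \<phi>(u(x)) - \<phi>(c) by u(x) - c and equally
  \<phi>(u(x)) - \<phi>(u(-x)) by u(x) - u(-x), so size and parity are inherited at once.\<close>

lemma asymp_const_lipschitz:
  assumes u: "asymp_const \<delta> \<tau> c u" "\<tau> \<ge> 0" and d: "d > 0"
    and \<phi>: "\<And>v w. \<bar>v - c\<bar> < d \<Longrightarrow> \<bar>w - c\<bar> < d \<Longrightarrow> \<bar>\<phi> v - \<phi> w\<bar> \<le> L * \<bar>v - w\<bar>"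
  shows "asymp_const \<delta> \<tau> (\<phi> c) (\<lambda>x. \<phi> (u x))"
proof -
  have near: "\<forall>\<^sub>F x in at_infinity. \<bar>u x - c\<bar> < d"
    using tendstoD[OF asymp_const_tendsto[OF u] d] by (simp add: dist_real_def)
  have near': "\<forall>\<^sub>F x in at_infinity. \<bar>u (- x) - c\<bar> < d"
    using tendstoD[OF filterlim_compose[OF asymp_const_tendsto[OF u] filterlim_reflect_at_infinity] d]
    by (simp add: dist_real_def)
  have lo: "little_o \<tau> (\<lambda>x. u x - c)" "little_o (\<tau> + \<delta>) (\<lambda>x. u x - u (- x))"
    using u(1) by (auto simp: asymp_const_def decays_def)
  have "\<forall>\<^sub>F x in at_infinity. \<bar>\<phi> (u x) - \<phi> c\<bar> \<le> L * \<bar>u x - c\<bar>"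
    using near by eventually_elim (rule \<phi>, use d in auto)
  then have "little_o \<tau> (\<lambda>x. \<phi> (u x) - \<phi> c)"
    by (rule little_o_bounded[OF lo(1)])
  moreover have "\<forall>\<^sub>F x in at_infinity. \<bar>\<phi> (u x) - \<phi> (u (- x))\<bar> \<le> L * \<bar>u x - u (- x)\<bar>"
    using near near' by eventually_elim (rule \<phi>)
  then have "little_o (\<tau> + \<delta>) (\<lambda>x. \<phi> (u x) - \<phi> (u (- x)))"
    by (rule little_o_bounded[OF lo(2)])
  ultimately show ?thesis
    by (simp add: asymp_const_def decays_def)
qed

lemma asymp_const_inverse:
  assumes "asymp_const \<delta> \<tau> 1 u" "\<tau> \<ge> 0"
  shows "asymp_const \<delta> \<tau> 1 (\<lambda>x. inverse (u x))"
proof -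
  \<comment> \<open>Both arguments exceed 1/2, so v w \<ge> 1/4; hence the constant 4.\<close>
  have "\<bar>inverse v - inverse w\<bar> \<le> 4 * \<bar>v - w\<bar>" if "\<bar>v - 1\<bar> < 1/2" "\<bar>w - 1\<bar> < 1/2" for v w :: real
  proof -
    have vw: "v > 1/2" "w > 1/2"
      using that by (auto simp: abs_if split: if_splits)
    then have "1/2 * (1/2) \<le> v * w"
      by (intro mult_mono) auto
    then have "\<bar>v - w\<bar> * 1 \<le> \<bar>v - w\<bar> * (4 * (v * w))"
      by (intro mult_left_mono) auto
    moreover have "\<bar>inverse v - inverse w\<bar> = \<bar>v - w\<bar> / (v * w)"
      using vw by (simp add: field_simps abs_minus_commute abs_div_pos[symmetric])
    ultimately show ?thesis
      using vw by (simp add: field_simps)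
  qed
  from asymp_const_lipschitz[OF assms, of "1/2" inverse 4, OF _ this] show ?thesis
    by simp
qed

lemma asymp_const_sqrt:
  assumes "asymp_const \<delta> \<tau> 1 u" "\<tau> \<ge> 0"
  shows "asymp_const \<delta> \<tau> 1 (\<lambda>x. sqrt (u x))"
proof -
  \<comment> \<open>Both roots are at least 1/2, so their sum is at least 1; hence the constant
    1.\<close>
  have "\<bar>sqrt v - sqrt w\<bar> \<le> 1 * \<bar>v - w\<bar>" if "\<bar>v - 1\<bar> < 1/2" "\<bar>w - 1\<bar> < 1/2" for v w :: real
  proof -
    have vw: "v > 1/2" "w > 1/2"
      using that by (auto simp: abs_if split: if_splits)
    have "sqrt v \<ge> 1/2" "sqrt w \<ge> 1/2"
      by (rule real_le_rsqrt, use vw in \<open>simp add: power2_eq_square\<close>)+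
    then have "\<bar>sqrt v - sqrt w\<bar> * 1 \<le> \<bar>sqrt v - sqrt w\<bar> * (sqrt v + sqrt w)"
      by (intro mult_left_mono) auto
    also have "\<dots> = \<bar>(sqrt v - sqrt w) * (sqrt v + sqrt w)\<bar>"
      using vw by (simp add: abs_mult)
    also have "(sqrt v - sqrt w) * (sqrt v + sqrt w) = v - w"
      using vw by (simp add: algebra_simps)
    finally show ?thesis by simp
  qed
  from asymp_const_lipschitz[OF assms, of "1/2" sqrt 1, OF _ this] show ?thesis
    by simp
qed

section \<open>The error of the linearization\<close>

lemma invertible_posdef:
  fixes A :: "real^'n::finite^'n"
  assumes "\<And>v. v \<noteq> 0 \<Longrightarrow> v \<bullet> (A *v v) > 0"
  shows "invertible A"
proof -
  have "A *v v = 0 \<longrightarrow> v = 0" for v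
    by (metis assms inner_zero_right less_irrefl)
  then obtain B where "B ** A = mat 1"
    using matrix_left_invertible_ker[of A] by blast
  then show ?thesis
    unfolding invertible_def using matrix_left_right_inverse by blast
qed

lemma matrix_inv_inverse:
  fixes A :: "real^'n::finite^'n"
  assumes "invertible A"
  shows "A ** matrix_inv A = mat 1" "matrix_inv A ** A = mat 1"
  using someI_ex[OF assms[unfolded invertible_def]] by (simp_all add: matrix_inv_def)

text \<open>As quotients of determinants the entries of the inverse are rational in the entries of
  the matrix, which yields both their differentiability and their asymptotics.\<close>

lemma matrix_inv_component_cramer:
  fixes A :: "real^'n::finite^'n"
  assumes "invertible A"
  shows "matrix_inv A $ k $ l =
    det (\<chi> i j. if j = k then axis l 1 $ i else A $ i $ j) / det A"
proof -
  have "A *v (matrix_inv A *v axis l 1) = axis l 1"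
    using matrix_inv_inverse(1)[OF assms] by (simp add: matrix_vector_mul_assoc)
  then have "matrix_inv A *v axis l 1 = (\<chi> k. det (\<chi> i j. if j = k then axis l 1 $ i else A $ i $ j) / det A)"
    using cramer[of A "matrix_inv A *v axis l 1" "axis l 1"] assms invertible_det_nz[of A] by blast
  moreover have "(matrix_inv A *v axis l 1) $ k = matrix_inv A $ k $ l"
    by (simp add: matrix_vector_mult_basis column_def)
  ultimately show ?thesis by simp
qed

lemma matrix_inv_mat_1: "matrix_inv (mat 1 :: real^'n::finite^'n) = mat 1"
  by (metis matrix_inv_inverse(1) invertible_def matrix_mul_lid)

lemma differentiable_prod_real:
  fixes f :: "'i \<Rightarrow> 'a::real_normed_vector \<Rightarrow> real"
  assumes "\<And>i. i \<in> I \<Longrightarrow> f i differentiable (at x)"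
  shows "(\<lambda>x. \<Prod>i\<in>I. f i x) differentiable (at x)"
proof (cases "finite I")
  case True
  then show ?thesis
    using assms by (induction I rule: finite_induct) (auto intro: differentiable_mult)
qed simp

lemma differentiable_det:
  fixes A :: "'a::real_normed_vector \<Rightarrow> real^'n::finite^'n"
  assumes "\<And>i j. (\<lambda>x. A x $ i $ j) differentiable (at x)"
  shows "(\<lambda>x. det (A x)) differentiable (at x)"
  unfolding det_def
  by (intro differentiable_sum differentiable_mult differentiable_prod_real ballI assms finite_permutations) auto

lemma differentiable_cong_open:
  assumes "f differentiable (at x)" "open S" "x \<in> S" "\<And>y. y \<in> S \<Longrightarrow> f y = h y"
  shows "h differentiable (at x)"
proof -
  obtain D where "(f has_derivative D) (at x)"
    using assms(1) unfolding differentiable_def by blast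
  then have "(h has_derivative D) (at x)"
    by (rule has_derivative_transform_within_open[OF _ assms(2,3,4)])
  then show ?thesis
    unfolding differentiable_def by blast
qed

section \<open>The inverse metric and the curvature for |x| > 1\<close>

locale asymp_flat_metric = symmetric_C2_tensor g for g :: "real^'n::finite \<Rightarrow> real^'n^'n" +
  assumes posdef: "\<And>x v. norm x > 1 \<Longrightarrow> v \<noteq> 0 \<Longrightarrow> v \<bullet> (g x *v v) > 0"
begin

lemma invertible_g: "norm x > 1 \<Longrightarrow> invertible (g x)"
  by (rule invertible_posdef) (rule posdef)

lemma g_ginv: "norm x > 1 \<Longrightarrow> (\<Sum>a\<in>UNIV. gc g k a x * ginv g x $ a $ l) = (if k = l then 1 else 0)"
  using matrix_inv_inverse(1)[OF invertible_g, of x]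
  by (simp add: vec_eq_iff matrix_matrix_mult_def mat_def gc_def ginv_def)

lemma ginv_g: "norm x > 1 \<Longrightarrow> (\<Sum>a\<in>UNIV. ginv g x $ k $ a * gc g a l x) = (if k = l then 1 else 0)"
  using matrix_inv_inverse(2)[OF invertible_g, of x]
  by (simp add: vec_eq_iff matrix_matrix_mult_def mat_def gc_def ginv_def)

lemma ginv_cramer:
  assumes "norm x > 1"
  shows "ginv g x $ k $ l =
    det (\<chi> i j. if j = k then axis l 1 $ i else gc g i j x) * inverse (det (\<chi> i j. gc g i j x))"
  using matrix_inv_component_cramer[OF invertible_g[OF assms], of k l]
  by (simp add: ginv_def gc_def divide_inverse cong del: if_weak_cong)

lemma ginv_differentiable:
  assumes "norm x > 1"
  shows "(\<lambda>x. ginv g x $ k $ l) differentiable (at x)"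
proof (rule differentiable_cong_open[OF _ open_norm_gt])
  have "(\<lambda>x. (\<chi> i j. if j = k then axis l 1 $ i else gc g i j x) $ i $ j) differentiable (at x)" for i j
    using gc_differentiable[OF assms] by (cases "j = k") auto
  moreover have "det (\<chi> i j. gc g i j x) \<noteq> 0"
    using invertible_g[OF assms] by (simp add: invertible_det_nz gc_def)
  ultimately show "(\<lambda>x. det (\<chi> i j. if j = k then axis l 1 $ i else gc g i j x) * inverse (det (\<chi> i j. gc g i j x)))
    differentiable (at x)"
    by (intro differentiable_mult differentiable_inverse differentiable_det)
      (auto simp: gc_differentiable[OF assms])
qed (use assms in \<open>auto simp: ginv_cramer\<close>)

lemma continuous_on_ginv: "continuous_on {x. norm x > 1} (\<lambda>x. ginv g x $ k $ l)"
  by (intro continuous_at_imp_continuous_on ballI differentiable_imp_continuous_within ginv_differentiable) simp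

text \<open>Differentiate g^(-1) g = 1, which holds in a neighbourhood of x, and multiply by g^(-1)
  from the right.\<close>

lemma pd_ginv:
  assumes "norm x > 1"
  shows "pd m (\<lambda>x. ginv g x $ k $ l) x =
    - (\<Sum>b\<in>UNIV. \<Sum>a\<in>UNIV. ginv g x $ k $ a * dg a b m x * ginv g x $ b $ l)"
proof -
  have "(\<Sum>a\<in>UNIV. pd m (\<lambda>x. ginv g x $ k $ a) x * gc g a b x) = - (\<Sum>a\<in>UNIV. ginv g x $ k $ a * dg a b m x)" for b
  proof -
    have "0 = pd m (\<lambda>x. \<Sum>a\<in>UNIV. ginv g x $ k $ a * gc g a b x) x"
      using assms by (subst pd_cong_open[OF open_norm_gt[of 1], where g = "\<lambda>_. if k = b then 1 else 0"]) (auto simp: ginv_g)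
    also have "\<dots> = (\<Sum>a\<in>UNIV. pd m (\<lambda>x. ginv g x $ k $ a) x * gc g a b x) + (\<Sum>a\<in>UNIV. ginv g x $ k $ a * dg a b m x)"
      by (simp add: pd_sum pd_mult differentiable_mult ginv_differentiable[OF assms] gc_differentiable[OF assms] sum.distrib)
    finally show ?thesis by simp
  qed
  then have "(\<Sum>b\<in>UNIV. (\<Sum>a\<in>UNIV. pd m (\<lambda>x. ginv g x $ k $ a) x * gc g a b x) * ginv g x $ b $ l)
    = - (\<Sum>b\<in>UNIV. \<Sum>a\<in>UNIV. ginv g x $ k $ a * dg a b m x * ginv g x $ b $ l)"
    by (simp add: sum_negf sum_distrib_right)
  moreover have "(\<Sum>b\<in>UNIV. (\<Sum>a\<in>UNIV. pd m (\<lambda>x. ginv g x $ k $ a) x * gc g a b x) * ginv g x $ b $ l)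
    = (\<Sum>a\<in>UNIV. pd m (\<lambda>x. ginv g x $ k $ a) x * (\<Sum>b\<in>UNIV. gc g a b x * ginv g x $ b $ l))"
    unfolding sum_distrib_right sum_distrib_left by (subst sum.swap) (simp add: mult.assoc)
  moreover have "\<dots> = pd m (\<lambda>x. ginv g x $ k $ l) x"
    by (simp add: g_ginv[OF assms] if_distrib[of "\<lambda>c. _ * c"] cong: if_cong)
  ultimately show ?thesis by simp
qed

abbreviation Chr_low :: "'n \<Rightarrow> 'n \<Rightarrow> 'n \<Rightarrow> real^'n \<Rightarrow> real" where
  "Chr_low l i j x \<equiv> dg l i j x + dg l j i x - dg i j l x"

lemma Chr_alt: "Chr g k i j = (\<lambda>x. 1/2 * (\<Sum>l\<in>UNIV. ginv g x $ k $ l * Chr_low l i j x))"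
  by (simp add: Chr_def fun_eq_iff)

lemma Chr_differentiable: "norm x > 1 \<Longrightarrow> Chr g k i j differentiable (at x)"
  unfolding Chr_alt
  by (intro differentiable_mult differentiable_const differentiable_sum differentiable_add differentiable_diff
      ballI ginv_differentiable dg_differentiable) auto

lemma continuous_on_Chr: "continuous_on {x. norm x > 1} (Chr g k i j)"
  by (intro continuous_at_imp_continuous_on ballI differentiable_imp_continuous_within Chr_differentiable) simp

text \<open>Separates the part quadratic in first derivatives from the part linear in second
  derivatives; putting the identity for g^(-1) in the latter gives \<open>dChr_lin\<close>.\<close>

lemma pd_Chr:
  assumes "norm x > 1"
  shows "pd m (Chr g k i j) x = (\<Sum>l\<in>UNIV. 1/2 * (pd m (\<lambda>x. ginv g x $ k $ l) x * Chr_low l i j x)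
    + ginv g x $ k $ l * dChr_lin l i j m x)"
proof -
  have *: "pd m (Chr_low l i j) x = 2 * dChr_lin l i j m x" for l
    by (simp add: pd_diff pd_add differentiable_add dg_differentiable[OF assms] dChr_lin_def)
  have d: "Chr_low l i j differentiable (at x)" for l
    by (intro differentiable_add differentiable_diff dg_differentiable assms)
  have "pd m (Chr g k i j) x = 1/2 * (\<Sum>l\<in>UNIV. pd m (\<lambda>x. ginv g x $ k $ l * Chr_low l i j x) x)"
    unfolding Chr_alt
    by (subst pd_cmult, (intro differentiable_sum differentiable_mult d ginv_differentiable assms ballI finite)[1],
        subst pd_sum, (intro differentiable_mult d ginv_differentiable assms)[1], rule refl)
  also have "(\<Sum>l\<in>UNIV. pd m (\<lambda>x. ginv g x $ k $ l * Chr_low l i j x) x)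
    = (\<Sum>l\<in>UNIV. pd m (\<lambda>x. ginv g x $ k $ l) x * Chr_low l i j x + ginv g x $ k $ l * (2 * dChr_lin l i j m x))"
    by (intro sum.cong refl) (simp only: pd_mult[OF ginv_differentiable[OF assms] d] *)
  finally show ?thesis
    by (simp add: sum_distrib_left distrib_left)
qed

lemma continuous_on_dChr_lin: "continuous_on {x. norm x > 1} (dChr_lin k i j m)"
  unfolding dChr_lin_def[abs_def] by (intro continuous_intros continuous_on_ddg) auto

text \<open>Inserting \<open>pd_ginv\<close> leaves only g^(-1) and first and second derivatives of
  g, all continuous.\<close>

lemma continuous_on_pd_Chr: "continuous_on {x. norm x > 1} (pd m (Chr g k i j))"
proof (rule continuous_on_eq)
  show "continuous_on {x. norm x > 1} (\<lambda>x. \<Sum>l\<in>UNIV.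
    1/2 * (- (\<Sum>b\<in>UNIV. \<Sum>a\<in>UNIV. ginv g x $ k $ a * dg a b m x * ginv g x $ b $ l) * Chr_low l i j x)
    + ginv g x $ k $ l * dChr_lin l i j m x)"
    by (intro continuous_intros continuous_on_dg continuous_on_dChr_lin continuous_on_ginv)
qed (simp add: pd_Chr pd_ginv)

lemma continuous_on_Ric: "continuous_on {x. norm x > 1} (Ric g i j)"
  unfolding Ric_def[abs_def] by (intro continuous_intros continuous_on_Chr continuous_on_pd_Chr)

lemma continuous_on_Scal: "continuous_on {x. norm x > 1} (Scal g)"
  unfolding Scal_def[abs_def] by (intro continuous_intros continuous_on_Ric continuous_on_ginv)

lemma continuous_on_Ein: "continuous_on {x. norm x > 1} (Ein g i j)"
proof -
  have "Ein g i j = (\<lambda>x. Ric g i j x - 1/2 * Scal g x * gc g i j x)"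
    by (simp add: Ein_def gc_def fun_eq_iff)
  then show ?thesis
    by (simp only:) (intro continuous_intros continuous_on_Ric continuous_on_Scal continuous_on_gc)
qed

definition flux :: "'n \<Rightarrow> 'n \<Rightarrow> real^'n \<Rightarrow> real" where
  "flux i k x = (\<Sum>j\<in>UNIV. sqrt (det (g x)) * ginv g x $ j $ k * Ein g i j x)"

lemma continuous_on_det_g: "continuous_on {x. norm x > 1} (\<lambda>x. det (g x))"
  using differentiable_det[of g] gc_differentiable
  by (intro continuous_at_imp_continuous_on ballI differentiable_imp_continuous_within) (simp add: gc_def)

lemma continuous_on_flux: "continuous_on {x. norm x > 1} (flux i k)"
  unfolding flux_def[abs_def]
  by (intro continuous_intros continuous_on_Ein continuous_on_ginv continuous_on_det_g)

text \<open>For w = g^(-1) \<nu> the value is w \<bullet> \<nu> = w \<bullet> g w, positive since w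
  is nonzero. This allows the conormal length to be cancelled.\<close>

lemma conorm2_pos:
  assumes "norm x > 1"
  shows "conorm2 g x > 0"
proof -
  define w where "w = ginv g x *v nu_e x"
  have gw: "g x *v w = nu_e x"
    using matrix_inv_inverse(1)[OF invertible_g[OF assms]] by (simp add: w_def ginv_def matrix_vector_mul_assoc)
  have "nu_e x \<noteq> 0"
    using assms by (auto simp: nu_e_def)
  then have "w \<noteq> 0"
    using gw by auto
  then have "0 < w \<bullet> nu_e x"
    using posdef[OF assms, of w] gw by simp
  also have "\<dots> = conorm2 g x"
    by (simp add: w_def conorm2_def inner_vec_def matrix_vector_mult_def sum_distrib_left mult_ac)
  finally show ?thesis .
qed

text \<open>The root of \<open>conorm2\<close> in the denominator of \<open>nu_g\<close> cancels
  against the same factor in \<open>area_g\<close>, leaving \<open>flux\<close> against the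
  Euclidean normal.\<close>

lemma surface_integrand_eq:
  assumes "norm x > 1"
  shows "(\<Sum>i\<in>UNIV. \<Sum>j\<in>UNIV. Ein g i j x * V i * nu_g g x $ j) * area_g g x
    = (\<Sum>i\<in>UNIV. \<Sum>k\<in>UNIV. flux i k x * V i * nu_e x $ k)"
proof -
  have "nu_g g x $ j * area_g g x = (\<Sum>k\<in>UNIV. sqrt (det (g x)) * ginv g x $ j $ k * nu_e x $ k)" for j
  proof -
    have "sqrt (conorm2 g x) \<noteq> 0"
      using conorm2_pos[OF assms] by simp
    then have "nu_g g x $ j * area_g g x = (\<Sum>k\<in>UNIV. ginv g x $ j $ k * nu_e x $ k) * sqrt (det (g x))"
      by (simp add: nu_g_def area_g_def)
    then show ?thesis
      by (simp add: sum_distrib_left mult_ac)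
  qed
  then have "(\<Sum>i\<in>UNIV. \<Sum>j\<in>UNIV. Ein g i j x * V i * nu_g g x $ j) * area_g g x
    = (\<Sum>i\<in>UNIV. \<Sum>j\<in>UNIV. Ein g i j x * V i * (\<Sum>k\<in>UNIV. sqrt (det (g x)) * ginv g x $ j $ k * nu_e x $ k))"
    by (simp add: sum_distrib_right mult.assoc)
  also have "\<dots> = (\<Sum>i\<in>UNIV. \<Sum>k\<in>UNIV. flux i k x * V i * nu_e x $ k)"
  proof (rule sum.cong[OF refl])
    fix i
    have "(\<Sum>j\<in>UNIV. Ein g i j x * V i * (\<Sum>k\<in>UNIV. sqrt (det (g x)) * ginv g x $ j $ k * nu_e x $ k))
      = (\<Sum>j\<in>UNIV. \<Sum>k\<in>UNIV. sqrt (det (g x)) * ginv g x $ j $ k * Ein g i j x * V i * nu_e x $ k)"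
      by (simp add: sum_distrib_left mult_ac)
    also have "\<dots> = (\<Sum>k\<in>UNIV. flux i k x * V i * nu_e x $ k)"
      by (subst sum.swap) (simp add: flux_def sum_distrib_right)
    finally show "(\<Sum>j\<in>UNIV. Ein g i j x * V i * (\<Sum>k\<in>UNIV. sqrt (det (g x)) * ginv g x $ j $ k * nu_e x $ k))
      = (\<Sum>k\<in>UNIV. flux i k x * V i * nu_e x $ k)" .
  qed
  finally show ?thesis .
qed

end

section \<open>Size and parity of the linearization error\<close>

locale asymp_flat_metric_decay = asymp_flat_metric g for g :: "real^'n::finite \<Rightarrow> real^'n^'n" +
  fixes \<delta> \<tau> :: real
  assumes tau: "\<tau> \<ge> 0"
    and decays_gc: "\<And>i j. asymp_const \<delta> \<tau> (if i = j then 1 else 0) (gc g i j)"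
    and decays_dg: "\<And>i j k. decays \<delta> (- 1) (\<tau> + 1) (dg i j k)"
    and decays_ddg: "\<And>i j k l. decays \<delta> 1 (\<tau> + 2) (ddg i j k l)"
begin

lemma asymp_const_det_g: "asymp_const \<delta> \<tau> 1 (\<lambda>x. det (g x))"
proof -
  have "asymp_const \<delta> \<tau> ((mat 1 :: real^'n^'n) $ i $ j) (\<lambda>x. g x $ i $ j)" for i j
    using decays_gc[of i j] by (simp add: mat_def gc_def)
  then have "asymp_const \<delta> \<tau> (det (mat 1 :: real^'n^'n)) (\<lambda>x. det (g x))"
    using tau by (rule asymp_const_det)
  then show ?thesis
    by simp
qed

text \<open>Both determinants in Cramer's rule are asymptotically constant; the limit
  \<open>det ?C\<close> is read off from the same rule for the identity matrix.\<close>

lemma asymp_const_ginv: "asymp_const \<delta> \<tau> (if k = l then 1 else 0) (\<lambda>x. ginv g x $ k $ l)"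
proof -
  let ?C = "\<chi> i j. if j = k then axis l 1 $ i else (mat 1 :: real^'n^'n) $ i $ j"
  let ?A = "\<lambda>x. \<chi> i j. if j = k then axis l 1 $ i else gc g i j x"
  have "asymp_const \<delta> \<tau> (?C $ i $ j) (\<lambda>x. ?A x $ i $ j)" for i j
    using decays_gc[of i j] by (cases "j = k") (auto simp: asymp_const_const mat_def)
  then have "asymp_const \<delta> \<tau> (det ?C) (\<lambda>x. det (?A x))"
    using tau by (rule asymp_const_det)
  moreover have "det ?C = (if k = l then 1 else 0)"
  proof -
    have "invertible (mat 1 :: real^'n^'n)"
      unfolding invertible_def by (intro exI[of _ "mat 1"]) simp
    from matrix_inv_component_cramer[OF this, of k l] have "det ?C = (mat 1 :: real^'n^'n) $ k $ l"
      by (simp only: matrix_inv_mat_1 det_I div_by_1)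
    also have "\<dots> = (if k = l then 1 else 0)"
      by (simp add: mat_def)
    finally show ?thesis .
  qed
  ultimately have "asymp_const \<delta> \<tau> ((if k = l then 1 else 0) * 1) (\<lambda>x. det (?A x) * inverse (det (g x)))"
    by (intro asymp_const_mult asymp_const_inverse asymp_const_det_g tau) simp
  moreover have "g x = (\<chi> i j. gc g i j x)" for x
    by (simp add: gc_def vec_eq_iff)
  ultimately show ?thesis
    unfolding asymp_const_def
    by (intro decays_cong[where h = "\<lambda>x. ginv g x $ k $ l - (if k = l then 1 else 0)"]) (auto simp: ginv_cramer)
qed

lemma decays_ginv_mult: "decays \<delta> s a f \<Longrightarrow> decays \<delta> s a (\<lambda>x. ginv g x $ k $ l * f x)"
  by (rule decays_asymp_const_mult[OF asymp_const_ginv _ tau])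

lemma decays_pd_ginv: "decays \<delta> (- 1) (\<tau> + 1) (pd m (\<lambda>x. ginv g x $ k $ l))"
proof (rule decays_cong)
  have "decays \<delta> (- 1) (\<tau> + 1) (\<lambda>x. \<Sum>b\<in>UNIV. \<Sum>a\<in>UNIV. ginv g x $ k $ a * (ginv g x $ b $ l * dg a b m x))"
    by (intro decays_sum decays_ginv_mult decays_dg)
  from decays_cmult[OF this, of "- 1"]
  show "decays \<delta> (- 1) (\<tau> + 1) (\<lambda>x. - 1 * (\<Sum>b\<in>UNIV. \<Sum>a\<in>UNIV. ginv g x $ k $ a * (ginv g x $ b $ l * dg a b m x)))" .
qed (simp add: pd_ginv mult_ac)

lemma decays_Chr_low: "decays \<delta> (- 1) (\<tau> + 1) (Chr_low l i j)"
  by (intro decays_add decays_diff decays_dg)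

lemma decays_Chr: "decays \<delta> (- 1) (\<tau> + 1) (Chr g k i j)"
  unfolding Chr_alt by (intro decays_cmult decays_sum decays_ginv_mult decays_Chr_low)

lemma decays_dChr_lin: "decays \<delta> 1 (\<tau> + 2) (dChr_lin k i j m)"
proof -
  have "decays \<delta> 1 (\<tau> + 2) (\<lambda>x. 1/2 * (ddg k i j m x + ddg k j i m x - ddg i j k m x))"
    by (intro decays_cmult decays_add decays_diff decays_ddg)
  then show ?thesis
    by (simp add: dChr_lin_def[abs_def])
qed

text \<open>The error consists of products: derivatives of g^(-1) times first derivatives of g, two
  odd factors of order \<tau> + 1, and g^(-1) - 1 times second derivatives, two even factors of
  orders \<tau> and \<tau> + 2. Either way the order is 2\<tau> + 2 and the parity even.\<close>

lemma decays_pd_Chr: "decays \<delta> 1 (2 * \<tau> + 2) (\<lambda>x. pd m (Chr g k i j) x - dChr_lin k i j m x)"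
proof (rule decays_cong)
  have "decays \<delta> (- 1 * - 1) (\<tau> + 1 + (\<tau> + 1)) (\<lambda>x. pd m (\<lambda>x. ginv g x $ k $ l) x * Chr_low l i j x)" for l
    by (rule decays_mult[OF decays_pd_ginv decays_Chr_low])
  then have 1: "decays \<delta> 1 (2 * \<tau> + 2) (\<lambda>x. pd m (\<lambda>x. ginv g x $ k $ l) x * Chr_low l i j x)" for l
    by (simp add: algebra_simps)
  have "decays \<delta> (1 * 1) (\<tau> + (\<tau> + 2)) (\<lambda>x. (ginv g x $ k $ l - (if k = l then 1 else 0)) * dChr_lin l i j m x)" for l
    by (rule decays_mult[OF asymp_const_ginv[unfolded asymp_const_def] decays_dChr_lin])
  then have 2: "decays \<delta> 1 (2 * \<tau> + 2) (\<lambda>x. (ginv g x $ k $ l - (if k = l then 1 else 0)) * dChr_lin l i j m x)" for l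
    by (simp add: algebra_simps)
  show "decays \<delta> 1 (2 * \<tau> + 2) (\<lambda>x. \<Sum>l\<in>UNIV. 1/2 * (pd m (\<lambda>x. ginv g x $ k $ l) x * Chr_low l i j x)
    + (ginv g x $ k $ l - (if k = l then 1 else 0)) * dChr_lin l i j m x)"
    by (intro decays_sum decays_add decays_cmult 1 2)
  fix x :: "real^'n"
  assume x: "norm x > 1"
  have "(\<Sum>l\<in>UNIV. (if k = l then 1 else 0) * dChr_lin l i j m x) = dChr_lin k i j m x"
    by (simp add: if_distrib[of "\<lambda>c. c * _"] cong: if_cong)
  then show "(\<Sum>l\<in>UNIV. 1/2 * (pd m (\<lambda>x. ginv g x $ k $ l) x * Chr_low l i j x)
    + (ginv g x $ k $ l - (if k = l then 1 else 0)) * dChr_lin l i j m x) = pd m (Chr g k i j) x - dChr_lin k i j m x"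
    unfolding pd_Chr[OF x] by (simp only: sum.distrib sum_subtractf left_diff_distrib)
qed

text \<open>Products of two Christoffel symbols belong wholly to the error: two odd factors of order
  \<tau> + 1.\<close>

lemma decays_Ric_error: "decays \<delta> 1 (2 * \<tau> + 2) (\<lambda>x. Ric g i j x - Ric_lin i j x)"
proof -
  have "decays \<delta> (- 1 * - 1) (\<tau> + 1 + (\<tau> + 1)) (\<lambda>x. Chr g a b c x * Chr g d e f x)" for a b c d e f
    by (rule decays_mult[OF decays_Chr decays_Chr])
  then have 1: "decays \<delta> 1 (2 * \<tau> + 2) (\<lambda>x. Chr g a b c x * Chr g d e f x)" for a b c d e f
    by (simp add: algebra_simps)
  have "decays \<delta> 1 (2 * \<tau> + 2) (\<lambda>x.
      (\<Sum>k\<in>UNIV. (pd k (Chr g k i j) x - dChr_lin k i j k x) - (pd j (Chr g k i k) x - dChr_lin k i k j x))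
     + (\<Sum>k\<in>UNIV. \<Sum>l\<in>UNIV. Chr g k k l x * Chr g l i j x - Chr g k j l x * Chr g l i k x))"
    by (intro decays_add decays_sum decays_diff decays_pd_Chr 1)
  then show ?thesis
    by (simp add: Ric_def Ric_lin_def sum_subtractf sum.distrib algebra_simps)
qed

lemma decays_Ric_lin: "decays \<delta> 1 (\<tau> + 2) (Ric_lin i j)"
  unfolding Ric_lin_def[abs_def] by (intro decays_sum decays_diff decays_dChr_lin)

lemma decays_Ric: "decays \<delta> 1 (\<tau> + 2) (Ric g i j)"
  using decays_add[OF decays_mono[OF decays_Ric_error[of i j]] decays_Ric_lin[of i j]] tau by simp

text \<open>Passing from the trace with g^(-1) to the Euclidean trace gains a factor of order
  \<tau>, on top of the order \<tau> + 2 of the Ricci tensor.\<close>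

lemma decays_Scal_error: "decays \<delta> 1 (2 * \<tau> + 2) (\<lambda>x. Scal g x - Scal_lin x)"
proof -
  have "decays \<delta> (1 * 1) (\<tau> + (\<tau> + 2)) (\<lambda>x. (ginv g x $ i $ j - (if i = j then 1 else 0)) * Ric g i j x)" for i j
    by (rule decays_mult[OF asymp_const_ginv[unfolded asymp_const_def] decays_Ric])
  then have 1: "decays \<delta> 1 (2 * \<tau> + 2) (\<lambda>x. (ginv g x $ i $ j - (if i = j then 1 else 0)) * Ric g i j x)" for i j
    by (simp add: algebra_simps)
  have "decays \<delta> 1 (2 * \<tau> + 2) (\<lambda>x.
    (\<Sum>i\<in>UNIV. \<Sum>j\<in>UNIV. (ginv g x $ i $ j - (if i = j then 1 else 0)) * Ric g i j x)
    + (\<Sum>i\<in>UNIV. Ric g i i x - Ric_lin i i x))"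
    by (intro decays_add decays_sum 1 decays_Ric_error)
  moreover have "(\<Sum>i\<in>UNIV. \<Sum>j\<in>UNIV. (ginv g x $ i $ j - (if i = j then 1 else 0)) * Ric g i j x)
    + (\<Sum>i\<in>UNIV. Ric g i i x - Ric_lin i i x) = Scal g x - Scal_lin x" for x
  proof -
    have "(\<Sum>i\<in>UNIV. \<Sum>j\<in>UNIV. (if i = j then 1 else 0) * Ric g i j x) = (\<Sum>i\<in>UNIV. Ric g i i x)"
      by (simp add: if_distrib[of "\<lambda>c. c * _"] cong: if_cong)
    then show ?thesis
      unfolding Scal_def Scal_lin_def by (simp only: sum_subtractf left_diff_distrib)
  qed
  ultimately show ?thesis by simp
qed

lemma decays_Scal: "decays \<delta> 1 (\<tau> + 2) (Scal g)"
  unfolding Scal_def[abs_def] by (intro decays_sum decays_ginv_mult decays_Ric)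

lemma decays_Ein_error: "decays \<delta> 1 (2 * \<tau> + 2) (\<lambda>x. Ein g i j x - Ein_lin i j x)"
proof -
  have "decays \<delta> (1 * 1) (\<tau> + (\<tau> + 2)) (\<lambda>x. (gc g i j x - (if i = j then 1 else 0)) * Scal g x)"
    by (rule decays_mult[OF decays_gc[unfolded asymp_const_def] decays_Scal])
  then have 1: "decays \<delta> 1 (2 * \<tau> + 2) (\<lambda>x. (gc g i j x - (if i = j then 1 else 0)) * Scal g x)"
    by (simp add: algebra_simps)
  have "decays \<delta> 1 (2 * \<tau> + 2) (\<lambda>x. (Ric g i j x - Ric_lin i j x)
    - 1/2 * ((gc g i j x - (if i = j then 1 else 0)) * Scal g x + (if i = j then 1 else 0) * (Scal g x - Scal_lin x)))"
    by (intro decays_diff decays_add decays_cmult 1 decays_Scal_error decays_Ric_error)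
  moreover have "(Ric g i j x - Ric_lin i j x)
    - 1/2 * ((gc g i j x - (if i = j then 1 else 0)) * Scal g x + (if i = j then 1 else 0) * (Scal g x - Scal_lin x))
    = Ein g i j x - Ein_lin i j x" for x
    by (simp add: Ein_def Ein_lin_def gc_def field_simps)
  ultimately show ?thesis by simp
qed

lemma decays_Ein: "decays \<delta> 1 (\<tau> + 2) (Ein g i j)"
proof -
  have "decays \<delta> 1 (\<tau> + 2) (\<lambda>x. Ric g i j x - 1/2 * (gc g i j x * Scal g x))"
    by (intro decays_diff decays_cmult decays_Ric decays_asymp_const_mult[OF decays_gc] decays_Scal tau)
  then show ?thesis
    by (simp add: Ein_def[abs_def] gc_def mult_ac)
qed

text \<open>The weight sqrt(det g) g^(jk) differs from the identity by order \<tau>; times the full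
  Einstein tensor, of order \<tau> + 2, this is of the same order as
  \<open>decays_Ein_error\<close>.\<close>

lemma decays_flux_error: "decays \<delta> 1 (2 * \<tau> + 2) (\<lambda>x. flux i k x - Ein_lin i k x)"
proof -
  have "asymp_const \<delta> \<tau> (1 * (if j = k then 1 else 0)) (\<lambda>x. sqrt (det (g x)) * ginv g x $ j $ k)" for j
    by (intro asymp_const_mult asymp_const_sqrt asymp_const_det_g asymp_const_ginv tau)
  from decays_mult[OF this[unfolded asymp_const_def] decays_Ein[of i]]
  have 1: "decays \<delta> 1 (2 * \<tau> + 2) (\<lambda>x. (sqrt (det (g x)) * ginv g x $ j $ k - (if j = k then 1 else 0)) * Ein g i j x)" for j
    by (simp add: algebra_simps)
  have "decays \<delta> 1 (2 * \<tau> + 2) (\<lambda>x.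
    (\<Sum>j\<in>UNIV. (sqrt (det (g x)) * ginv g x $ j $ k - (if j = k then 1 else 0)) * Ein g i j x)
    + (Ein g i k x - Ein_lin i k x))"
    by (intro decays_add decays_sum 1 decays_Ein_error)
  moreover have "(\<Sum>j\<in>UNIV. (sqrt (det (g x)) * ginv g x $ j $ k - (if j = k then 1 else 0)) * Ein g i j x)
    + (Ein g i k x - Ein_lin i k x) = flux i k x - Ein_lin i k x" for x
  proof -
    have "(\<Sum>j\<in>UNIV. (if j = k then 1 else 0) * Ein g i j x) = Ein g i k x"
      by (simp add: if_distrib[of "\<lambda>c. c * _"] cong: if_cong)
    then show ?thesis
      unfolding flux_def by (simp only: sum_subtractf left_diff_distrib)
  qed
  ultimately show ?thesis by simp
qed

end

section \<open>Surface integrals of the error\<close>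

lemma sphere_int_tendsto_0:
  fixes f :: "real^'n::finite \<Rightarrow> real"
  assumes f: "continuous_on {x. norm x > 1} f" and lo: "little_o (real (CARD('n) - 1)) f"
  shows "((\<lambda>r. sphere_int r f) \<longlongrightarrow> 0) at_top"
proof (rule tendstoI)
  fix e :: real
  assume e: "e > 0"
  \<comment> \<open>The added 1 keeps the denominator positive, which makes d positive and d |omega|
    < e at once.\<close>
  define d where "d = e / (\<bar>omega TYPE('n)\<bar> + 1)"
  have d: "d > 0" "d * \<bar>omega TYPE('n)\<bar> < e"
    using e by (auto simp: d_def field_simps)
  obtain R where R: "\<And>x::real^'n. R \<le> norm x \<Longrightarrow> \<bar>norm x powr real (CARD('n) - 1) * f x\<bar> < d"
    using tendstoD[OF lo d(1)] unfolding eventually_at_infinity by auto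
  have "dist (sphere_int r f) 0 < e" if r: "r > max R 1" for r
  proof -
    have pos: "r ^ (CARD('n) - 1) > 0"
      using r by simp
    have "\<bar>sphere_int r f\<bar> \<le> sphere_int r (\<lambda>_::real^'n. d / r ^ (CARD('n) - 1))"
    proof (rule sphere_int_bound)
      show "continuous_on (sphere 0 r) f"
        by (rule continuous_on_subset[OF f]) (use r in auto)
      fix x :: "real^'n"
      assume x: "norm x = r"
      have "r powr real (CARD('n) - 1) = r ^ (CARD('n) - 1)"
        using r by (intro powr_realpow) simp
      from R[of x, unfolded x this] have "\<bar>r ^ (CARD('n) - 1) * f x\<bar> < d"
        using r by linarith
      then show "\<bar>f x\<bar> \<le> d / r ^ (CARD('n) - 1)"
        using pos by (simp add: abs_mult field_simps)
    qed (use r in simp)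
    also have "\<dots> = d * omega TYPE('n)"
      using r by (simp add: sphere_int_const)
    also have "\<dots> < e"
      using d by (smt (verit, best) mult_left_mono)
    finally show ?thesis
      by simp
  qed
  then show "\<forall>\<^sub>F r in at_top. dist (sphere_int r f) 0 < e"
    using eventually_gt_at_top[of "max R 1"] by (rule eventually_mono[rotated])
qed

text \<open>By invariance under x \<mapsto> -x the integral is half that of f(x) + f(-x), so it
  suffices that this sum decays.\<close>

lemma sphere_int_tendsto_0_even:
  fixes f :: "real^'n::finite \<Rightarrow> real"
  assumes f: "continuous_on {x. norm x > 1} f"
    and lo: "little_o (real (CARD('n) - 1)) (\<lambda>x. f x + f (- x))"
  shows "((\<lambda>r. sphere_int r f) \<longlongrightarrow> 0) at_top"
proof -
  have fm: "continuous_on {x. norm x > 1} (\<lambda>x. f (- x))"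
    by (rule continuous_on_compose2[OF f]) (auto intro: continuous_intros)
  have lim: "((\<lambda>r. 1/2 * sphere_int r (\<lambda>x. f x + f (- x))) \<longlongrightarrow> 1/2 * 0) at_top"
    by (intro tendsto_mult_left sphere_int_tendsto_0 lo continuous_on_add f fm)
  have ev: "\<forall>\<^sub>F r in at_top. 1/2 * sphere_int r (\<lambda>x. f x + f (- x)) = sphere_int r f"
    using eventually_gt_at_top[of 1]
  proof eventually_elim
    case (elim r)
    have sub: "sphere (0::real^'n) r \<subseteq> {x. norm x > 1}"
      using elim by auto
    have c: "continuous_on (sphere 0 r) f" "continuous_on (sphere 0 r) (\<lambda>x. f (- x))"
      using continuous_on_subset[OF f sub] continuous_on_subset[OF fm sub] by auto
    then show ?case
      using elim by (simp add: sphere_int_add sphere_int_reflect)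
  qed
  from Lim_transform_eventually[OF lim ev] show ?thesis
    by simp
qed

text \<open>The weight w will be a component of the vector field times one of the normal, with p = 1
  for X and p = 2 for Y.\<close>

lemma little_o_mult_bounded:
  assumes "little_o a f" "\<And>x. norm x > 1 \<Longrightarrow> \<bar>w x\<bar> \<le> C * norm x powr p"
  shows "little_o (a - p) (\<lambda>x. f x * w x)"
proof (rule Lim_null_comparison)
  show "((\<lambda>x. C * \<bar>norm x powr a * f x\<bar>) \<longlongrightarrow> 0) at_infinity"
    using tendsto_mult_left[OF tendsto_rabs_zero[OF assms(1)], of C] by simp
  show "\<forall>\<^sub>F x in at_infinity. norm (norm x powr (a - p) * (f x * w x)) \<le> C * \<bar>norm x powr a * f x\<bar>"
    using eventually_norm_gt_at_infinity[of 1]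
  proof eventually_elim
    case (elim x)
    have "norm x powr (a - p) * (\<bar>f x\<bar> * \<bar>w x\<bar>) \<le> norm x powr (a - p) * (\<bar>f x\<bar> * (C * norm x powr p))"
      by (intro mult_left_mono assms(2) elim) auto
    also have "\<dots> = C * ((norm x powr (a - p) * norm x powr p) * \<bar>f x\<bar>)"
      by (simp add: mult_ac)
    also have "norm x powr (a - p) * norm x powr p = norm x powr a"
      by (simp add: powr_add[symmetric])
    finally show ?case
      by (simp add: abs_mult)
  qed
qed

lemma little_o_sum:
  assumes "\<And>i. i \<in> A \<Longrightarrow> little_o a (f i)"
  shows "little_o a (\<lambda>x. \<Sum>i\<in>A. f i x)"
proof (cases "finite A")
  case True
  then show ?thesis
    using assms by (induction A rule: finite_induct) (auto simp: little_o_add)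
qed simp

lemma nu_e_component: "nu_e x $ k = x $ k / norm x"
  by (simp add: nu_e_def divide_inverse mult.commute)

lemma abs_nu_e_component_le_1: "\<bar>nu_e x $ k\<bar> \<le> 1"
  using component_le_norm_cart[of x k] by (cases "x = 0") (auto simp: nu_e_component divide_le_eq_1)

lemma nu_e_reflect: "nu_e (- x) $ k = - nu_e x $ k"
  by (simp add: nu_e_component)

lemma Yfield_reflect: "Yfield a (- x) $ i = Yfield a x $ i"
  by (simp add: Yfield_def)

lemma abs_Yfield_component_le: "\<bar>Yfield a x $ i\<bar> \<le> 3 * (norm x)\<^sup>2"
proof -
  have "\<bar>x $ a * x $ i\<bar> \<le> (norm x)\<^sup>2"
    unfolding abs_mult power2_eq_square by (intro mult_mono component_le_norm_cart) auto
  moreover have "\<bar>(norm x)\<^sup>2 * (if a = i then 1 else 0)\<bar> \<le> (norm x)\<^sup>2"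
    by auto
  moreover have "Yfield a x $ i = (norm x)\<^sup>2 * (if a = i then 1 else 0) - 2 * (x $ a * x $ i)"
    by (simp add: Yfield_def)
  ultimately show ?thesis
    by linarith
qed

lemma continuous_on_nu_e: "continuous_on {x::real^'n::finite. norm x > 1} (\<lambda>x. nu_e x $ k)"
  unfolding nu_e_component by (intro continuous_intros) auto

section \<open>The classical mass and center integrals on S_r\<close>

context symmetric_C2_tensor
begin

lemma sphere_int_mass:
  assumes r: "r > 1"
  shows "sphere_int r (\<lambda>x. \<Sum>i\<in>UNIV. \<Sum>j\<in>UNIV. (dg i j j x - dg j j i x) * nu_e x $ i) =
    - (1 / r) * sphere_int r (\<lambda>x. \<Sum>j\<in>UNIV. mass_density j x * x $ j)"
  unfolding sphere_int_cmult[symmetric]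
proof (rule sphere_int_cong)
  fix x :: "real^'n"
  assume x: "norm x = r"
  have "(\<Sum>j\<in>UNIV. (dg i j j x - dg j j i x) * nu_e x $ i) = - (1 / r) * (mass_density i x * x $ i)" for i
  proof -
    have "(\<Sum>j\<in>UNIV. (dg i j j x - dg j j i x) * nu_e x $ i) = (\<Sum>j\<in>UNIV. dg i j j x - dg j j i x) * nu_e x $ i"
      by (rule sum_distrib_right[symmetric])
    also have "(\<Sum>j\<in>UNIV. dg i j j x - dg j j i x) = - mass_density i x"
      by (simp add: mass_density_def sum_subtractf)
    finally show ?thesis
      using x by (simp add: nu_e_component)
  qed
  then show "(\<Sum>i\<in>UNIV. \<Sum>j\<in>UNIV. (dg i j j x - dg j j i x) * nu_e x $ i) =
    - (1 / r) * (\<Sum>j\<in>UNIV. mass_density j x * x $ j)"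
    by (simp only: sum_distrib_left)
qed (use r in simp)

text \<open>Symmetry of g turns g_ij,i - g_ii,j into minus \<open>mass_density j\<close>, the normal
  x/r gives the factor 1/r, and the zero-order terms are exactly those produced by
  \<open>sphere_int_potential\<close>.\<close>

lemma sphere_int_center:
  assumes r: "r > 1"
  shows "sphere_int r (\<lambda>x. x $ a * (\<Sum>i\<in>UNIV. \<Sum>j\<in>UNIV. (dg i j i x - dg i i j x) * nu_e x $ j)
        - ((\<Sum>i\<in>UNIV. g x $ i $ a * nu_e x $ i) - (\<Sum>i\<in>UNIV. g x $ i $ i) * nu_e x $ a)) =
    (1 / r) * sphere_int r (\<lambda>x. x $ a * (\<Sum>l\<in>UNIV. gc g l l x) - (\<Sum>i\<in>UNIV. x $ i * gc g i a x)
      - x $ a * (\<Sum>j\<in>UNIV. mass_density j x * x $ j))"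
  unfolding sphere_int_cmult[symmetric]
proof (rule sphere_int_cong)
  fix x :: "real^'n"
  assume x: "norm x = r"
  then have x1: "norm x > 1"
    using r by simp
  have "(\<Sum>i\<in>UNIV. \<Sum>j\<in>UNIV. (dg i j i x - dg i i j x) * nu_e x $ j) =
    (\<Sum>j\<in>UNIV. \<Sum>i\<in>UNIV. (dg i j i x - dg i i j x) * nu_e x $ j)"
    by (rule sum.swap)
  also have "\<dots> = (\<Sum>j\<in>UNIV. - (1 / r) * (mass_density j x * x $ j))"
  proof (intro sum.cong refl)
    fix j
    have "(\<Sum>i\<in>UNIV. (dg i j i x - dg i i j x) * nu_e x $ j) = (\<Sum>i\<in>UNIV. dg i j i x - dg i i j x) * nu_e x $ j"
      by (rule sum_distrib_right[symmetric])
    also have "(\<Sum>i\<in>UNIV. dg i j i x - dg i i j x) = - mass_density j x"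
      using dg_sym[OF x1, of _ j] by (simp add: mass_density_def sum_subtractf)
    finally show "(\<Sum>i\<in>UNIV. (dg i j i x - dg i i j x) * nu_e x $ j) = - (1 / r) * (mass_density j x * x $ j)"
      using x by (simp add: nu_e_component)
  qed
  finally have 1: "(\<Sum>i\<in>UNIV. \<Sum>j\<in>UNIV. (dg i j i x - dg i i j x) * nu_e x $ j) =
    - (1 / r) * (\<Sum>j\<in>UNIV. mass_density j x * x $ j)"
    by (simp only: sum_distrib_left)
  have 2: "(\<Sum>i\<in>UNIV. g x $ i $ a * nu_e x $ i) = (1 / r) * (\<Sum>i\<in>UNIV. x $ i * gc g i a x)"
    using x by (simp add: nu_e_component gc_def sum_distrib_left mult_ac)
  have 3: "(\<Sum>i\<in>UNIV. g x $ i $ i) * nu_e x $ a = (1 / r) * (x $ a * (\<Sum>l\<in>UNIV. gc g l l x))"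
    using x by (simp add: nu_e_component gc_def)
  show "x $ a * (\<Sum>i\<in>UNIV. \<Sum>j\<in>UNIV. (dg i j i x - dg i i j x) * nu_e x $ j)
        - ((\<Sum>i\<in>UNIV. g x $ i $ a * nu_e x $ i) - (\<Sum>i\<in>UNIV. g x $ i $ i) * nu_e x $ a) =
    (1 / r) * (x $ a * (\<Sum>l\<in>UNIV. gc g l l x) - (\<Sum>i\<in>UNIV. x $ i * gc g i a x)
      - x $ a * (\<Sum>j\<in>UNIV. mass_density j x * x $ j))"
    unfolding 1 2 3 by (simp add: algebra_simps)
qed (use r in simp)

end

context asymp_flat_metric
begin

definition flux_error :: "(real^'n \<Rightarrow> real^'n) \<Rightarrow> real^'n \<Rightarrow> real" where
  "flux_error V x = (\<Sum>i\<in>UNIV. \<Sum>k\<in>UNIV. (flux i k x - Ein_lin i k x) * (V x $ i * nu_e x $ k))"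

lemma continuous_on_flux_error:
  assumes "\<And>i. continuous_on {x. norm x > 1} (\<lambda>x. V x $ i)"
  shows "continuous_on {x. norm x > 1} (flux_error V)"
  unfolding flux_error_def[abs_def]
  by (intro continuous_on_sum continuous_on_mult continuous_on_diff continuous_on_flux continuous_on_Ein_lin
      continuous_on_nu_e assms)

text \<open>An exact splitting at each radius: the first integral is evaluated in closed form for X
  and Y, the second is all that remains of the difference.\<close>

lemma sphere_int_flux:
  assumes r: "r > 1" and V: "\<And>i. continuous_on {x. norm x > 1} (\<lambda>x. V x $ i)"
  shows "sphere_int r (\<lambda>x. (\<Sum>i\<in>UNIV. \<Sum>j\<in>UNIV. Ein g i j x * V x $ i * nu_g g x $ j) * area_g g x)
    = (1 / r) * sphere_int r (\<lambda>x. \<Sum>i\<in>UNIV. \<Sum>j\<in>UNIV. Ein_lin i j x * V x $ i * x $ j) + sphere_int r (flux_error V)"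
proof -
  have r0: "r > 0" and sub: "sphere (0::real^'n) r \<subseteq> {x. norm x > 1}"
    using r by auto
  have cL: "continuous_on {x. norm x > 1} (\<lambda>x. \<Sum>i\<in>UNIV. \<Sum>j\<in>UNIV. Ein_lin i j x * V x $ i * x $ j)"
    by (intro continuous_on_sum continuous_on_mult continuous_on_Ein_lin V continuous_on_component continuous_on_id)
  have "sphere_int r (\<lambda>x. (\<Sum>i\<in>UNIV. \<Sum>j\<in>UNIV. Ein g i j x * V x $ i * nu_g g x $ j) * area_g g x)
    = sphere_int r (\<lambda>x. (1 / r) * (\<Sum>i\<in>UNIV. \<Sum>j\<in>UNIV. Ein_lin i j x * V x $ i * x $ j) + flux_error V x)"
  proof (rule sphere_int_cong[OF r0])
    fix x :: "real^'n"
    assume x: "norm x = r"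
    then have x1: "norm x > 1"
      using r by simp
    show "(\<Sum>i\<in>UNIV. \<Sum>j\<in>UNIV. Ein g i j x * V x $ i * nu_g g x $ j) * area_g g x
      = (1 / r) * (\<Sum>i\<in>UNIV. \<Sum>j\<in>UNIV. Ein_lin i j x * V x $ i * x $ j) + flux_error V x"
      unfolding surface_integrand_eq[OF x1, of "\<lambda>i. V x $ i"] flux_error_def sum_distrib_left sum.distrib[symmetric]
      using x by (intro sum.cong refl) (simp add: nu_e_component algebra_simps)
  qed
  also have "\<dots> = sphere_int r (\<lambda>x. (1 / r) * (\<Sum>i\<in>UNIV. \<Sum>j\<in>UNIV. Ein_lin i j x * V x $ i * x $ j)) + sphere_int r (flux_error V)"
    by (intro sphere_int_add r0 continuous_on_mult continuous_on_const continuous_on_subset[OF cL sub]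
        continuous_on_subset[OF continuous_on_flux_error[OF V] sub])
  finally show ?thesis
    by (simp only: sphere_int_cmult)
qed

end

context asymp_flat_metric_decay
begin

text \<open>Power count: o(|x|^(-n)) times |x| is o(|x|^(1-n)), just enough against the area
  r^(n-1).\<close>

lemma flux_error_radial_tendsto_0:
  assumes "2 * \<tau> + 2 = real CARD('n)"
  shows "((\<lambda>r. sphere_int r (flux_error (\<lambda>x. x))) \<longlongrightarrow> 0) at_top"
proof (rule sphere_int_tendsto_0)
  show "continuous_on {x. norm x > 1} (flux_error (\<lambda>x. x))"
    by (intro continuous_on_flux_error continuous_intros)
  have "little_o (2 * \<tau> + 2 - 1) (\<lambda>x. (flux i k x - Ein_lin i k x) * (x $ i * nu_e x $ k))" for i k
  proof (rule little_o_mult_bounded[where C = 1])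
    show "little_o (2 * \<tau> + 2) (\<lambda>x. flux i k x - Ein_lin i k x)"
      using decays_flux_error[of i k] by (simp add: decays_def)
    show "\<bar>x $ i * nu_e x $ k\<bar> \<le> 1 * norm x powr 1" if "norm x > 1" for x :: "real^'n"
      using mult_mono[OF component_le_norm_cart[of x i] abs_nu_e_component_le_1[of x k]] that
      by (simp add: abs_mult)
  qed
  then have "little_o (2 * \<tau> + 2 - 1) (flux_error (\<lambda>x. x))"
    unfolding flux_error_def[abs_def] by (intro little_o_sum)
  then show "little_o (real (CARD('n) - 1)) (flux_error (\<lambda>x. x))"
    using assms by (simp add: of_nat_diff)
qed

text \<open>\<open>Yfield\<close> is even and the normal odd, so adding the value at -x leaves the
  parity defect of the error, of order 2\<tau> + 3 = n + 1; the weight |x|^2 brings it to n -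
  1.\<close>

lemma flux_error_conformal_tendsto_0:
  assumes "2 * \<tau> + 2 = real CARD('n)" "\<delta> = 1"
  shows "((\<lambda>r. sphere_int r (flux_error (Yfield a))) \<longlongrightarrow> 0) at_top"
proof (rule sphere_int_tendsto_0_even)
  show "continuous_on {x. norm x > 1} (flux_error (Yfield a))"
    by (rule continuous_on_flux_error[OF Ck_on_1D(2)[OF Ck_on_1_Yfield open_norm_gt]])
  let ?E = "\<lambda>i k x. flux i k x - Ein_lin i k x"
  have "little_o (2 * \<tau> + 2 + 1 - 2) (\<lambda>x. (?E i k x - ?E i k (- x)) * (Yfield a x $ i * nu_e x $ k))" for i k
  proof (rule little_o_mult_bounded[where C = 3])
    show "little_o (2 * \<tau> + 2 + 1) (\<lambda>x. ?E i k x - ?E i k (- x))"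
      using decays_flux_error[of i k] assms(2) by (simp add: decays_def)
    show "\<bar>Yfield a x $ i * nu_e x $ k\<bar> \<le> 3 * norm x powr 2" if "norm x > 1" for x :: "real^'n"
      using mult_mono[OF abs_Yfield_component_le[of a x i] abs_nu_e_component_le_1[of x k]] that
      by (simp add: abs_mult)
  qed
  then have "little_o (2 * \<tau> + 2 + 1 - 2) (\<lambda>x. \<Sum>i\<in>UNIV. \<Sum>k\<in>UNIV. (?E i k x - ?E i k (- x)) * (Yfield a x $ i * nu_e x $ k))"
    by (intro little_o_sum)
  moreover have "(\<Sum>i\<in>UNIV. \<Sum>k\<in>UNIV. (?E i k x - ?E i k (- x)) * (Yfield a x $ i * nu_e x $ k))
    = flux_error (Yfield a) x + flux_error (Yfield a) (- x)" for x
    unfolding flux_error_def sum.distrib[symmetric]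
    by (intro sum.cong refl) (simp add: nu_e_reflect Yfield_reflect algebra_simps)
  ultimately show "little_o (real (CARD('n) - 1)) (\<lambda>x. flux_error (Yfield a) x + flux_error (Yfield a) (- x))"
    using assms by (simp add: of_nat_diff)
qed

end

context asymp_flat_metric
begin

text \<open>The factor (n-2)/2 of \<open>sphere_int_Ein_lin_radial\<close> divided by (n-1)(2-n) is
  -1/(2(n-1)), so the linear parts cancel and only the error is left.\<close>

lemma mass_difference:
  assumes r: "r > 1" and n: "CARD('n) \<ge> 3"
  shows "mass_r g r - mass_I g r =
    - (1 / ((real CARD('n) - 1) * (2 - real CARD('n)) * omega TYPE('n))) * sphere_int r (flux_error (\<lambda>x. x))"
proof -
  define S where "S = (1 / r) * sphere_int r (\<lambda>x. \<Sum>j\<in>UNIV. mass_density j x * x $ j)"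
  have 1: "mass_r g r = 1 / (2 * (real CARD('n) - 1) * omega TYPE('n)) * (- S)"
    unfolding mass_r_def sphere_int_mass[OF r] S_def by simp
  have "mass_I g r = 1 / ((real CARD('n) - 1) * (2 - real CARD('n)) * omega TYPE('n)) *
    ((real CARD('n) - 2) / 2 * S + sphere_int r (flux_error (\<lambda>x. x)))"
    unfolding mass_I_def S_def
    by (subst sphere_int_flux[OF r]) (auto simp: sphere_int_Ein_lin_radial[OF r] intro: continuous_intros)
  moreover have "1 / ((real CARD('n) - 1) * (2 - real CARD('n)) * omega TYPE('n)) * ((real CARD('n) - 2) / 2 * S)
    = 1 / (2 * (real CARD('n) - 1) * omega TYPE('n)) * (- S)"
    \<comment> \<open>If \<open>omega\<close> is 0, both sides are 0 by the convention for
      division.\<close>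
    using n by (cases "omega TYPE('n) = 0") (auto simp: divide_simps, simp add: algebra_simps)
  ultimately show ?thesis
    unfolding 1 by (simp add: distrib_left)
qed

lemma center_difference:
  assumes r: "r > 1" and n: "CARD('n) \<ge> 3"
  shows "(c_CS g m r - c_I g m r) $ a =
    - (1 / (2 * (real CARD('n) - 1) * (real CARD('n) - 2) * omega TYPE('n) * m)) * sphere_int r (flux_error (Yfield a))"
proof -
  define S where "S = (1 / r) * sphere_int r (\<lambda>x. x $ a * (\<Sum>l\<in>UNIV. gc g l l x) - (\<Sum>i\<in>UNIV. x $ i * gc g i a x)
      - x $ a * (\<Sum>j\<in>UNIV. mass_density j x * x $ j))"
  have 1: "c_CS g m r $ a = 1 / (2 * (real CARD('n) - 1) * omega TYPE('n) * m) * S"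
    unfolding c_CS_def vec_lambda_beta sphere_int_center[OF r] S_def ..
  have "c_I g m r $ a = 1 / (2 * (real CARD('n) - 1) * (real CARD('n) - 2) * omega TYPE('n) * m) *
    ((real CARD('n) - 2) * S + sphere_int r (flux_error (Yfield a)))"
    unfolding c_I_def vec_lambda_beta S_def
    by (subst sphere_int_flux[OF r Ck_on_1D(2)[OF Ck_on_1_Yfield open_norm_gt]])
      (simp add: sphere_int_Ein_lin_conformal[OF r])
  moreover have "1 / (2 * (real CARD('n) - 1) * (real CARD('n) - 2) * omega TYPE('n) * m) * ((real CARD('n) - 2) * S)
    = 1 / (2 * (real CARD('n) - 1) * omega TYPE('n) * m) * S"
    using n by simp
  ultimately show ?thesis
    unfolding vector_minus_component 1 by (simp add: distrib_left)
qed

end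

section \<open>Comparison of mass and center\<close>

lemma little_o_kD:
  assumes "little_o_k 2 a f"
  shows "little_o a f" "little_o (1 + a) (pd k f)" "little_o (2 + a) (pd l (pd k f))"
proof -
  have "little_o (real (length is) + a) (pds is f)" if "length is \<le> 2" for "is"
  proof -
    have "((\<lambda>x. \<bar>norm x powr (real (length is) + a) * pds is f x\<bar>) \<longlongrightarrow> 0) at_infinity"
      using assms that by (simp add: little_o_k_def abs_mult)
    then show ?thesis
      by (simp only: tendsto_rabs_zero_iff)
  qed
  from this[of "[]"] this[of "[k]"] this[of "[l, k]"]
  show "little_o a f" "little_o (1 + a) (pd k f)" "little_o (2 + a) (pd l (pd k f))"
    by simp_all
qed

context symmetric_C2_tensor
begin

text \<open>The derivative of the odd part is half the defect of \<open>dg\<close> from parity -1;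
  this is how the Regge-Teitelboim condition becomes a statement about
  \<open>decays\<close>.\<close>

lemma pd_odd_part_gc:
  assumes "norm x > 1"
  shows "pd k (odd_part (gc g i j)) x = (dg i j k x + dg i j k (- x)) / 2"
proof -
  have "odd_part (gc g i j) = (\<lambda>x. 1/2 * (gc g i j x - gc g i j (- x)))"
    by (simp add: odd_part_def fun_eq_iff)
  then show ?thesis
    using assms by (simp only: pd_cmult pd_diff pd_reflect differentiable_diff differentiable_reflect
        gc_differentiable norm_minus_cancel) simp
qed

lemma pd_pd_odd_part_gc:
  assumes "norm x > 1"
  shows "pd l (pd k (odd_part (gc g i j))) x = (ddg i j k l x - ddg i j k l (- x)) / 2"
proof -
  have "pd l (pd k (odd_part (gc g i j))) x = pd l (\<lambda>x. 1/2 * (dg i j k x + dg i j k (- x))) x"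
    using assms by (intro pd_cong_open[OF open_norm_gt[of 1]]) (auto simp: pd_odd_part_gc)
  then show ?thesis
    using assms by (simp only: pd_cmult pd_add pd_reflect differentiable_add differentiable_reflect
        dg_differentiable norm_minus_cancel) simp
qed

end

theorem theorem1p1:
  fixes g :: "real^'n::finite \<Rightarrow> real^'n^'n"
  assumes n3: "CARD('n) \<ge> 3"
    and sym: "\<And>x. norm x > 1 \<Longrightarrow> transpose (g x) = g x"
    and posdef: "\<And>x v. norm x > 1 \<Longrightarrow> v \<noteq> 0 \<Longrightarrow> v \<bullet> (g x *v v) > 0"
    and C2: "\<And>i j. Ck_on 2 {x. norm x > 1} (gc g i j)"
    and decay: "\<And>i j. little_o_k 2 ((real CARD('n) - 2) / 2)
                  (\<lambda>x. g x $ i $ j - (if i = j then 1 else 0))"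
  shows "((\<lambda>r. mass_r g r - mass_I g r) \<longlongrightarrow> 0) at_top \<and>
         (\<forall>m. (\<forall>i j. little_o_k 2 (real CARD('n) / 2) (odd_part (gc g i j))) \<and>
              ((\<lambda>r. mass_r g r) \<longlongrightarrow> m) at_top \<and> m \<noteq> 0
          \<longrightarrow> ((\<lambda>r. c_CS g m r - c_I g m r) \<longlongrightarrow> 0) at_top)"
proof (intro conjI allI impI)
  define \<tau> where "\<tau> = (real CARD('n) - 2) / 2"
  have \<tau>: "\<tau> \<ge> 0" "2 * \<tau> + 2 = real CARD('n)"
    using n3 by (auto simp: \<tau>_def field_simps)
  interpret asymp_flat_metric g
    by unfold_locales (fact sym, fact C2, fact posdef)
  have lo: "little_o \<tau> (\<lambda>x. gc g i j x - (if i = j then 1 else 0))"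
    "little_o (\<tau> + 1) (dg i j k)" "little_o (\<tau> + 2) (ddg i j k l)" for i j k l
    using little_o_kD(1)[OF decay[of i j]] little_o_kD(2)[OF decay[of i j], of k]
      little_o_kD(3)[OF decay[of i j], of l k]
    by (simp_all add: pd_diff_const gc_def \<tau>_def add_ac)
  {
    \<comment> \<open>With \<delta> = 0, \<open>decays_0\<close> derives each parity requirement
      from decay. The block confines this instance, so that one with \<delta> = 1 can
      follow.\<close>
    interpret asymp_flat_metric_decay g 0 \<tau>
      by unfold_locales (rule \<tau>(1) | (unfold asymp_const_def)?, rule decays_0, rule lo)+
    have "((\<lambda>r. - (1 / ((real CARD('n) - 1) * (2 - real CARD('n)) * omega TYPE('n))) *
        sphere_int r (flux_error (\<lambda>x. x))) \<longlongrightarrow> 0) at_top"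
      by (rule tendsto_mult_right_zero[OF flux_error_radial_tendsto_0[OF \<tau>(2)]])
    then show "((\<lambda>r. mass_r g r - mass_I g r) \<longlongrightarrow> 0) at_top"
      by (rule Lim_transform_eventually)
        (use eventually_gt_at_top[of 1] in \<open>eventually_elim, simp add: mass_difference n3\<close>)
  }
  fix m
  assume asm: "(\<forall>i j. little_o_k 2 (real CARD('n) / 2) (odd_part (gc g i j))) \<and>
    ((\<lambda>r. mass_r g r) \<longlongrightarrow> m) at_top \<and> m \<noteq> 0"
  have odd: "little_o (\<tau> + 1) (odd_part (gc g i j))"
    "little_o (\<tau> + 2) (pd k (odd_part (gc g i j)))" "little_o (\<tau> + 3) (pd l (pd k (odd_part (gc g i j))))" for i j k l
  proof -
    \<comment> \<open>The order n/2 exceeds (n-2)/2 by one: this is the gain \<delta> = 1.\<close>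
    have e: "real CARD('n) / 2 = \<tau> + 1"
      by (simp add: \<tau>_def field_simps)
    show "little_o (\<tau> + 1) (odd_part (gc g i j))"
      "little_o (\<tau> + 2) (pd k (odd_part (gc g i j)))" "little_o (\<tau> + 3) (pd l (pd k (odd_part (gc g i j))))"
      using asm little_o_kD(1)[of "\<tau> + 1" "odd_part (gc g i j)"] little_o_kD(2)[of "\<tau> + 1" "odd_part (gc g i j)" k]
        little_o_kD(3)[of "\<tau> + 1" "odd_part (gc g i j)" l k]
      unfolding e by (auto simp: add_ac)
  qed
  interpret asymp_flat_metric_decay g 1 \<tau>
  \<comment> \<open>Each parity defect is twice the odd part or one of its derivatives: g and its
    second derivatives are compared with parity 1, first derivatives with -1.\<close>
  proof unfold_locales
    show "asymp_const 1 \<tau> (if i = j then 1 else 0) (gc g i j)" for i j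
      unfolding asymp_const_def decays_def
      using lo(1) little_o_cong[OF little_o_cmult[OF odd(1)[of i j], of 2], of "\<lambda>x. gc g i j x - gc g i j (- x)"]
      by (simp add: odd_part_def)
    show "decays 1 (- 1) (\<tau> + 1) (dg i j k)" for i j k
      unfolding decays_def
      using lo(2) little_o_cong[OF little_o_cmult[OF odd(2)[of k i j], of 2], of "\<lambda>x. dg i j k x - - 1 * dg i j k (- x)"]
      by (simp add: pd_odd_part_gc add.assoc)
    show "decays 1 1 (\<tau> + 2) (ddg i j k l)" for i j k l
      unfolding decays_def
      using lo(3) little_o_cong[OF little_o_cmult[OF odd(3)[of l k i j], of 2], of "\<lambda>x. ddg i j k l x - 1 * ddg i j k l (- x)"]
      by (simp add: pd_pd_odd_part_gc add.assoc)
  qed (fact \<tau>(1))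
  show "((\<lambda>r. c_CS g m r - c_I g m r) \<longlongrightarrow> 0) at_top"
  proof (rule vec_tendstoI)
    fix a
    have "((\<lambda>r. - (1 / (2 * (real CARD('n) - 1) * (real CARD('n) - 2) * omega TYPE('n) * m)) *
        sphere_int r (flux_error (Yfield a))) \<longlongrightarrow> 0) at_top"
      by (rule tendsto_mult_right_zero[OF flux_error_conformal_tendsto_0[OF \<tau>(2) refl]])
    then show "((\<lambda>r. (c_CS g m r - c_I g m r) $ a) \<longlongrightarrow> 0 $ a) at_top"
      unfolding zero_index
      by (rule Lim_transform_eventually)
        (use eventually_gt_at_top[of 1] in \<open>eventually_elim, simp only: center_difference n3\<close>)
  qed
qed

end
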